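(* $$\lim_{X\to\infty}\frac{\sum_{0<n<X,\ n \text{ squarefree}} \#\mathcal{F}^{6n,\mathrm{sol}}_{n^2}}{\sum_{0<n<X,\ n\text{ squarefree}} \#\mathcal{F}^{6n,\mathrm{ls}}_{n^2}} =\lim_{X\to\infty}\frac{\sum_{0<n<X,\ n \text{ squarefree}} \#\mathcal{F}^{-6n,\mathrm{sol}}_{n^2}}{\sum_{0<n<X,\ n\text{ squarefree}} \#\mathcal{F}^{-6n,\mathrm{ls}}_{n^2}}= 1.$$
   Context: For integers $B,M$, $W^B_M(\mathbb{Z})$ is the set of binary quartic forms $ax^4+Bx^2y^2+cy^4$ with $a,c\in\mathbb{Z}$, $ac=M$, and $\mathcal{F}^B_M=\{ax^4+Bx^2y^2+cy^4\in W^B_M(\mathbb{Z}): 0\le\operatorname{ord}_pa\le1 \text{ for all primes } p\}$. A form $f$ is locally soluble if for every place $v$ of $\mathbb{Q}$ there are $x,y,z\in\mathbb{Q}_v$, $(x,y)\ne(0,0)$, with $z^2=f(x,y)$; it is soluble if such $x,y,z$ exist in $\mathbb{Q}$. $\mathcal{F}^{B,\mathrm{ls}}_M$ and $\mathcal{F}^{B,\mathrm{sol}}_M$ denote the locally soluble and soluble elements of $\mathcal{F}^B_M$. *)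

theory Defs
  imports Complex_Main "HOL-Computational_Algebra.Squarefree"
begin

definition qform :: "'a::comm_ring_1 \<Rightarrow> 'a \<Rightarrow> 'a \<Rightarrow> 'a \<Rightarrow> 'a \<Rightarrow> 'a" where
  "qform a B c x y = a * x^4 + B * x^2 * y^2 + c * y^4"

text \<open>p-adic integers as the inverse limit of Z/p^k Z: a representative sequence
  X k (an integer standing for its class mod p^k) with X (k+1) = X k mod p^k.
  Two such sequences represent the same p-adic integer iff they agree mod p^k for every k;
  ring operations are componentwise.\<close>
definition padic_seq :: "nat \<Rightarrow> (nat \<Rightarrow> int) \<Rightarrow> bool" where
  "padic_seq p X \<longleftrightarrow> (\<forall>k. X (Suc k) mod (int p ^ k) = X k mod (int p ^ k))"

text \<open>Solubility over Q_p of z^2 = f(x,y), (x,y) \<noteq> (0,0). Clearing denominators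
  (x = X/p^m, y = Y/p^m, z = Z/p^(2m), using homogeneity) this is: there are p-adic
  integers X, Y, Z with (X,Y) \<noteq> (0,0) in Z_p and Z^2 = f(X,Y) in Z_p.\<close>
definition soluble_Qp :: "nat \<Rightarrow> int \<Rightarrow> int \<Rightarrow> int \<Rightarrow> bool" where
  "soluble_Qp p a B c \<longleftrightarrow>
     (\<exists>X Y Z. padic_seq p X \<and> padic_seq p Y \<and> padic_seq p Z \<and>
        (\<exists>k. X k mod (int p ^ k) \<noteq> 0 \<or> Y k mod (int p ^ k) \<noteq> 0) \<and>
        (\<forall>k. (Z k)^2 mod (int p ^ k) = qform a B c (X k) (Y k) mod (int p ^ k)))"

definition soluble_R :: "int \<Rightarrow> int \<Rightarrow> int \<Rightarrow> bool" where
  "soluble_R a B c \<longleftrightarrow>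
     (\<exists>x y z :: real. (x, y) \<noteq> (0, 0) \<and> z^2 = qform (of_int a) (of_int B) (of_int c) x y)"

definition locally_soluble :: "int \<Rightarrow> int \<Rightarrow> int \<Rightarrow> bool" where
  "locally_soluble a B c \<longleftrightarrow> soluble_R a B c \<and> (\<forall>p. prime p \<longrightarrow> soluble_Qp p a B c)"

definition soluble :: "int \<Rightarrow> int \<Rightarrow> int \<Rightarrow> bool" where
  "soluble a B c \<longleftrightarrow>
     (\<exists>x y z :: rat. (x, y) \<noteq> (0, 0) \<and> z^2 = qform (of_int a) (of_int B) (of_int c) x y)"

text \<open>F^B_M, with the form a x^4 + B x^2 y^2 + c y^4 identified with the pair (a, c).\<close>
definition FF :: "int \<Rightarrow> int \<Rightarrow> (int \<times> int) set" where
  "FF B M = {(a, c). a * c = M \<and> (\<forall>p::nat. prime p \<longrightarrow> 0 \<le> multiplicity (int p) a \<and> multiplicity (int p) a \<le> 1)}"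

definition FF_ls :: "int \<Rightarrow> int \<Rightarrow> (int \<times> int) set" where
  "FF_ls B M = {(a, c) \<in> FF B M. locally_soluble a B c}"

definition FF_sol :: "int \<Rightarrow> int \<Rightarrow> (int \<times> int) set" where
  "FF_sol B M = {(a, c) \<in> FF B M. soluble a B c}"

end

theory Submission
  imports Defs "HOL-Number_Theory.Number_Theory" "HOL-Real_Asymp.Real_Asymp" "HOL-Analysis.Convex"
begin

text \<open>The form with $a = 1$ is soluble for every $n$, so it suffices that the locally soluble forms
  with $a \neq 1$ number $o(X)$. Write $a = \eta d$, $n = 2^k d m$ with $d$, $m$ odd. Local solubility
  at the odd primes forces $a$ to be a square modulo every $p \mid m$, and both $2$ and
  $\pm m$ to be squares modulo every $p \mid d$. If $d$ or $m$ is at most a power of $\ln X$, one of these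
  conditions already saves a power of the logarithm: for a real character $\chi$ modulo $q$ the
  numbers composed of primes with $\chi(p) = 1$ have small density, uniformly in $q$, because the
  square of $\sum 1/m$ over them is at most a partial sum of $\sum (1 * \chi)(k)/k$. If both are large,
  one expands the conditions into Jacobi symbols as Heath-Brown does for the congruent number
  curves. A large sieve bound handles the terms with two large linked variables, and the
  remaining terms are bounded trivially, with mean $(\ln X)^{-1/4}$ up to powers of
  $\ln \ln X$.\<close>

section \<open>The Jacobi symbol\<close>

text \<open>The form attached to \<open>B = 6 * s * n\<close>, with \<open>s\<close> a sign, and
  \<open>a * c = n^2\<close> has \<open>B^2 - 4 * a * c = 32 * n^2\<close>, twice a square. This is
  where the residue condition on 2 modulo \<open>d\<close> comes from, and that condition decides
  the matter. The mutual residue conditions between \<open>d\<close> and \<open>m\<close> save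
  nothing on average: expanded into symbols, they leave main terms with trivial symbols, in which
  the factorizations of a squarefree number \<open>n\<close> have total weight 1. Once 2 must also
  be a residue modulo every prime of \<open>d\<close>, a prime with 2 as nonresidue can only divide
  \<open>m\<close> and keeps weight 1/2. Averaged over the primes the weight is 3/4, which is the
  origin of the exponent -1/4. The obstacle is uniformity. The characters that arise for small
  \<open>d\<close> have moduli growing with X, where an asymptotic formula for primes would be deep.
  A bound that loses a power of \<open>ln q\<close> is enough, since \<open>q\<close> stays below a
  power of \<open>ln X\<close>; such a bound follows from the trivial estimate of a character sum by
  its period.\<close>

lemma Legendre_cong:
  assumes "[a = b] (mod p)"
  shows "Legendre a p = Legendre b p"
proof -
  have "[a = 0] (mod p) \<longleftrightarrow> [b = 0] (mod p)"
    using assms cong_trans cong_sym by blast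
  moreover have "QuadRes p a \<longleftrightarrow> QuadRes p b"
    unfolding QuadRes_def using assms cong_trans cong_sym by blast
  ultimately show ?thesis by (simp add: Legendre_def)
qed

lemma Legendre_values: "Legendre a p \<in> {-1, 0, 1}"
  by (simp add: Legendre_def)

lemma sign_cong_imp_eq:
  fixes x y :: int
  assumes "[x = y] (mod int p)" "x \<in> {-1, 0, 1}" "y \<in> {-1, 0, 1}" "2 < p"
  shows "x = y"
proof (rule ccontr)
  assume "x \<noteq> y"
  then have "int p \<le> \<bar>x - y\<bar>"
    using assms(1) zdvd_imp_le[of "int p" "\<bar>x - y\<bar>"] by (simp add: cong_iff_dvd_diff)
  then show False using assms(2-4) by auto
qed

lemma Legendre_mult:
  assumes "prime p" "2 < p"
  shows "Legendre (a * b) (int p) = Legendre a (int p) * Legendre b (int p)"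
proof -
  have "[Legendre (a * b) p = (a * b) ^ ((p - 1) div 2)] (mod p)"
    by (rule euler_criterion[OF assms])
  moreover have "[Legendre a p * Legendre b p = a ^ ((p - 1) div 2) * b ^ ((p - 1) div 2)] (mod p)"
    by (intro cong_mult euler_criterion[OF assms])
  ultimately have "[Legendre (a * b) p = Legendre a p * Legendre b p] (mod p)"
    by (metis cong_sym cong_trans power_mult_distrib)
  then show ?thesis
    by (rule sign_cong_imp_eq[OF _ Legendre_values _ assms(2)])
      (use Legendre_values[of a p] Legendre_values[of b p] in auto)
qed

lemma odd_prime_induct [consumes 1, case_names one mult]:
  fixes m :: nat
  assumes "odd m" "P 1"
    and "\<And>p m. prime p \<Longrightarrow> odd p \<Longrightarrow> odd m \<Longrightarrow> P m \<Longrightarrow> P (p * m)"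
  shows "P m"
  using assms(1)
proof (induction m rule: less_induct)
  case (less m)
  show ?case
  proof (cases "m = 1")
    case False
    then obtain p where p: "prime p" "p dvd m" using prime_factor_nat by blast
    then obtain k where k: "m = p * k" by blast
    have "odd p" "odd k" using less.prems k by auto
    moreover have "k < m"
      using k prime_gt_1_nat[OF p(1)] \<open>odd k\<close> n_less_m_mult_n[of k p] odd_pos by (simp add: mult.commute)
    ultimately show ?thesis using assms(3)[OF p(1), of k] less.IH[of k] k by blast
  qed (use assms in simp)
qed

text \<open>Only odd $m$ is meaningful: $\mathrm{jacobi}\;b\;0 = 1$, and the factor at 2 is not
  Kronecker's.\<close>
definition jacobi :: "int \<Rightarrow> nat \<Rightarrow> int" where
  "jacobi b m = (\<Prod>p\<in>#prime_factorization m. Legendre b (int p))"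

lemma jacobi_1 [simp]: "jacobi b 1 = 1" "jacobi b (Suc 0) = 1"
  by (simp_all add: jacobi_def)

lemma jacobi_mult_right:
  "m \<noteq> 0 \<Longrightarrow> n \<noteq> 0 \<Longrightarrow> jacobi b (m * n) = jacobi b m * jacobi b n"
  by (simp add: jacobi_def prime_factorization_mult)

lemma jacobi_prime: "prime p \<Longrightarrow> jacobi b p = Legendre b (int p)"
  by (simp add: jacobi_def prime_factorization_prime)

lemma jacobi_prime_mult:
  "prime p \<Longrightarrow> odd m \<Longrightarrow> jacobi b (p * m) = Legendre b (int p) * jacobi b m"
  by (subst jacobi_mult_right) (auto simp: jacobi_prime intro: Nat.gr0I)

lemma odd_prime_gt_2: "prime p \<Longrightarrow> odd p \<Longrightarrow> 2 < (p :: nat)"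
  using prime_ge_2_nat[of p] by (cases "p = 2") auto

lemma jacobi_mult_left:
  assumes "odd m"
  shows "jacobi (b * c) m = jacobi b m * jacobi c m"
  using assms
  by (induction m rule: odd_prime_induct) (auto simp: jacobi_prime_mult Legendre_mult odd_prime_gt_2)

lemma jacobi_values:
  assumes "odd m"
  shows "jacobi b m \<in> {-1, 0, 1}"
  using assms
proof (induction m rule: odd_prime_induct)
  case (mult p m)
  then show ?case using Legendre_values[of b p] by (auto simp: jacobi_prime_mult)
qed simp

lemma jacobi_cong:
  assumes "odd m" "[b = c] (mod int m)"
  shows "jacobi b m = jacobi c m"
  using assms
proof (induction m rule: odd_prime_induct)
  case (mult p m)
  have "[b = c] (mod int p)" "[b = c] (mod int m)"
    using mult.prems by (auto intro: cong_dvd_modulus)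
  then show ?case using mult by (simp add: jacobi_prime_mult Legendre_cong)
qed simp

lemma jacobi_eq_0_iff:
  assumes "odd m"
  shows "jacobi b m = 0 \<longleftrightarrow> \<not> coprime b (int m)"
  using assms
proof (induction m rule: odd_prime_induct)
  case (mult p m)
  have "Legendre b (int p) = 0 \<longleftrightarrow> \<not> coprime b (int p)"
    using mult(1) prime_imp_coprime[of "int p" b] coprime_common_divisor[of b "int p" "int p"]
    by (auto simp: Legendre_def cong_0_iff coprime_commute)
  then show ?case using mult by (simp add: jacobi_prime_mult)
qed simp

lemma jacobi_one_left [simp]: "odd m \<Longrightarrow> jacobi 1 m = 1"
proof (induction m rule: odd_prime_induct)
  case (mult p m)
  have "Legendre 1 (int p) = 1"
    using prime_gt_1_nat[OF mult(1)]
    by (auto simp: Legendre_def cong_0_iff QuadRes_def intro!: exI[of _ 1])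
  then show ?case using mult by (simp add: jacobi_prime_mult)
qed simp

lemma Legendre_minus_one:
  assumes "prime p" "odd p"
  shows "Legendre (-1) (int p) = (if p mod 4 = 1 then 1 else -1)"
proof -
  have gt: "2 < p" using assms odd_prime_gt_2 by blast
  have *: "[Legendre (-1) p = (-1) ^ ((p - 1) div 2)] (mod p)"
    by (rule euler_criterion[OF assms(1) gt])
  have e: "(-1::int) ^ ((p - 1) div 2) = (if p mod 4 = 1 then 1 else -1)"
  proof (cases "p mod 4 = 1")
    case True
    then have "even ((p - 1) div 2)" by presburger
    then show ?thesis using True by simp
  next
    case False
    then have "odd ((p - 1) div 2)" using assms(2) by presburger
    then show ?thesis using False by simp
  qed
  show ?thesis
    using sign_cong_imp_eq[OF * Legendre_values _ gt] e by auto
qed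

lemma odd_mod4_mult:
  fixes m n :: nat
  assumes "odd m" "odd n"
  shows "(m * n) mod 4 = 1 \<longleftrightarrow> m mod 4 = n mod 4"
proof -
  have "m mod 4 = 1 \<or> m mod 4 = 3" "n mod 4 = 1 \<or> n mod 4 = 3"
    using assms by presburger+
  then show ?thesis by (auto simp: mod_mult_eq[of m 4 n, symmetric])
qed

lemma jacobi_minus_one:
  assumes "odd m"
  shows "jacobi (-1) m = (if m mod 4 = 1 then 1 else -1)"
  using assms
proof (induction m rule: odd_prime_induct)
  case (mult p m)
  have "m mod 4 = 1 \<or> m mod 4 = 3" using mult(3) by presburger
  moreover have "p mod 4 = 1 \<or> p mod 4 = 3" using mult(2) by presburger
  ultimately show ?case
    using mult odd_mod4_mult[OF mult(2,3)] by (auto simp: jacobi_prime_mult Legendre_minus_one)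
qed simp

text \<open>For odd arguments this is \<open>(-1)^((d-1)/2 * (m-1)/2)\<close>. Writing it through
  residues modulo 4 shows at once that it is multiplicative in each argument and depends on each
  only modulo 4.\<close>

definition recip_sign :: "nat \<Rightarrow> nat \<Rightarrow> int" where
  "recip_sign d m = (if d mod 4 = 3 \<and> m mod 4 = 3 then -1 else 1)"

lemma recip_sign_mult:
  assumes "odd d" "odd m" "odd n"
  shows "recip_sign d (m * n) = recip_sign d m * recip_sign d n"
    and "recip_sign (m * n) d = recip_sign m d * recip_sign n d"
proof -
  have mn: "m mod 4 = 1 \<or> m mod 4 = 3" "n mod 4 = 1 \<or> n mod 4 = 3"
    using assms by presburger+
  then have "(m * n) mod 4 = 3 \<longleftrightarrow> m mod 4 \<noteq> n mod 4"
    by (auto simp: mod_mult_eq[of m 4 n, symmetric])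
  with mn show "recip_sign d (m * n) = recip_sign d m * recip_sign d n"
    "recip_sign (m * n) d = recip_sign m d * recip_sign n d"
    by (auto simp: recip_sign_def)
qed

text \<open>With the sign moved to the right-hand side the law also covers \<open>p = q\<close>,
  where both symbols vanish; the induction over prime factors can then proceed without a coprimality
  assumption.\<close>

lemma Legendre_reciprocity:
  assumes "prime p" "odd p" "prime q" "odd q"
  shows "Legendre (int p) (int q) = recip_sign p q * Legendre (int q) (int p)"
proof (cases "p = q")
  case False
  have "Legendre p q * Legendre q p = (-1::int) ^ ((p - 1) div 2 * ((q - 1) div 2))"
    using Quadratic_Reciprocity assms odd_prime_gt_2 False by blast
  also have "\<dots> = recip_sign p q"
  proof (cases "p mod 4 = 3 \<and> q mod 4 = 3")
    case True
    then have "odd ((p - 1) div 2)" "odd ((q - 1) div 2)" by presburger+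
    then show ?thesis using True by (simp add: recip_sign_def)
  next
    case False
    then have "even ((p - 1) div 2) \<or> even ((q - 1) div 2)" using assms by presburger
    then show ?thesis using False by (auto simp: recip_sign_def)
  qed
  finally show ?thesis
    using Legendre_values[of p q] Legendre_values[of q p]
    by (auto simp: recip_sign_def split: if_splits)
qed (auto simp: Legendre_def cong_0_iff)

lemma jacobi_Legendre_reciprocity:
  assumes "prime p" "odd p" "odd m"
  shows "Legendre (int m) (int p) = recip_sign m p * jacobi (int p) m"
  using assms(3)
proof (induction m rule: odd_prime_induct)
  case one
  then show ?case using jacobi_one_left[of p] assms jacobi_prime[of p 1] by (simp add: recip_sign_def)
next
  case (mult q m)
  then show ?case using assms
    by (simp add: jacobi_prime_mult Legendre_mult odd_prime_gt_2 Legendre_reciprocity[of q p]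
        recip_sign_mult)
qed

lemma jacobi_reciprocity:
  assumes "odd d" "odd m"
  shows "jacobi (int d) m = recip_sign d m * jacobi (int m) d"
  using assms(2)
proof (induction m rule: odd_prime_induct)
  case one
  then show ?case using assms by (simp add: recip_sign_def)
next
  case (mult p m)
  then show ?case using assms
    by (simp add: jacobi_prime_mult jacobi_mult_left jacobi_Legendre_reciprocity recip_sign_mult)
qed

text \<open>Peeling off $2 \equiv -(m-2)$ modulo $m$ and applying reciprocity to $m$ and $m-2$
  avoids Gauss' lemma.\<close>
lemma jacobi_two:
  assumes "odd m"
  shows "jacobi 2 m = (if m mod 8 = 1 \<or> m mod 8 = 7 then 1 else -1)"
  using assms
proof (induction m rule: less_induct)
  case (less m)
  show ?case
  proof (cases "m = 1")
    case False
    define k where "k = m - 2"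
    have m: "m = k + 2" "odd k" using False less.prems by (auto simp: k_def) presburger+
    have "jacobi 2 m = jacobi (-1 * int k) m"
      by (rule jacobi_cong) (use m in \<open>auto simp: cong_iff_dvd_diff\<close>)
    also have "\<dots> = jacobi (-1) m * (recip_sign k m * jacobi (int m) k)"
      using m less.prems by (subst jacobi_mult_left) (auto simp: jacobi_reciprocity)
    \<comment> \<open>Two odd numbers that differ by 2 are never both 3 modulo 4.\<close>
    also have "recip_sign k m = 1" using m by (auto simp: recip_sign_def) presburger
    also have "jacobi (int m) k = jacobi 2 k"
      by (rule jacobi_cong) (use m in \<open>auto simp: cong_iff_dvd_diff\<close>)
    also have "jacobi 2 k = (if k mod 8 = 1 \<or> k mod 8 = 7 then 1 else -1)"
      using less.IH m by simp
    also have "jacobi (-1) m = (if m mod 4 = 1 then 1 else -1)"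
      using less.prems by (rule jacobi_minus_one)
    finally have eq: "jacobi 2 m = (if m mod 4 = 1 then 1 else -1) *
        (1 * (if k mod 8 = 1 \<or> k mod 8 = 7 then 1 else -1))" .
    have "k mod 8 = 1 \<or> k mod 8 = 3 \<or> k mod 8 = 5 \<or> k mod 8 = 7"
      using m(2) by presburger
    moreover have "m mod 8 = (k mod 8 + 2) mod 8"
      unfolding m(1) by (rule mod_add_left_eq[symmetric])
    moreover have "m mod 4 = (m mod 8) mod 4"
      by (simp add: mod_mod_cancel)
    ultimately show ?thesis unfolding eq by auto
  qed simp
qed

section \<open>Chebyshev's bound and sums over integers with restricted prime factors\<close>

lemma sum_inverse_le_ln:
  assumes "n > 0"
  shows "(\<Sum>k\<in>{1..n}. 1 / real k) \<le> 1 + ln (real n)"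
  using assms
proof (induction n rule: nat_induct_non_zero)
  case (Suc n)
  have "ln (real n / (real n + 1)) \<le> real n / (real n + 1) - 1"
    using Suc.hyps by (intro ln_le_minus_one) auto
  then have "1 / (real n + 1) \<le> ln (real n + 1) - ln (real n)"
    using Suc.hyps by (simp add: ln_div field_simps)
  then show ?case using Suc by (simp add: algebra_simps)
qed simp

text \<open>Summation by parts: two boundary terms and a telescoping sum, each bounded by
  \<open>B\<close> times values of \<open>a\<close>, add up to \<open>2 * B * a M\<close>.
  Monotonicity is asked only from \<open>M\<close> on, because the intended weight
  \<open>1 / real k\<close> takes the value 0 at \<open>k = 0\<close> and is not decreasing
  there.\<close>

lemma abel_bound:
  fixes a c :: "nat \<Rightarrow> real"
  assumes c: "\<And>N. \<bar>\<Sum>k<N. c k\<bar> \<le> B"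
    and a: "\<And>k. k \<ge> M \<Longrightarrow> a (Suc k) \<le> a k" "\<And>k. k \<ge> M \<Longrightarrow> 0 \<le> a k"
    and "M \<le> N"
  shows "\<bar>\<Sum>k\<in>{M..<N}. a k * c k\<bar> \<le> 2 * B * a M"
proof -
  define C where "C = (\<lambda>N. \<Sum>k<N. c k)"
  have eq: "(\<Sum>k\<in>{M..<N}. a k * c k) =
      a N * C N - a M * C M + (\<Sum>k\<in>{M..<N}. (a k - a (Suc k)) * C (Suc k))"
    using \<open>M \<le> N\<close>
    by (induction N rule: dec_induct) (auto simp: C_def algebra_simps)
  have tel: "(\<Sum>k\<in>{M..<N}. a k - a (Suc k)) = a M - a N"
    using \<open>M \<le> N\<close> by (induction N rule: dec_induct) auto
  have "\<bar>\<Sum>k\<in>{M..<N}. (a k - a (Suc k)) * C (Suc k)\<bar> \<le> (\<Sum>k\<in>{M..<N}. (a k - a (Suc k)) * B)"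
  proof (rule order_trans[OF sum_abs sum_mono])
    fix k assume "k \<in> {M..<N}"
    then show "\<bar>(a k - a (Suc k)) * C (Suc k)\<bar> \<le> (a k - a (Suc k)) * B"
      using a(1)[of k] c[of "Suc k"] unfolding abs_mult C_def by (intro mult_mono) auto
  qed
  also have "\<dots> = (a M - a N) * B"
    unfolding tel[symmetric] by (rule sum_distrib_right[symmetric])
  finally have 1: "\<bar>\<Sum>k\<in>{M..<N}. (a k - a (Suc k)) * C (Suc k)\<bar> \<le> (a M - a N) * B" .
  have 2: "\<bar>a N * C N\<bar> \<le> a N * B" "\<bar>a M * C M\<bar> \<le> a M * B"
    using a(2)[of N] a(2)[of M] c[of N] c[of M] \<open>M \<le> N\<close>
    by (auto simp: abs_mult C_def intro!: mult_mono)
  have "\<bar>\<Sum>k\<in>{M..<N}. a k * c k\<bar> \<le> a N * B + a M * B + (a M - a N) * B"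
    unfolding eq using 1 2 by linarith
  then show ?thesis by (simp add: algebra_simps)
qed

text \<open>The substitution \<open>k = e * f\<close>. The variable \<open>e\<close>, which often
  carries a character, ends up in the inner sum over an interval, where cancellation or Chebyshev's
  bound applies.\<close>

lemma sum_divisors_swap:
  fixes F :: "nat \<Rightarrow> nat \<Rightarrow> 'a :: comm_monoid_add"
  shows "(\<Sum>k\<in>{1..Z}. \<Sum>e | e dvd k. F e (k div e)) = (\<Sum>f\<in>{1..Z}. \<Sum>e\<in>{1..Z div f}. F e f)"
proof -
  have "(\<Sum>k\<in>{1..Z}. \<Sum>e | e dvd k. F e (k div e)) =
      (\<Sum>(k, e)\<in>(SIGMA k:{1..Z}. {e. e dvd k}). F e (k div e))"
    by (subst sum.Sigma) auto
  also have "\<dots> = (\<Sum>(f, e)\<in>(SIGMA f:{1..Z}. {1..Z div f}). F e f)"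
  proof (rule sum.reindex_bij_witness[where j = "\<lambda>(k, e). (k div e, e)" and i = "\<lambda>(f, e). (e * f, e)"])
    fix a assume "a \<in> (SIGMA k:{1..Z}. {e. e dvd k})"
    then obtain e f where a: "a = (e * f, e)" "e * f \<in> {1..Z}" by (auto simp: dvd_def)
    then have "e > 0" "f > 0" by (auto intro!: Nat.gr0I)
    then have "f \<le> e * f" by simp
    then have "f \<le> Z" by (rule le_trans) (use a(2) in simp)
    then show "(case case a of (k, e) \<Rightarrow> (k div e, e) of (f, e) \<Rightarrow> (e * f, e)) = a"
      "(case a of (k, e) \<Rightarrow> (k div e, e)) \<in> (SIGMA f:{1..Z}. {1..Z div f})"
      using a \<open>e > 0\<close> \<open>f > 0\<close> by (auto simp: less_eq_div_iff_mult_less_eq mult.commute)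
  next
    fix b assume "b \<in> (SIGMA f:{1..Z}. {1..Z div f})"
    then show "(case case b of (f, e) \<Rightarrow> (e * f, e) of (k, e) \<Rightarrow> (k div e, e)) = b"
      "(case b of (f, e) \<Rightarrow> (e * f, e)) \<in> (SIGMA k:{1..Z}. {e. e dvd k})"
      by (auto simp: less_eq_div_iff_mult_less_eq mult.commute)
  qed auto
  also have "\<dots> = (\<Sum>f\<in>{1..Z}. \<Sum>e\<in>{1..Z div f}. F e f)"
    by (subst sum.Sigma) auto
  finally show ?thesis .
qed

lemma squarefree_eq_prod_primes:
  fixes m :: nat
  assumes "squarefree m"
  shows "m = \<Prod>(prime_factors m)"
proof -
  have "m \<noteq> 0" using assms by (intro notI) simp
  then have "m = (\<Prod>p\<in>prime_factors m. p ^ multiplicity p m)"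
    using prod_prime_factors[of m] by simp
  also have "\<dots> = \<Prod>(prime_factors m)"
    using assms \<open>m \<noteq> 0\<close> by (intro prod.cong) (auto simp: squarefree_factorial_semiring')
  finally show ?thesis .
qed

lemma prod_primes_dvd:
  fixes n :: nat
  assumes "finite A" "\<And>p. p \<in> A \<Longrightarrow> prime p" "\<And>p. p \<in> A \<Longrightarrow> p dvd n"
  shows "\<Prod>A dvd n"
  using assms
proof (induction A rule: finite_induct)
  case (insert p A)
  have "coprime p (\<Prod>A)"
    using insert by (intro prod_coprime_right) (auto intro: primes_coprime)
  then show ?case using insert by (simp add: divides_mult)
qed simp

text \<open>Erdos' argument: the primes between \<open>m + 2\<close> and \<open>2 * m + 1\<close>
  all divide the central binomial coefficient of row \<open>2 * m + 1\<close>, which is at most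
  \<open>4 ^ m\<close>. Even \<open>n > 2\<close> reduce to \<open>n - 1\<close>.\<close>

lemma primorial_le: "\<Prod>{p. prime p \<and> p \<le> n} \<le> (4::nat) ^ n"
proof (induction n rule: less_induct)
  case (less n)
  have "n = 0 \<or> n = 1 \<or> n = 2 \<or> n > 2 \<and> even n \<or> (\<exists>m. n = 2 * m + 1 \<and> m > 0)"
    by presburger
  then consider "n = 0" | "n = 1" | "n = 2" | "n > 2" "even n" | m where "n = 2 * m + 1" "m > 0"
    by blast
  then show ?case
  proof cases
    case 1
    then have eq: "{p. prime p \<and> p \<le> n} = {}" by (auto dest: prime_gt_0_nat)
    show ?thesis unfolding eq by simp
  next
    case 2
    then have eq: "{p. prime p \<and> p \<le> n} = {}" by (auto dest: prime_gt_1_nat)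
    show ?thesis unfolding eq by simp
  next
    case 3
    then have "{p. prime p \<and> p \<le> n} \<subseteq> {2}"
      by (auto dest: prime_ge_2_nat)
    then have "{p. prime p \<and> p \<le> n} = {} \<or> {p. prime p \<and> p \<le> n} = {2}" by blast
    moreover have "\<Prod>X \<le> 4 ^ n" if "X = {} \<or> X = {2}" for X :: "nat set"
      using that 3 by auto
    ultimately show ?thesis by blast
  next
    case 4
    then have "\<not> prime n" using primes_dvd_imp_eq two_is_prime_nat by blast
    then have "{p. prime p \<and> p \<le> n} = {p. prime p \<and> p \<le> n - 1}"
      using \<open>n > 2\<close> by (auto simp: le_diff_conv2 le_eq_less_or_eq[of _ n])
    also have "\<Prod>\<dots> \<le> 4 ^ (n - 1)" using less.IH[of "n - 1"] 4 by simp
    also have "\<dots> \<le> (4::nat) ^ n" by (intro power_increasing) auto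
    finally show ?thesis .
  next
    case 5
    let ?B = "{p. prime p \<and> m + 1 < p \<and> p \<le> 2 * m + 1}"
    have fin: "finite ?B" by (rule finite_subset[of _ "{..2 * m + 1}"]) auto
    have "{p. prime p \<and> p \<le> n} = {p. prime p \<and> p \<le> m + 1} \<union> ?B"
      using 5 by auto
    then have "\<Prod>{p. prime p \<and> p \<le> n} = \<Prod>{p. prime p \<and> p \<le> m + 1} * \<Prod>?B"
      using fin by (simp only:) (rule prod.union_disjoint, auto)
    also have "\<dots> \<le> 4 ^ (m + 1) * 4 ^ m"
    proof (rule mult_le_mono)
      show "\<Prod>{p. prime p \<and> p \<le> m + 1} \<le> 4 ^ (m + 1)" using less.IH[of "m + 1"] 5 by simp
      have dvd: "\<Prod>?B dvd ((2 * m + 1) choose m)"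
      proof (rule prod_primes_dvd[OF fin])
        fix p assume p: "p \<in> ?B"
        then have "prime p" by blast
        have "fact m * fact (m + 1) * ((2 * m + 1) choose m) = (fact (2 * m + 1) :: nat)"
          using binomial_fact_lemma[of m "2 * m + 1"] by (simp add: algebra_simps)
        moreover have "p dvd fact (2 * m + 1)"
          using p \<open>prime p\<close> by (subst prime_dvd_fact_iff) auto
        ultimately have "p dvd fact m * fact (m + 1) * ((2 * m + 1) choose m)" by (simp only:)
        moreover have "\<not> p dvd fact m" "\<not> p dvd fact (m + 1)"
          using p \<open>prime p\<close> by (subst prime_dvd_fact_iff; simp)+
        ultimately show "p dvd ((2 * m + 1) choose m)"
          using \<open>prime p\<close> by (simp only: prime_dvd_mult_iff) blast
      qed auto
      \<comment> \<open>The two equal middle coefficients together are at most the row sum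
        \<open>2 * 4 ^ m\<close>.\<close>
      have "2 * ((2 * m + 1) choose m) = ((2 * m + 1) choose m) + ((2 * m + 1) choose (m + 1))"
        using binomial_symmetric[of m "2 * m + 1"] by simp
      also have "\<dots> = (\<Sum>k\<in>{m, m + 1}. (2 * m + 1) choose k)" by simp
      also have "\<dots> \<le> (\<Sum>k\<le>2 * m + 1. (2 * m + 1) choose k)" by (intro sum_mono2) auto
      also have "\<dots> = 2 * 4 ^ m"
        by (subst choose_row_sum) (simp add: power_mult)
      finally have "((2 * m + 1) choose m) \<le> 4 ^ m" by simp
      moreover have "((2 * m + 1) choose m) > 0" by simp
      ultimately show "\<Prod>?B \<le> 4 ^ m" using dvd_imp_le[OF dvd] by linarith
    qed
    also have "\<dots> = 4 ^ n" using 5 by (simp add: power_add[symmetric] mult_2)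
    finally show ?thesis .
  qed
qed

lemma chebyshev_theta_le: "(\<Sum>p | prime p \<and> p \<le> n. ln (real p)) \<le> 2 * real n"
proof -
  have fin: "finite {p. prime p \<and> p \<le> n}" by (rule finite_subset[of _ "{..n}"]) auto
  have "(\<Sum>p | prime p \<and> p \<le> n. ln (real p)) = ln (\<Prod>p | prime p \<and> p \<le> n. real p)"
    using fin by (subst ln_prod) (auto dest: prime_gt_0_nat)
  also have "\<dots> \<le> ln (real (4 ^ n))"
  proof (subst ln_le_cancel_iff)
    show "(\<Prod>p | prime p \<and> p \<le> n. real p) > 0"
      by (intro prod_pos) (auto dest: prime_gt_0_nat)
    show "(\<Prod>p | prime p \<and> p \<le> n. real p) \<le> real (4 ^ n)"
      using primorial_le[of n] unfolding of_nat_prod[symmetric] of_nat_le_iff .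
  qed auto
  also have "\<dots> = real n * ln 4" by (simp add: ln_realpow)
  also have "ln (4::real) = 2 * ln 2" using ln_realpow[of 2 2] by simp
  also have "ln (2::real) \<le> 1" using ln_le_minus_one[of "2::real"] by simp
  finally show ?thesis by (simp add: mult_left_mono)
qed


text \<open>Writing $\ln m$ as the sum of $\ln p$ over $p \mid m$ trades the sum over $m$ for a sum
  over $m / p$, on which Chebyshev's bound for the sum over $p$ gains a logarithm.\<close>
lemma sum_monotone_le:
  fixes f :: "nat \<Rightarrow> real"
  assumes range: "\<And>m. 0 \<le> f m" "\<And>m. f m \<le> 1" and "f 1 = 1"
    and sqfree: "\<And>m. f m \<noteq> 0 \<Longrightarrow> squarefree m"
    and mono: "\<And>p k. prime p \<Longrightarrow> f (p * k) \<le> f k"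
    and "Y \<ge> 2"
  shows "(\<Sum>m\<in>{1..Y}. f m) \<le> 10 * real Y / ln (real Y) * (\<Sum>k\<in>{1..Y}. f k / real k)"
proof -
  define S where "S = (\<Sum>k\<in>{1..Y}. f k / real k)"
  \<comment> \<open>The term at 1 gives \<open>S \<ge> 1\<close>, which later allows the trivial
    count of the small \<open>m\<close> to be absorbed into the main bound.\<close>
  have "S \<ge> (\<Sum>k\<in>{1}. f k / real k)"
    unfolding S_def using \<open>Y \<ge> 2\<close> range by (intro sum_mono2) auto
  then have S1: "S \<ge> 1" using \<open>f 1 = 1\<close> by simp
  have lnY: "ln (real Y) > 0" using \<open>Y \<ge> 2\<close> by simp
  have "(\<Sum>m\<in>{1..Y}. f m * ln (real m)) \<le> (\<Sum>m\<in>{1..Y}. \<Sum>p | p dvd m. if prime p then f (m div p) * ln (real p) else 0)"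
  proof (rule sum_mono)
    fix m assume m: "m \<in> {1..Y}"
    show "f m * ln (real m) \<le> (\<Sum>p | p dvd m. if prime p then f (m div p) * ln (real p) else 0)"
    proof (cases "f m = 0")
      case True
      then show ?thesis
        using range m by (auto intro!: sum_nonneg mult_nonneg_nonneg simp: Suc_le_eq dest: prime_gt_0_nat)
    next
      case False
      then have "m = \<Prod>(prime_factors m)"
        by (intro squarefree_eq_prod_primes sqfree)
      then have "real m = real (\<Prod>(prime_factors m))" by (rule arg_cong)
      also have "\<dots> = (\<Prod>p\<in>prime_factors m. real p)" by simp
      finally have "ln (real m) = ln (\<Prod>p\<in>prime_factors m. real p)" by (rule arg_cong)
      also have "\<dots> = (\<Sum>p\<in>prime_factors m. ln (real p))"
        by (rule ln_prod) (auto dest!: in_prime_factors_imp_prime prime_gt_0_nat)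
      finally have "f m * ln (real m) = (\<Sum>p\<in>prime_factors m. f m * ln (real p))"
        by (simp add: sum_distrib_left)
      also have "\<dots> \<le> (\<Sum>p\<in>prime_factors m. f (m div p) * ln (real p))"
      proof (intro sum_mono mult_right_mono)
        fix p assume p: "p \<in> prime_factors m"
        then have "prime p" "m = p * (m div p)" by auto
        then show "f m \<le> f (m div p)" using mono[of p "m div p"] by simp
        show "0 \<le> ln (real p)" using \<open>prime p\<close> by (auto dest: prime_gt_0_nat simp: Suc_le_eq)
      qed
      also have "\<dots> = (\<Sum>p | p dvd m. if prime p then f (m div p) * ln (real p) else 0)"
        using m by (intro sum.mono_neutral_cong_left) (auto simp: prime_factors_dvd)
      finally show ?thesis .
    qed
  qed
  also have "\<dots> = (\<Sum>k\<in>{1..Y}. \<Sum>p\<in>{1..Y div k}. if prime p then f k * ln (real p) else 0)"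
    by (rule sum_divisors_swap)
  also have "\<dots> \<le> (\<Sum>k\<in>{1..Y}. 2 * real Y * (f k / real k))"
  proof (rule sum_mono)
    fix k assume k: "k \<in> {1..Y}"
    have "(\<Sum>p\<in>{1..Y div k}. if prime p then f k * ln (real p) else 0)
        = (\<Sum>p | prime p \<and> p \<le> Y div k. f k * ln (real p))"
      by (intro sum.mono_neutral_cong_right) (auto dest: prime_gt_0_nat simp: Suc_le_eq)
    also have "\<dots> = f k * (\<Sum>p | prime p \<and> p \<le> Y div k. ln (real p))"
      by (simp add: sum_distrib_left)
    also have "\<dots> \<le> f k * (2 * real (Y div k))"
      using range by (intro mult_left_mono chebyshev_theta_le) auto
    also have "\<dots> \<le> f k * (2 * (real Y / real k))"
      using range by (intro mult_left_mono) (auto simp: of_nat_div_le_of_nat)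
    finally show "(\<Sum>p\<in>{1..Y div k}. if prime p then f k * ln (real p) else 0) \<le> 2 * real Y * (f k / real k)"
      by (simp add: mult_ac)
  qed
  also have "\<dots> = 2 * real Y * S" by (simp add: S_def sum_distrib_left)
  finally have main: "(\<Sum>m\<in>{1..Y}. f m * ln (real m)) \<le> 2 * real Y * S" .
  have sq: "sqrt (real Y) \<le> 2 * real Y / ln (real Y)"
  proof -
    have "ln (sqrt (real Y)) \<le> sqrt (real Y)"
      using ln_le_minus_one[of "sqrt (real Y)"] \<open>Y \<ge> 2\<close> by simp
    then have "sqrt (real Y) * ln (real Y) \<le> sqrt (real Y) * (2 * sqrt (real Y))"
      using \<open>Y \<ge> 2\<close> by (intro mult_left_mono) (auto simp: ln_sqrt)
    also have "\<dots> = 2 * real Y" by simp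
    finally show ?thesis using lnY by (simp add: field_simps)
  qed
  \<comment> \<open>Beyond the square root of \<open>Y\<close> the weight \<open>ln m\<close> is at
    least half of \<open>ln Y\<close>, so dividing by it costs a factor 2; the remaining
    \<open>m\<close> are counted trivially.\<close>
  have "f m \<le> (if real m \<le> sqrt (real Y) then 1 else 0) + 2 / ln (real Y) * (f m * ln (real m))"
    if "m \<in> {1..Y}" for m
  proof (cases "real m \<le> sqrt (real Y)")
    case True
    have "0 \<le> 2 / ln (real Y) * (f m * ln (real m))"
      using lnY range that by (intro mult_nonneg_nonneg) auto
    then show ?thesis using True range(2)[of m] by simp
  next
    case False
    then have "ln (sqrt (real Y)) \<le> ln (real m)" using \<open>Y \<ge> 2\<close> that by (subst ln_le_cancel_iff) auto
    then have "ln (real Y) \<le> 2 * ln (real m)" using \<open>Y \<ge> 2\<close> by (simp add: ln_sqrt)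
    then have "f m * ln (real Y) \<le> f m * (2 * ln (real m))" using range by (intro mult_left_mono)
    then show ?thesis using lnY False by (simp add: field_simps)
  qed
  then have "(\<Sum>m\<in>{1..Y}. f m) \<le> (\<Sum>m\<in>{1..Y}. (if real m \<le> sqrt (real Y) then 1 else 0)
      + 2 / ln (real Y) * (f m * ln (real m)))"
    by (rule sum_mono)
  also have "\<dots> = (\<Sum>m\<in>{1..Y}. (if real m \<le> sqrt (real Y) then 1 else 0))
      + 2 / ln (real Y) * (\<Sum>m\<in>{1..Y}. f m * ln (real m))"
    by (simp add: sum.distrib sum_distrib_left)
  also have "(\<Sum>m\<in>{1..Y}. (if real m \<le> sqrt (real Y) then 1 else 0)) \<le> sqrt (real Y)"
  proof -
    have "(\<Sum>m\<in>{1..Y}. (if real m \<le> sqrt (real Y) then 1 else (0::real)))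
        = real (card {m\<in>{1..Y}. real m \<le> sqrt (real Y)})"
      by (simp add: sum.If_cases Int_def)
    also have "card {m\<in>{1..Y}. real m \<le> sqrt (real Y)} \<le> card {1..nat \<lfloor>sqrt (real Y)\<rfloor>}"
      by (intro card_mono) (auto simp: le_nat_floor)
    also have "real (card {1..nat \<lfloor>sqrt (real Y)\<rfloor>}) \<le> sqrt (real Y)" by simp
    finally show ?thesis by simp
  qed
  also have "2 / ln (real Y) * (\<Sum>m\<in>{1..Y}. f m * ln (real m)) \<le> 2 / ln (real Y) * (2 * real Y * S)"
    using lnY by (intro mult_left_mono main) auto
  also have "sqrt (real Y) + 2 / ln (real Y) * (2 * real Y * S)
      \<le> 2 * real Y / ln (real Y) * S + 2 / ln (real Y) * (2 * real Y * S)"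
  proof -
    have "2 * real Y / ln (real Y) * 1 \<le> 2 * real Y / ln (real Y) * S"
      using S1 lnY by (intro mult_left_mono) auto
    then show ?thesis using sq by linarith
  qed
  also have "\<dots> \<le> 10 * real Y / ln (real Y) * S"
    using S1 lnY by (simp add: field_simps)
  finally show ?thesis by (simp add: S_def)
qed

section \<open>The divisor function and logarithmic sums weighted by its inverse\<close>

text \<open>Since every number divides 0 and infinite sets have cardinality 0,
  \<open>tau 0 = 0\<close>.\<close>

definition tau :: "nat \<Rightarrow> nat" where
  "tau n = card {e. e dvd n}"

lemma finite_divisors: "n > 0 \<Longrightarrow> finite {e. e dvd (n::nat)}"
  by simp

lemma tau_pos: "n > 0 \<Longrightarrow> tau n > 0"
  by (auto simp: tau_def card_gt_0_iff)

lemma sum_divisors_coprime: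
  fixes F :: "nat \<Rightarrow> 'a :: comm_semiring_1"
  assumes "coprime x y" "x > 0" "y > 0"
    and F: "\<And>a b. coprime a b \<Longrightarrow> F (a * b) = F a * F b"
  shows "(\<Sum>e | e dvd x * y. F e) = (\<Sum>e | e dvd x. F e) * (\<Sum>e | e dvd y. F e)"
proof -
  have g1: "gcd (a * b) x = a" "gcd (a * b) y = b" if "a dvd x" "b dvd y" for a b
  proof -
    have "coprime b x" "coprime a y"
      using assms(1) that coprime_divisors[of a x b y] coprime_divisors[of x x b y]
        coprime_divisors[of a x y y] by (auto simp: coprime_commute)
    then show "gcd (a * b) x = a" "gcd (a * b) y = b"
      using that by (simp_all add: gcd_mult_left_left_cancel gcd_mult_left_right_cancel coprime_commute
          gcd_proj1_iff)
  qed
  have "(\<Sum>e | e dvd x. F e) * (\<Sum>e | e dvd y. F e) =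
      (\<Sum>(a, b)\<in>{e. e dvd x} \<times> {e. e dvd y}. F a * F b)"
    by (simp add: sum_product sum.cartesian_product)
  also have "\<dots> = (\<Sum>e | e dvd x * y. F e)"
  proof (rule sum.reindex_bij_witness[where i = "\<lambda>e. (gcd e x, gcd e y)" and j = "\<lambda>(a, b). a * b"])
    fix c assume "c \<in> {e. e dvd x} \<times> {e. e dvd y}"
    then obtain a b where c: "c = (a, b)" "a dvd x" "b dvd y" by auto
    then show "(gcd (case c of (a, b) \<Rightarrow> a * b) x, gcd (case c of (a, b) \<Rightarrow> a * b) y) = c"
      "(case c of (a, b) \<Rightarrow> a * b) \<in> {e. e dvd x * y}"
      by (auto simp: g1 mult_dvd_mono)
    have "coprime a b" using assms(1) c(2,3) by (rule coprime_divisors[rotated 2])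
    then show "F (case c of (a, b) \<Rightarrow> a * b) = (case c of (a, b) \<Rightarrow> F a * F b)"
      using c F by simp
  next
    fix e assume "e \<in> {e. e dvd x * y}"
    then obtain a b where e: "e = a * b" "a dvd x" "b dvd y"
      using division_decomp by blast
    then show "(case (gcd e x, gcd e y) of (a, b) \<Rightarrow> a * b) = e" by (simp add: g1)
    show "(gcd e x, gcd e y) \<in> {e. e dvd x} \<times> {e. e dvd y}" by simp
  qed
  finally show ?thesis by simp
qed

lemma tau_coprime:
  assumes "coprime x y" "x > 0" "y > 0"
  shows "tau (x * y) = tau x * tau y"
  using sum_divisors_coprime[OF assms, of "\<lambda>_. 1 :: nat"] by (simp add: tau_def)

lemma tau_mult_le:
  assumes "x > 0" "y > 0"
  shows "tau (x * y) \<le> tau x * tau y"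
proof -
  have "{e. e dvd x * y} \<subseteq> (\<lambda>(a, b). a * b) ` ({e. e dvd x} \<times> {e. e dvd y})"
    using division_decomp[of _ x y] by force
  then have "tau (x * y) \<le> card ((\<lambda>(a, b). a * b) ` ({e. e dvd x} \<times> {e. e dvd y}))"
    unfolding tau_def using assms by (intro card_mono) auto
  also have "\<dots> \<le> card ({e. e dvd x} \<times> {e. e dvd y})"
    using assms by (intro card_image_le) auto
  finally show ?thesis by (simp add: tau_def card_cartesian_product)
qed

lemma card_factorizations_le_tau:
  assumes "k > 0"
  shows "card {(a, b) \<in> A \<times> B. a * b = k} \<le> tau k"
proof -
  have "card {(a, b) \<in> A \<times> B. a * b = k} \<le> card {e. e dvd k}"
    using assms by (intro card_inj_on_le[where f = fst]) (auto intro!: inj_onI)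
  then show ?thesis by (simp add: tau_def)
qed

lemma sum_pairs_le_sum_tau:
  fixes h :: "nat \<Rightarrow> real"
  assumes "A \<subseteq> {1..Y}" "\<And>k. 0 \<le> h k"
  shows "(\<Sum>a\<in>A. \<Sum>b\<in>A. h (a * b)) \<le> (\<Sum>k\<in>{1..Y\<^sup>2}. real (tau k) * h k)"
proof -
  have fin: "finite A" using assms finite_subset by blast
  have "(\<Sum>a\<in>A. \<Sum>b\<in>A. h (a * b)) = (\<Sum>x\<in>A \<times> A. h (fst x * snd x))"
    by (simp add: sum.cartesian_product case_prod_beta)
  also have "\<dots> = (\<Sum>k\<in>{1..Y\<^sup>2}. \<Sum>x | x \<in> A \<times> A \<and> fst x * snd x = k. h (fst x * snd x))"
  proof (rule sum.group[symmetric])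
    show "(\<lambda>x. fst x * snd x) ` (A \<times> A) \<subseteq> {1..Y\<^sup>2}"
      using assms(1) by (auto simp: power2_eq_square Suc_le_eq intro!: mult_le_mono)
        (auto simp: subset_iff Suc_le_eq)
  qed (use fin in auto)
  also have "\<dots> \<le> (\<Sum>k\<in>{1..Y\<^sup>2}. real (tau k) * h k)"
  proof (rule sum_mono)
    fix k assume k: "k \<in> {1..Y\<^sup>2}"
    have "{x \<in> A \<times> A. fst x * snd x = k} = {(a, b) \<in> A \<times> A. a * b = k}" by auto
    then have "card {x \<in> A \<times> A. fst x * snd x = k} \<le> tau k"
      using card_factorizations_le_tau[of k A A] k by simp
    then show "(\<Sum>x | x \<in> A \<times> A \<and> fst x * snd x = k. h (fst x * snd x)) \<le> real (tau k) * h k"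
      using assms(2)[of k] by (simp add: mult_right_mono)
  qed
  finally show ?thesis .
qed

text \<open>In the square, \<open>tau (a * b) \<le> tau a * tau b\<close> merges the two weights
  into \<open>1 / tau k\<close>, and this cancels against the at most \<open>tau k\<close> pairs
  with product \<open>k\<close>. Thus the weight \<open>1 / tau\<close> takes a square root of a
  logarithmic sum.\<close>

lemma sum_inverse_tau_le:
  assumes "\<And>a b. a \<in> S \<Longrightarrow> b \<in> S \<Longrightarrow> a * b \<in> S"
  shows "(\<Sum>n\<in>{1..Y} \<inter> S. 1 / (real (tau n) * real n))\<^sup>2 \<le> (\<Sum>k\<in>{1..Y\<^sup>2} \<inter> S. 1 / real k)"
proof -
  let ?A = "{1..Y} \<inter> S" and ?h = "\<lambda>k. if k \<in> S then 1 / (real (tau k) * real k) else 0"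
  have "(\<Sum>n\<in>?A. 1 / (real (tau n) * real n))\<^sup>2 =
      (\<Sum>a\<in>?A. \<Sum>b\<in>?A. 1 / (real (tau a) * real a) * (1 / (real (tau b) * real b)))"
    by (simp only: power2_eq_square sum_product)
  also have "\<dots> \<le> (\<Sum>a\<in>?A. \<Sum>b\<in>?A. ?h (a * b))"
  proof (intro sum_mono)
    fix a b assume ab: "a \<in> ?A" "b \<in> ?A"
    have "tau (a * b) \<le> tau a * tau b" "tau (a * b) > 0" "tau a > 0" "tau b > 0"
      using ab by (auto intro!: tau_mult_le tau_pos)
    then have "1 / (real (tau a * tau b) * real (a * b)) \<le> 1 / (real (tau (a * b)) * real (a * b))"
      using ab by (intro divide_left_mono mult_right_mono mult_pos_pos) (auto simp del: of_nat_mult)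
    then show "1 / (real (tau a) * real a) * (1 / (real (tau b) * real b)) \<le> ?h (a * b)"
      using ab assms by (simp add: mult_ac)
  qed
  also have "\<dots> \<le> (\<Sum>k\<in>{1..Y\<^sup>2}. real (tau k) * ?h k)"
    by (rule sum_pairs_le_sum_tau) auto
  also have "\<dots> = (\<Sum>k\<in>{1..Y\<^sup>2} \<inter> S. 1 / real k)"
    using tau_pos by (intro sum.mono_neutral_cong_right) auto
  finally show ?thesis .
qed

section \<open>Real characters and integers all of whose primes split\<close>

text \<open>A nontrivial real Dirichlet character, described only by the properties that are to be
  verified for Jacobi symbols. The witness in \<open>nontrivial\<close> is coprime to
  \<open>q\<close> because multiplication by it must permute the residues for the sum over a period
  to vanish.\<close>

locale real_character =
  fixes q :: nat and \<chi> :: "nat \<Rightarrow> int"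
  assumes one: "\<chi> 1 = 1"
    and mult: "\<chi> (m * n) = \<chi> m * \<chi> n"
    and periodic: "\<chi> (n + q) = \<chi> n"
    and char_values: "\<chi> n \<in> {-1, 0, 1}"
    and nontrivial: "\<exists>b. coprime b q \<and> \<chi> b = -1"
    and modulus_pos: "q > 0"
begin

lemma mod_modulus: "\<chi> (n mod q) = \<chi> n"
proof -
  have "\<chi> (r + k * q) = \<chi> r" for r k
  proof (induction k)
    case (Suc k)
    then show ?case using periodic[of "r + k * q"] by (simp add: algebra_simps)
  qed simp
  from this[of "n mod q" "n div q"] show ?thesis by simp
qed

lemma sum_period: "(\<Sum>n<q. \<chi> n) = 0"
proof -
  obtain b where b: "coprime b q" "\<chi> b = -1" using nontrivial by blast
  have inj: "inj_on (\<lambda>n. (b * n) mod q) {..<q}"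
  proof (rule inj_onI)
    fix x y assume "x \<in> {..<q}" "y \<in> {..<q}" "b * x mod q = b * y mod q"
    then show "x = y"
      using b(1) cong_mult_lcancel_nat[of b q x y] by (simp add: Cong.cong_def)
  qed
  then have "(\<lambda>n. (b * n) mod q) ` {..<q} = {..<q}"
    using modulus_pos by (intro endo_inj_surj) auto
  with inj have "(\<Sum>n<q. \<chi> n) = (\<Sum>n<q. \<chi> ((b * n) mod q))"
    using sum.reindex[of "\<lambda>n. (b * n) mod q" "{..<q}" \<chi>] by simp
  also have "\<dots> = - (\<Sum>n<q. \<chi> n)"
    by (simp add: mod_modulus mult b(2) sum_negf)
  finally show ?thesis by simp
qed

lemma sum_bound: "\<bar>\<Sum>n<N. \<chi> n\<bar> \<le> int q"
proof -
  have shift: "(\<Sum>n<q + M. \<chi> n) = (\<Sum>n<M. \<chi> n)" for M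
  proof (induction M)
    case (Suc M)
    then show ?case using periodic[of M] by (simp add: add.commute)
  qed (simp add: sum_period)
  have "(\<Sum>n<k * q + r. \<chi> n) = (\<Sum>n<r. \<chi> n)" for k r
  proof (induction k)
    case (Suc k)
    then show ?case using shift[of "k * q + r"] by (simp add: algebra_simps)
  qed simp
  from this[of "N div q" "N mod q"] have "(\<Sum>n<N. \<chi> n) = (\<Sum>n<N mod q. \<chi> n)" by simp
  also have "\<bar>\<dots>\<bar> \<le> (\<Sum>n<N mod q. \<bar>\<chi> n\<bar>)" by (rule sum_abs)
  also have "\<dots> \<le> (\<Sum>n<N mod q. 1)"
  proof (rule sum_mono)
    fix n show "\<bar>\<chi> n\<bar> \<le> 1" using char_values[of n] by auto
  qed
  also have "\<dots> \<le> int q" using modulus_pos by (simp add: less_imp_le)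
  finally show ?thesis .
qed

text \<open>Up to \<open>q\<close> the harmonic sum gives \<open>1 + ln q\<close>. Beyond
  \<open>q\<close>, partial summation with character sums of size at most \<open>q\<close> gives
  \<open>2 * q / (q + 1)\<close>, so the tail costs at most 2, uniformly in
  \<open>N\<close>.\<close>

lemma sum_over_n_le: "\<bar>\<Sum>n\<in>{1..N}. real_of_int (\<chi> n) / real n\<bar> \<le> 3 + ln (real q)"
proof -
  have val: "\<bar>real_of_int (\<chi> n)\<bar> \<le> 1" for n using char_values[of n] by auto
  have head: "\<bar>\<Sum>n\<in>{1..M}. real_of_int (\<chi> n) / real n\<bar> \<le> 1 + ln (real q)" if "M \<le> q" for M
  proof (cases "M = 0")
    case False
    have "\<bar>\<Sum>n\<in>{1..M}. real_of_int (\<chi> n) / real n\<bar> \<le> (\<Sum>n\<in>{1..M}. 1 / real n)"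
      using val by (intro order_trans[OF sum_abs] sum_mono) (auto simp: divide_right_mono)
    also have "\<dots> \<le> 1 + ln (real M)" using False by (intro sum_inverse_le_ln) auto
    also have "\<dots> \<le> 1 + ln (real q)" using False that by simp
    finally show ?thesis .
  qed (use modulus_pos in \<open>auto simp: Suc_le_eq\<close>)
  show ?thesis
  proof (cases "N \<le> q")
    case True
    then show ?thesis using head[of N] by simp
  next
    case False
    have "{1..N} = {1..q} \<union> {Suc q..<Suc N}" using False by auto
    then have split: "(\<Sum>n\<in>{1..N}. real_of_int (\<chi> n) / real n) =
        (\<Sum>n\<in>{1..q}. real_of_int (\<chi> n) / real n) +
        (\<Sum>n\<in>{Suc q..<Suc N}. 1 / real n * real_of_int (\<chi> n))"
      by (simp only:) (subst sum.union_disjoint, auto)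
    have "\<bar>\<Sum>n\<in>{Suc q..<Suc N}. 1 / real n * real_of_int (\<chi> n)\<bar> \<le> 2 * real q * (1 / real (Suc q))"
    proof (rule abel_bound)
      fix N
      have "real_of_int \<bar>\<Sum>n<N. \<chi> n\<bar> \<le> real_of_int (int q)"
        using sum_bound[of N] by (simp only: of_int_le_iff)
      then show "\<bar>\<Sum>k<N. real_of_int (\<chi> k)\<bar> \<le> real q" by simp
    qed (use False in \<open>auto simp: field_simps\<close>)
    also have "\<dots> \<le> 2" by (simp add: field_simps)
    finally show ?thesis using head[of q] split by linarith
  qed
qed

text \<open>The divisor sum is multiplicative, and at \<open>p ^ j\<close> it is the sum of
  \<open>\<chi> p ^ i\<close> for \<open>i \<le> j\<close>: this is \<open>j + 1\<close>, 1, or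
  alternately 1 and 0, according to \<open>\<chi> p\<close>.\<close>

lemma sum_divisors_nonneg:
  assumes "k > 0"
  shows "(\<Sum>e | e dvd k. \<chi> e) \<ge> 0"
  using assms
proof (induction k rule: less_induct)
  case (less k)
  show ?case
  proof (cases "k = 1")
    case True
    then show ?thesis using one by simp
  next
    case False
    then obtain p where p: "prime p" "p dvd k" using prime_factor_nat by blast
    define j where "j = multiplicity p k"
    obtain k' where k': "k = p ^ j * k'" "\<not> p dvd k'"
      using multiplicity_decompose'[of k p] less.prems prime_gt_1_nat[OF p(1)] by (auto simp: j_def)
    have "j > 0" using k' p by (intro Nat.gr0I) auto
    have k'0: "k' > 0" using k' less.prems by (intro Nat.gr0I) auto
    have "1 < p ^ j" using prime_gt_1_nat[OF p(1)] \<open>j > 0\<close> by (rule one_less_power)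
    then have "k' < k" using k'(1) k'0 by simp
    have "coprime (p ^ j) k'" using p k' by (simp add: prime_imp_coprime)
    then have "(\<Sum>e | e dvd k. \<chi> e) = (\<Sum>e | e dvd p ^ j. \<chi> e) * (\<Sum>e | e dvd k'. \<chi> e)"
      unfolding k'(1) using k'0 prime_gt_0_nat[OF p(1)] by (intro sum_divisors_coprime mult) auto
    moreover have "(\<Sum>e | e dvd p ^ j. \<chi> e) \<ge> 0"
    proof -
      have pow: "\<chi> (p ^ i) = \<chi> p ^ i" for i by (induction i) (use one mult in auto)
      have "{e. e dvd p ^ j} = (\<lambda>i. p ^ i) ` {..j}"
        using p(1) by (auto simp: divides_primepow_nat)
      then have "(\<Sum>e | e dvd p ^ j. \<chi> e) = (\<Sum>i\<le>j. \<chi> p ^ i)"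
        using prime_gt_1_nat[OF p(1)] by (simp add: sum.reindex inj_on_def pow)
      also have "\<dots> \<ge> 0"
      proof -
        consider "\<chi> p = -1" | "\<chi> p = 0" | "\<chi> p = 1" using char_values[of p] by auto
        then show ?thesis
        proof cases
          case 1
          have "(\<Sum>i\<le>n. (-1) ^ i) = (if even n then 1 else (0::int))" for n by (induction n) auto
          then show ?thesis using 1 by simp
        qed (auto intro!: sum_nonneg)
      qed
      finally show ?thesis .
    qed
    ultimately show ?thesis using less.IH[OF \<open>k' < k\<close> k'0] by simp
  qed
qed

text \<open>A product of two numbers all of whose prime factors $p$ satisfy $\chi(p) = 1$ has again this
  property, and for such $k$ the divisor sum of $\chi$ is the number of divisors of $k$; this replaces
  the prime number theorem for $\chi$ by a bound for partial sums of $\chi(n)/n$.\<close>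
lemma sum_split_inverse_le:
  "(\<Sum>m | m \<in> {1..Y} \<and> (\<forall>p. prime p \<and> p dvd m \<longrightarrow> \<chi> p = 1). 1 / real m)\<^sup>2
    \<le> (1 + 2 * ln (real Y)) * (3 + ln (real q))"
proof (cases "Y = 0")
  case False
  define S where "S = {m. \<forall>p. prime p \<and> p dvd m \<longrightarrow> \<chi> p = 1}"
  let ?A = "{m. m \<in> {1..Y} \<and> (\<forall>p. prime p \<and> p dvd m \<longrightarrow> \<chi> p = 1)}"
  let ?h = "\<lambda>k. if k \<in> S then 1 / real k else 0"
  have S_mult: "a * b \<in> S" if "a \<in> S" "b \<in> S" for a b
    using that by (auto simp: S_def prime_dvd_mult_iff)
  have S_one: "\<chi> e = 1" if "e \<in> S" "e > 0" for e
    using that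
  proof (induction e rule: less_induct)
    case (less e)
    show ?case
    proof (cases "e = 1")
      case False
      then obtain p where p: "prime p" "p dvd e" using prime_factor_nat by blast
      then obtain f where f: "e = p * f" by blast
      have "f > 0" using less.prems f by (intro Nat.gr0I) auto
      moreover have "f < e" using f \<open>f > 0\<close> prime_gt_1_nat[OF p(1)] by simp
      moreover have "f \<in> S" using less.prems(1) f by (auto simp: S_def)
      moreover have "\<chi> p = 1" using less.prems(1) p by (auto simp: S_def)
      ultimately show ?thesis using less.IH f mult by simp
    qed (use one in simp)
  qed
  have "(\<Sum>m\<in>?A. 1 / real m)\<^sup>2 = (\<Sum>a\<in>?A. \<Sum>b\<in>?A. 1 / real a * (1 / real b))"
    by (simp only: power2_eq_square sum_product)
  also have "\<dots> = (\<Sum>a\<in>?A. \<Sum>b\<in>?A. ?h (a * b))"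
    using S_mult by (intro sum.cong refl) (auto simp: S_def)
  also have "\<dots> \<le> (\<Sum>k\<in>{1..Y\<^sup>2}. real (tau k) * ?h k)"
    by (rule sum_pairs_le_sum_tau) auto
  also have "\<dots> \<le> (\<Sum>k\<in>{1..Y\<^sup>2}. \<Sum>e | e dvd k. real_of_int (\<chi> e) / (real e * real (k div e)))"
  proof (rule sum_mono)
    fix k assume k: "k \<in> {1..Y\<^sup>2}"
    have "(\<Sum>e | e dvd k. real_of_int (\<chi> e) / (real e * real (k div e))) =
        (\<Sum>e | e dvd k. real_of_int (\<chi> e) / real k)"
      by (intro sum.cong refl) (auto simp flip: of_nat_mult)
    also have "\<dots> = real_of_int (\<Sum>e | e dvd k. \<chi> e) / real k"
      by (simp add: sum_divide_distrib)
    also have "\<dots> \<ge> real (tau k) * ?h k"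
    proof (cases "k \<in> S")
      case True
      then have "e \<in> S" if "e dvd k" for e using that by (auto simp: S_def intro: dvd_trans)
      then have "(\<Sum>e | e dvd k. \<chi> e) = (\<Sum>e | e dvd k. 1)"
        using k S_one by (intro sum.cong refl) (auto intro: dvd_pos_nat)
      then show ?thesis using True by (simp add: tau_def)
    next
      case False
      have "real_of_int (\<Sum>e | e dvd k. \<chi> e) \<ge> 0"
        using sum_divisors_nonneg[of k] k by (simp only: of_int_0_le_iff) simp
      then show ?thesis using False by simp
    qed
    finally show "real (tau k) * ?h k \<le> (\<Sum>e | e dvd k. real_of_int (\<chi> e) / (real e * real (k div e)))" .
  qed
  also have "\<dots> = (\<Sum>f\<in>{1..Y\<^sup>2}. \<Sum>e\<in>{1..Y\<^sup>2 div f}. real_of_int (\<chi> e) / (real e * real f))"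
    by (rule sum_divisors_swap)
  also have "\<dots> = (\<Sum>f\<in>{1..Y\<^sup>2}. 1 / real f * (\<Sum>e\<in>{1..Y\<^sup>2 div f}. real_of_int (\<chi> e) / real e))"
    by (simp add: sum_distrib_left mult.commute)
  also have "\<dots> \<le> (\<Sum>f\<in>{1..Y\<^sup>2}. 1 / real f * (3 + ln (real q)))"
    using sum_over_n_le by (intro sum_mono mult_left_mono) (auto simp: abs_le_iff)
  also have "\<dots> = (\<Sum>f\<in>{1..Y\<^sup>2}. 1 / real f) * (3 + ln (real q))"
    by (rule sum_distrib_right[symmetric])
  also have "\<dots> \<le> (1 + ln (real (Y\<^sup>2))) * (3 + ln (real q))"
    using False modulus_pos by (intro mult_right_mono sum_inverse_le_ln) auto
  also have "ln (real (Y\<^sup>2)) = 2 * ln (real Y)" using False by (simp add: ln_realpow)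
  finally show ?thesis by (simp add: S_def)
qed (use modulus_pos in \<open>auto simp: Suc_le_eq intro!: add_nonneg_nonneg\<close>)

text \<open>The bound is of order \<open>Y * sqrt (ln q / ln Y)\<close>, hence a saving as soon as
  \<open>ln q\<close> is small compared with \<open>ln Y\<close>.\<close>

lemma card_split_le:
  assumes "Y \<ge> 2"
  shows "real (card {m \<in> {1..Y}. squarefree m \<and> (\<forall>p. prime p \<and> p dvd m \<longrightarrow> \<chi> p = 1)})
    \<le> 10 * real Y / ln (real Y) * sqrt ((1 + 2 * ln (real Y)) * (3 + ln (real q)))"
proof -
  define f where "f = (\<lambda>m. if squarefree m \<and> (\<forall>p. prime p \<and> p dvd m \<longrightarrow> \<chi> p = 1) then 1 else (0::real))"
  have "real (card {m \<in> {1..Y}. squarefree m \<and> (\<forall>p. prime p \<and> p dvd m \<longrightarrow> \<chi> p = 1)})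
      = (\<Sum>m\<in>{1..Y}. f m)"
    by (simp add: f_def sum.If_cases Int_def)
  also have "\<dots> \<le> 10 * real Y / ln (real Y) * (\<Sum>k\<in>{1..Y}. f k / real k)"
  proof (rule sum_monotone_le)
    show "f (p * k) \<le> f k" for p k
      using squarefree_mono[of k "p * k"] by (auto simp: f_def)
    have "f m \<noteq> 0 \<Longrightarrow> squarefree m" for m by (simp add: f_def split: if_splits)
    then show "f m \<noteq> 0 \<Longrightarrow> squarefree m" for m .
  qed (use assms in \<open>auto simp: f_def dest: prime_gt_1_nat\<close>)
  also have "\<dots> \<le> 10 * real Y / ln (real Y) * sqrt ((1 + 2 * ln (real Y)) * (3 + ln (real q)))"
  proof (rule mult_left_mono)
    have "(\<Sum>k\<in>{1..Y}. f k / real k)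
        \<le> (\<Sum>m | m \<in> {1..Y} \<and> (\<forall>p. prime p \<and> p dvd m \<longrightarrow> \<chi> p = 1). 1 / real m)"
      by (subst sum.inter_filter) (auto simp: f_def intro!: sum_mono)
    also have "\<dots> \<le> sqrt ((1 + 2 * ln (real Y)) * (3 + ln (real q)))"
      by (intro real_le_rsqrt sum_split_inverse_le)
    finally show "(\<Sum>k\<in>{1..Y}. f k / real k) \<le> sqrt ((1 + 2 * ln (real Y)) * (3 + ln (real q)))" .
  qed (use assms in auto)
  finally show ?thesis .
qed

end

section \<open>Jacobi symbols as real characters in either argument\<close>

text \<open>If every residue were a square, squaring would be surjective, hence injective, on the
  residues modulo \<open>p\<close>; but 1 and \<open>p - 1\<close> have the same square.\<close>

lemma ex_nonresidue:
  assumes "prime p" "odd p"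
  shows "\<exists>g::nat. Legendre (int g) (int p) = -1"
proof (rule ccontr)
  assume "\<not> ?thesis"
  then have qr: "\<exists>y. [y\<^sup>2 = int g] (mod int p)" if "\<not> p dvd g" for g
    using that by (auto simp: Legendre_def QuadRes_def cong_0_iff split: if_splits)
  have p: "p > 2" using assms odd_prime_gt_2 by blast
  have "{..<p} \<subseteq> (\<lambda>y. y\<^sup>2 mod p) ` {..<p}"
  proof
    fix g assume g: "g \<in> {..<p}"
    show "g \<in> (\<lambda>y. y\<^sup>2 mod p) ` {..<p}"
    proof (cases "g = 0")
      case True
      then show ?thesis using p by (auto intro!: image_eqI[of _ _ 0])
    next
      case False
      then have "\<not> p dvd g" using g by (auto dest: dvd_imp_le)
      then obtain y where y: "[y\<^sup>2 = int g] (mod int p)"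
        using qr by blast
      define z where "z = nat (y mod int p)"
      have z: "int z = y mod int p" using p by (simp add: z_def)
      then have "int (z\<^sup>2 mod p) = y\<^sup>2 mod int p"
        by (simp add: zmod_int power_mod)
      also have "\<dots> = int g" using y g by (simp add: Cong.cong_def)
      finally have "z\<^sup>2 mod p = g" by simp
      moreover have "int z < int p" unfolding z using p by (intro pos_mod_bound) auto
      ultimately show ?thesis by auto
    qed
  qed
  then have "inj_on (\<lambda>y. y\<^sup>2 mod p) {..<p}"
    by (intro finite_surj_inj) auto
  moreover have "1\<^sup>2 mod p = (p - 1)\<^sup>2 mod p"
  proof -
    have "(p - 1)\<^sup>2 = 1 + p * (p - 2)"
    proof -
      obtain r where "p = r + 2" using p by (metis add.commute le_Suc_ex less_imp_le)
      then show ?thesis by (simp add: power2_eq_square algebra_simps)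
    qed
    then show ?thesis by (simp only: power_one mod_mult_self2)
  qed
  ultimately have "1 = p - 1" by (rule inj_onD) (use p in auto)
  then show False using p by simp
qed

lemma squarefree_prime_dvd_diff:
  fixes m n :: nat
  assumes "squarefree m" "squarefree n" "m \<noteq> n"
  shows "\<exists>p. prime p \<and> (p dvd m \<and> \<not> p dvd n \<or> p dvd n \<and> \<not> p dvd m)"
proof (rule ccontr)
  assume "\<not> ?thesis"
  moreover have "m \<noteq> 0" using assms(1) by (intro notI) simp
  moreover have "n \<noteq> 0" using assms(2) by (intro notI) simp
  ultimately have "prime_factors m = prime_factors n"
    by (auto simp: prime_factors_dvd)
  then show False
    using assms squarefree_eq_prod_primes[of m] squarefree_eq_prod_primes[of n] by simp
qed

text \<open>By the Chinese remainder theorem \<open>b\<close> can be a nonresidue modulo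
  \<open>p\<close> and 1 modulo the cofactor of \<open>p\<close> in \<open>m\<close> and modulo
  \<open>k\<close>. The symbol is then flipped at \<open>p\<close> alone, and anything depending on
  \<open>b\<close> modulo \<open>k\<close> is undisturbed.\<close>

lemma ex_jacobi_minus_one:
  assumes "squarefree m" "prime p" "p dvd m" "odd m" "\<not> p dvd k" "k > 0"
  shows "\<exists>b. [b = 1] (mod k) \<and> coprime b (m * k) \<and> jacobi (int b) m = -1"
proof -
  obtain m' where m: "m = p * m'" using assms(3) by blast
  have "odd p" "odd m'" using m assms(4) by auto
  have "\<not> p dvd m'"
    using assms(1,2) m not_prime_unit by (auto simp: power2_eq_square dest: squarefreeD[of _ p])
  obtain g where g: "Legendre (int g) (int p) = -1" using ex_nonresidue \<open>odd p\<close> assms(2) by blast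
  have cop: "coprime p (m' * k)"
    using assms(2,5) \<open>\<not> p dvd m'\<close> by (simp add: prime_imp_coprime)
  obtain b where b: "[b = g] (mod p)" "[b = 1] (mod (m' * k))"
    using binary_chinese_remainder_nat[OF cop, of g 1] by blast
  have b1: "[b = 1] (mod m')" "[b = 1] (mod k)"
    using b(2) by (auto intro: cong_dvd_modulus_nat)
  have "jacobi (int b) m = Legendre (int b) (int p) * jacobi (int b) m'"
    unfolding m by (intro jacobi_prime_mult assms(2) \<open>odd m'\<close>)
  also have "Legendre (int b) (int p) = Legendre (int g) (int p)"
    by (rule Legendre_cong) (use b(1) in \<open>simp add: cong_int_iff\<close>)
  also have "jacobi (int b) m' = jacobi 1 m'"
    using b1(1) cong_int_iff[of b 1 m'] by (intro jacobi_cong \<open>odd m'\<close>) auto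
  finally have j: "jacobi (int b) m = -1" using g \<open>odd m'\<close> by simp
  moreover have "coprime b m"
    using jacobi_eq_0_iff[OF assms(4), of "int b"] j by simp
  moreover have "coprime b k"
    using b1(2) cong_imp_coprime cong_sym coprime_1_left by blast
  ultimately show ?thesis using b1(2) by auto
qed

text \<open>These are the characters off the diagonal when the square of a sum over symbols is
  opened. Nontriviality: some prime divides exactly one of the two distinct squarefree moduli, and
  flipping the sign there leaves the other symbol at 1.\<close>

lemma real_character_jacobi_product:
  assumes "squarefree m" "squarefree n" "odd m" "odd n" "m \<noteq> n"
  shows "real_character (m * n) (\<lambda>x. jacobi (int x) m * jacobi (int x) n)"
proof
  show "jacobi (int 1) m * jacobi (int 1) n = 1" using assms by simp
  show "jacobi (int (x * y)) m * jacobi (int (x * y)) n =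
      jacobi (int x) m * jacobi (int x) n * (jacobi (int y) m * jacobi (int y) n)" for x y
    using assms by (simp add: jacobi_mult_left)
  show "jacobi (int (x + m * n)) m * jacobi (int (x + m * n)) n = jacobi (int x) m * jacobi (int x) n" for x
  proof -
    have "jacobi (int (x + m * n)) m = jacobi (int x) m"
      by (intro jacobi_cong assms) (simp add: cong_iff_dvd_diff)
    moreover have "jacobi (int (x + m * n)) n = jacobi (int x) n"
      by (intro jacobi_cong assms) (simp add: cong_iff_dvd_diff)
    ultimately show ?thesis by simp
  qed
  show "jacobi (int x) m * jacobi (int x) n \<in> {-1, 0, 1}" for x
    using jacobi_values[OF assms(3), of "int x"] jacobi_values[OF assms(4), of "int x"] by auto
  show "m * n > 0" using assms by (auto intro!: Nat.gr0I)
  show "\<exists>b. coprime b (m * n) \<and> jacobi (int b) m * jacobi (int b) n = -1"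
  proof -
    have *: "\<exists>b. coprime b (m * n) \<and> jacobi (int b) m * jacobi (int b) n = -1"
      if p: "prime p" "p dvd m" "\<not> p dvd n" and mn: "squarefree m" "odd m" "odd n" for p m n :: nat
    proof -
      obtain b where b: "[b = 1] (mod n)" "coprime b (m * n)" "jacobi (int b) m = -1"
        using ex_jacobi_minus_one[OF mn(1) p(1,2) mn(2) p(3)] mn(3) odd_pos by blast
      have "jacobi (int b) n = jacobi 1 n"
        using b(1) cong_int_iff[of b 1 n] by (intro jacobi_cong mn) auto
      then show ?thesis using b(2,3) mn by (intro exI[of _ b]) simp
    qed
    from squarefree_prime_dvd_diff[OF assms(1,2,5)]
    obtain p where "prime p" "p dvd m \<and> \<not> p dvd n \<or> p dvd n \<and> \<not> p dvd m" by blast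
    then show ?thesis
    proof (elim disjE conjE)
      assume "prime p" "p dvd m" "\<not> p dvd n"
      then show ?thesis by (intro *[of p m n] assms)
    next
      assume "prime p" "p dvd n" "\<not> p dvd m"
      then have "\<exists>b. coprime b (n * m) \<and> jacobi (int b) n * jacobi (int b) m = -1"
        by (intro *[of p n m] assms)
      then show ?thesis by (simp only: mult.commute)
    qed
  qed
qed

text \<open>Reciprocity turns the symbol with fixed upper entry into \<open>jacobi x d\<close> times
  a factor \<open>s x\<close> depending only on \<open>x\<close> modulo 8, whence the period
  \<open>8 * d\<close>. Even \<open>x\<close> are sent to 0, since \<open>jacobi\<close> carries no
  meaning there.\<close>

lemma real_character_jacobi_upper:
  assumes d: "squarefree d" "odd d" and \<eta>: "\<eta> \<in> {1, -1, 2, -2}" "\<eta> * int d \<noteq> 1"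
  shows "real_character (8 * d) (\<lambda>x. if even x then 0 else jacobi (\<eta> * int d) x)"
proof -
  have dpos: "d > 0" using d(2) odd_pos by blast
  define s where "s = (\<lambda>x. jacobi \<eta> x * recip_sign d x)"
  have eq: "jacobi (\<eta> * int d) x = s x * jacobi (int x) d" if "odd x" for x
    using jacobi_mult_left[OF that, of \<eta> "int d"] jacobi_reciprocity[OF d(2) that]
    by (simp add: s_def)
  have s_cong: "s x = s y" if "odd x" "[x = y] (mod 8)" for x y
  proof -
    have e: "x mod 8 = y mod 8" using that by (simp add: Cong.cong_def)
    then have "x mod 4 = y mod 4" using mod_mod_cancel[of 4 8 x] mod_mod_cancel[of 4 8 y] by simp
    moreover have "odd y"
      using that(1) e mod_mod_cancel[of 2 8 x] mod_mod_cancel[of 2 8 y] by (simp add: odd_iff_mod_2_eq_one)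
    moreover have "jacobi (-2) z = jacobi (-1) z * jacobi 2 z" if "odd z" for z
      using jacobi_mult_left[OF that, of "-1" 2] by simp
    ultimately show ?thesis
      using that(1) e \<eta>(1) by (auto simp: s_def recip_sign_def jacobi_minus_one jacobi_two)
  qed
  have c8: "coprime b 8" if "odd b" for b :: nat
    using that coprime_power_right_iff[of b 2 3] by simp
  have s_1: "s 1 = 1" by (simp add: s_def recip_sign_def)
  show ?thesis
  proof
    show "(if even 1 then 0 else jacobi (\<eta> * int d) 1) = 1" by simp
    show "(if even (x * y) then 0 else jacobi (\<eta> * int d) (x * y)) =
        (if even x then 0 else jacobi (\<eta> * int d) x) * (if even y then 0 else jacobi (\<eta> * int d) y)" for x y :: nat
      by (auto intro!: jacobi_mult_right intro: Nat.gr0I)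
    show "(if even (x + 8 * d) then 0 else jacobi (\<eta> * int d) (x + 8 * d)) =
        (if even x then 0 else jacobi (\<eta> * int d) x)" for x
    proof (cases "even x")
      case False
      then have "jacobi (\<eta> * int d) (x + 8 * d) = s (x + 8 * d) * jacobi (int (x + 8 * d)) d"
        by (intro eq) auto
      also have "s (x + 8 * d) = s x"
        using False by (intro s_cong) (auto simp: Cong.cong_def)
      also have "jacobi (int (x + 8 * d)) d = jacobi (int x) d"
        by (intro jacobi_cong d) (simp add: cong_iff_dvd_diff)
      finally show ?thesis using False eq by simp
    qed simp
    show "(if even x then 0 else jacobi (\<eta> * int d) x) \<in> {-1, 0, 1}" for x
      using jacobi_values[of x "\<eta> * int d"] by auto
    show "8 * d > 0" using dpos by simp
    show "\<exists>b. coprime b (8 * d) \<and> (if even b then 0 else jacobi (\<eta> * int d) b) = -1"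
    proof (cases "d = 1")
      case True
      \<comment> \<open>The witness 3 works for -1 and 2, which are nonresidues modulo 3; but -2 is
        a square modulo 3, so it needs the witness 5.\<close>
      consider "\<eta> = -1" | "\<eta> = 2" | "\<eta> = -2" using \<eta> True by auto
      then show ?thesis
      proof cases
        case 1
        then show ?thesis using True jacobi_minus_one[of 3] c8[of 3] by (intro exI[of _ 3]) simp
      next
        case 2
        then show ?thesis using True jacobi_two[of 3] c8[of 3] by (intro exI[of _ 3]) simp
      next
        case 3
        then show ?thesis
          using True jacobi_two[of 5] jacobi_minus_one[of 5] jacobi_mult_left[of 5 "-1" 2]
          c8[of 5]
          by (intro exI[of _ 5]) simp
      qed
    next
      case False
      then obtain p where p: "prime p" "p dvd d" using prime_factor_nat by blast
      have "odd p" using p d by auto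
      then have "\<not> p dvd 8"
        using prime_dvd_power_nat[of p 2 3] p(1) primes_dvd_imp_eq[of p 2] by auto
      then obtain b where b: "[b = 1] (mod 8)" "coprime b (d * 8)" "jacobi (int b) d = -1"
        using ex_jacobi_minus_one[OF d(1) p d(2), of 8] by auto
      have "odd b" using b(2) by auto
      moreover have "s b = 1" using s_cong[OF \<open>odd b\<close> b(1)] s_1 by simp
      ultimately show ?thesis using b eq[of b] by (auto simp: mult.commute)
    qed
  qed
qed

section \<open>Bilinear sums of Jacobi symbols\<close>

lemma (in real_character) zero: "\<chi> 0 = 0"
proof -
  obtain b where "\<chi> b = -1" using nontrivial by blast
  then show ?thesis using mult[of 0 b] by simp
qed

lemma (in real_character) sum_bound_atLeast1: "\<bar>\<Sum>n\<in>{1..N}. \<chi> n\<bar> \<le> int q"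
proof -
  have "(\<Sum>n\<in>{1..N}. \<chi> n) = (\<Sum>n<Suc N. \<chi> n)"
    unfolding lessThan_Suc_atMost using zero
    by (intro sum.mono_neutral_left) (auto simp: Suc_le_eq)
  then show ?thesis using sum_bound[of "Suc N"] by simp
qed

section \<open>Moments of the divisor function\<close>

lemma sum_tau_le: "(\<Sum>n\<in>{1..Z}. real (tau n)) \<le> real Z * (1 + ln (real Z))"
proof (cases "Z = 0")
  case False
  have "(\<Sum>n\<in>{1..Z}. real (tau n)) = (\<Sum>n\<in>{1..Z}. \<Sum>e | e dvd n. 1)"
    by (simp add: tau_def)
  also have "\<dots> = (\<Sum>f\<in>{1..Z}. \<Sum>e\<in>{1..Z div f}. 1)"
    by (rule sum_divisors_swap)
  also have "\<dots> \<le> (\<Sum>f\<in>{1..Z}. real Z * (1 / real f))"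
    by (intro sum_mono) (simp add: of_nat_div_le_of_nat)
  also have "\<dots> = real Z * (\<Sum>f\<in>{1..Z}. 1 / real f)"
    by (simp add: sum_distrib_left)
  also have "\<dots> \<le> real Z * (1 + ln (real Z))"
    using False by (intro mult_left_mono sum_inverse_le_ln) auto
  finally show ?thesis .
qed simp

lemma ln_nat_nonneg: "0 \<le> ln (real n)"
  by (cases "n = 0") auto

lemma sum_tau_over_n_le:
  assumes "Z > 0"
  shows "(\<Sum>n\<in>{1..Z}. real (tau n) / real n) \<le> (1 + ln (real Z))\<^sup>2"
proof -
  have "(\<Sum>n\<in>{1..Z}. real (tau n) / real n) = (\<Sum>n\<in>{1..Z}. \<Sum>e | e dvd n. 1 / (real e * real (n div e)))"
  proof (intro sum.cong refl)
    fix n assume "n \<in> {1..Z}"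
    have "(\<Sum>e | e dvd n. 1 / (real e * real (n div e))) = (\<Sum>e | e dvd n. 1 / real n)"
      by (intro sum.cong refl) (auto simp flip: of_nat_mult)
    then show "real (tau n) / real n = (\<Sum>e | e dvd n. 1 / (real e * real (n div e)))"
      by (simp add: tau_def)
  qed
  also have "\<dots> = (\<Sum>f\<in>{1..Z}. \<Sum>e\<in>{1..Z div f}. 1 / (real e * real f))"
    by (rule sum_divisors_swap)
  also have "\<dots> \<le> (\<Sum>f\<in>{1..Z}. \<Sum>e\<in>{1..Z}. 1 / (real e * real f))"
    by (intro sum_mono sum_mono2) (auto intro: order_trans[OF _ div_le_dividend])
  also have "\<dots> = (\<Sum>e\<in>{1..Z}. 1 / real e)\<^sup>2"
    by (simp add: power2_eq_square sum_product mult.commute)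
  also have "\<dots> \<le> (1 + ln (real Z))\<^sup>2"
    using assms by (intro power_mono sum_inverse_le_ln sum_nonneg) auto
  finally show ?thesis .
qed

text \<open>One factor \<open>tau n\<close> is opened as a sum over \<open>n = e * f\<close>, the
  other is split by submultiplicativity. The sum over \<open>e\<close> yields one logarithm and the
  sum of \<open>tau f / f\<close> two more.\<close>

lemma sum_tau_squared_le:
  assumes "U > 0"
  shows "(\<Sum>n\<in>{1..U}. real (tau n) ^ 2) \<le> real U * (1 + ln (real U)) ^ 3"
proof -
  have "(\<Sum>n\<in>{1..U}. real (tau n) ^ 2) = (\<Sum>n\<in>{1..U}. \<Sum>e | e dvd n. real (tau (e * (n div e))))"
  proof (intro sum.cong refl)
    fix n assume "n \<in> {1..U}"
    have "(\<Sum>e | e dvd n. real (tau (e * (n div e)))) = (\<Sum>e | e dvd n. real (tau n))"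
      by (intro sum.cong refl) simp
    then show "real (tau n) ^ 2 = (\<Sum>e | e dvd n. real (tau (e * (n div e))))"
      by (simp add: tau_def power2_eq_square)
  qed
  also have "\<dots> = (\<Sum>f\<in>{1..U}. \<Sum>e\<in>{1..U div f}. real (tau (e * f)))"
    by (rule sum_divisors_swap)
  also have "\<dots> \<le> (\<Sum>f\<in>{1..U}. real U * (1 + ln (real U)) * (real (tau f) / real f))"
  proof (rule sum_mono)
    fix f assume f: "f \<in> {1..U}"
    have "(\<Sum>e\<in>{1..U div f}. real (tau (e * f))) \<le> (\<Sum>e\<in>{1..U div f}. real (tau e) * real (tau f))"
      using f by (intro sum_mono) (auto simp flip: of_nat_mult intro!: tau_mult_le)
    also have "\<dots> = (\<Sum>e\<in>{1..U div f}. real (tau e)) * real (tau f)"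
      by (simp add: sum_distrib_right)
    also have "\<dots> \<le> (real (U div f) * (1 + ln (real (U div f)))) * real (tau f)"
      by (intro mult_right_mono sum_tau_le) auto
    also have "\<dots> \<le> (real U / real f * (1 + ln (real U))) * real (tau f)"
    proof (intro mult_right_mono mult_mono add_left_mono)
      show "ln (real (U div f)) \<le> ln (real U)"
        using f by (auto simp: div_greater_zero_iff intro!: ln_mono)
    qed (use ln_nat_nonneg in \<open>auto simp: of_nat_div_le_of_nat add_nonneg_nonneg\<close>)
    finally show "(\<Sum>e\<in>{1..U div f}. real (tau (e * f)))
        \<le> real U * (1 + ln (real U)) * (real (tau f) / real f)" by (simp add: mult_ac)
  qed
  also have "\<dots> = real U * (1 + ln (real U)) * (\<Sum>f\<in>{1..U}. real (tau f) / real f)"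
    by (simp add: sum_distrib_left)
  also have "\<dots> \<le> real U * (1 + ln (real U)) * (1 + ln (real U))\<^sup>2"
    using ln_nat_nonneg[of U] assms by (intro mult_left_mono sum_tau_over_n_le) auto
  finally show ?thesis by (simp add: power2_eq_square power3_eq_cube mult.assoc)
qed

text \<open>Jensen's inequality for the sixth power. The exponent is 6 because inner sums will be
  cubed and then enter a mean square.\<close>

lemma sum_power6_le:
  fixes x :: "'a \<Rightarrow> real"
  assumes "finite S"
  shows "(\<Sum>i\<in>S. x i) ^ 6 \<le> real (card S) ^ 5 * (\<Sum>i\<in>S. x i ^ 6)"
proof (cases "S = {}")
  case False
  define n where "n = real (card S)"
  have n: "n > 0" using assms False by (auto simp: n_def card_gt_0_iff)
  have conv: "convex_on UNIV (\<lambda>t::real. t ^ 6)"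
    by (rule convex_power_even) simp
  have "(\<Sum>i\<in>S. (1 / n) *\<^sub>R x i) ^ 6 \<le> (\<Sum>i\<in>S. (1 / n) * x i ^ 6)"
    by (rule convex_on_sum[OF assms False conv]) (use n in \<open>auto simp: n_def\<close>)
  also have "(\<Sum>i\<in>S. (1 / n) *\<^sub>R x i) = (\<Sum>i\<in>S. x i) / n"
    by (simp add: sum_divide_distrib)
  also have "(\<Sum>i\<in>S. (1 / n) * x i ^ 6) = (\<Sum>i\<in>S. x i ^ 6) / n"
    by (simp add: sum_divide_distrib)
  finally have "(\<Sum>i\<in>S. x i) ^ 6 / n ^ 6 \<le> (\<Sum>i\<in>S. x i ^ 6) / n" by (simp add: power_divide)
  then have "(\<Sum>i\<in>S. x i) ^ 6 \<le> (\<Sum>i\<in>S. x i ^ 6) / n * n ^ 6"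
    using n by (simp add: pos_divide_le_eq)
  also have "\<dots> = n ^ 5 * (\<Sum>i\<in>S. x i ^ 6)" using n by (simp add: eval_nat_numeral)
  finally show ?thesis by (simp add: n_def)
qed simp

lemma sum_cube:
  fixes f :: "'a \<Rightarrow> 'b :: comm_semiring_1"
  shows "(\<Sum>x\<in>D. f x) ^ 3 = (\<Sum>x\<in>D. \<Sum>y\<in>D. \<Sum>z\<in>D. f x * (f y * f z))"
proof -
  have "(\<Sum>x\<in>D. f x) ^ 3 = (\<Sum>x\<in>D. f x) * ((\<Sum>x\<in>D. f x) * (\<Sum>x\<in>D. f x))"
    by (simp add: power3_eq_cube mult.assoc)
  also have "(\<Sum>x\<in>D. f x) * (\<Sum>x\<in>D. f x) = (\<Sum>y\<in>D. \<Sum>z\<in>D. f y * f z)"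
    by (rule sum_product)
  also have "(\<Sum>x\<in>D. f x) * \<dots> = (\<Sum>x\<in>D. \<Sum>y\<in>D. f x * (\<Sum>z\<in>D. f y * f z))"
    by (rule sum_product)
  also have "\<dots> = (\<Sum>x\<in>D. \<Sum>y\<in>D. \<Sum>z\<in>D. f x * (f y * f z))"
    by (simp only: sum_distrib_left)
  finally show ?thesis .
qed

section \<open>A large sieve bound for Jacobi symbols over rectangles\<close>

abbreviation jac :: "nat \<Rightarrow> nat \<Rightarrow> real" where
  "jac d m \<equiv> real_of_int (jacobi (int d) m)"

lemma abs_jac_le_1: "odd m \<Longrightarrow> \<bar>jac d m\<bar> \<le> 1"
  using jacobi_values[of m "int d"] by auto

text \<open>Opening the square, the diagonal contributes \<open>E\<close>, and every other pair a
  complete character sum up to its period, at most \<open>m * n \<le> T ^ 2\<close>; Cauchy-Schwarz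
  over at most \<open>T\<close> values of \<open>m\<close> adds the third factor \<open>T\<close>.
  This crude bound is good enough once \<open>E\<close> is at least \<open>T ^ 3\<close>.\<close>

lemma dual_large_sieve:
  fixes c :: "nat \<Rightarrow> real"
  assumes M: "M \<subseteq> {m \<in> {1..T}. odd m \<and> squarefree m}"
  shows "(\<Sum>e\<in>{1..E}. (\<Sum>m\<in>M. c m * jac e m)\<^sup>2) \<le> (real E + real T ^ 3) * (\<Sum>m\<in>M. (c m)\<^sup>2)"
proof -
  have fin: "finite M" using M finite_subset[OF M] by simp
  have cardM: "real (card M) \<le> real T"
  proof -
    have "M \<subseteq> {1..T}" using M by auto
    then show ?thesis using card_mono[of "{1..T}" M] by simp
  qed
  have inner: "\<bar>\<Sum>e\<in>{1..E}. jac e m * jac e n\<bar> \<le> (if m = n then real E else 0) + real T ^ 2"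
    if "m \<in> M" "n \<in> M" for m n
  proof (cases "m = n")
    case True
    have "\<bar>\<Sum>e\<in>{1..E}. jac e m * jac e n\<bar> \<le> (\<Sum>e\<in>{1..E}. \<bar>jac e m * jac e n\<bar>)"
      by (rule sum_abs)
    also have "\<dots> \<le> (\<Sum>e\<in>{1..E}. 1)"
      using that M by (intro sum_mono) (auto simp: abs_mult intro!: mult_le_one abs_jac_le_1)
    finally have "\<bar>\<Sum>e\<in>{1..E}. jac e m * jac e n\<bar> \<le> real E" by simp
    moreover have "0 \<le> real T ^ 2" by simp
    ultimately show ?thesis unfolding if_P[OF True] by linarith
  next
    case False
    interpret real_character "m * n" "\<lambda>x. jacobi (int x) m * jacobi (int x) n"
      by (rule real_character_jacobi_product) (use that M False in auto)
    have "real_of_int \<bar>\<Sum>e\<in>{1..E}. jacobi (int e) m * jacobi (int e) n\<bar> \<le> real_of_int (int (m * n))"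
      using sum_bound_atLeast1[of E] by (simp only: of_int_le_iff)
    then have "\<bar>\<Sum>e\<in>{1..E}. jac e m * jac e n\<bar> \<le> real (m * n)" by simp
    also have "\<dots> \<le> real (T * T)" using that M by (subst of_nat_le_iff) (auto intro!: mult_le_mono)
    finally show ?thesis using False by (simp add: power2_eq_square)
  qed
  have "(\<Sum>e\<in>{1..E}. (\<Sum>m\<in>M. c m * jac e m)\<^sup>2) =
      (\<Sum>e\<in>{1..E}. \<Sum>m\<in>M. \<Sum>n\<in>M. c m * c n * (jac e m * jac e n))"
    by (simp add: power2_eq_square sum_product mult_ac)
  also have "\<dots> = (\<Sum>m\<in>M. \<Sum>e\<in>{1..E}. \<Sum>n\<in>M. c m * c n * (jac e m * jac e n))"
    by (rule sum.swap)
  also have "\<dots> = (\<Sum>m\<in>M. \<Sum>n\<in>M. \<Sum>e\<in>{1..E}. c m * c n * (jac e m * jac e n))"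
    by (intro sum.cong refl sum.swap)
  also have "\<dots> = (\<Sum>m\<in>M. \<Sum>n\<in>M. c m * c n * (\<Sum>e\<in>{1..E}. jac e m * jac e n))"
    by (simp add: sum_distrib_left)
  also have "\<dots> \<le> (\<Sum>m\<in>M. \<Sum>n\<in>M. \<bar>c m\<bar> * \<bar>c n\<bar> * ((if m = n then real E else 0) + real T ^ 2))"
  proof (intro sum_mono)
    fix m n assume "m \<in> M" "n \<in> M"
    have "c m * c n * (\<Sum>e\<in>{1..E}. jac e m * jac e n) \<le> \<bar>c m * c n\<bar> * \<bar>\<Sum>e\<in>{1..E}. jac e m * jac e n\<bar>"
      unfolding abs_mult[symmetric] by (rule abs_ge_self)
    also have "\<dots> \<le> \<bar>c m * c n\<bar> * ((if m = n then real E else 0) + real T ^ 2)"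
      by (intro mult_left_mono inner \<open>m \<in> M\<close> \<open>n \<in> M\<close>) auto
    finally show "c m * c n * (\<Sum>e\<in>{1..E}. jac e m * jac e n)
        \<le> \<bar>c m\<bar> * \<bar>c n\<bar> * ((if m = n then real E else 0) + real T ^ 2)" by (simp add: abs_mult)
  qed
  also have "\<dots> = (\<Sum>m\<in>M. \<Sum>n\<in>M. if m = n then real E * (\<bar>c m\<bar> * \<bar>c n\<bar>) else 0)
      + (\<Sum>m\<in>M. \<Sum>n\<in>M. real T ^ 2 * (\<bar>c m\<bar> * \<bar>c n\<bar>))"
    unfolding sum.distrib[symmetric] by (intro sum.cong refl) (auto simp: algebra_simps)
  also have "(\<Sum>m\<in>M. \<Sum>n\<in>M. if m = n then real E * (\<bar>c m\<bar> * \<bar>c n\<bar>) else 0) = real E * (\<Sum>m\<in>M. (c m)\<^sup>2)"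
    using fin by (simp add: sum.delta' sum_distrib_left power2_eq_square)
  also have "(\<Sum>m\<in>M. \<Sum>n\<in>M. real T ^ 2 * (\<bar>c m\<bar> * \<bar>c n\<bar>)) = real T ^ 2 * (\<Sum>m\<in>M. \<bar>c m\<bar>)\<^sup>2"
  proof -
    have "(\<Sum>m\<in>M. \<bar>c m\<bar>)\<^sup>2 = (\<Sum>m\<in>M. \<Sum>n\<in>M. \<bar>c m\<bar> * \<bar>c n\<bar>)"
      by (simp only: power2_eq_square sum_product)
    then show ?thesis by (simp only: sum_distrib_left)
  qed
  also have "real E * (\<Sum>m\<in>M. (c m)\<^sup>2) + real T ^ 2 * (\<Sum>m\<in>M. \<bar>c m\<bar>)\<^sup>2
      \<le> real E * (\<Sum>m\<in>M. (c m)\<^sup>2) + real T ^ 2 * ((\<Sum>m\<in>M. (c m)\<^sup>2) * real T)"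
  proof (intro add_left_mono mult_left_mono)
    have "(\<Sum>m\<in>M. \<bar>c m\<bar>)\<^sup>2 \<le> (\<Sum>m\<in>M. \<bar>c m\<bar>\<^sup>2) * real (card M)"
      by (rule sum_squared_le_sum_of_squares)
    also have "\<dots> \<le> (\<Sum>m\<in>M. \<bar>c m\<bar>\<^sup>2) * real T"
      by (intro mult_left_mono cardM sum_nonneg) auto
    finally show "(\<Sum>m\<in>M. \<bar>c m\<bar>)\<^sup>2 \<le> (\<Sum>m\<in>M. (c m)\<^sup>2) * real T" by simp
  qed simp
  also have "\<dots> = (real E + real T ^ 3) * (\<Sum>m\<in>M. (c m)\<^sup>2)"
    by (simp add: algebra_simps eval_nat_numeral)
  finally show ?thesis .
qed

text \<open>Cubing the inner sum lengthens its variable from $U$ to $U^3$, which then exceeds the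
  period of the characters that occur after duality.\<close>
lemma jacobi_rectangle_power6:
  fixes \<alpha> \<beta> :: "nat \<Rightarrow> real"
  assumes M: "M \<subseteq> {m \<in> {1..T}. odd m \<and> squarefree m}" and D: "D \<subseteq> {1..U}"
    and TU: "0 < T" "T \<le> U"
    and \<alpha>: "\<And>m. \<bar>\<alpha> m\<bar> \<le> 1" and \<beta>: "\<And>d. \<bar>\<beta> d\<bar> \<le> 1"
  shows "(\<Sum>m\<in>M. \<Sum>d\<in>D. \<alpha> m * \<beta> d * jac d m) ^ 6 \<le> 2 * real T ^ 5 * real U ^ 6 * (1 + ln (real U)) ^ 9"
proof -
  have finM: "finite M" and finD: "finite D"
    using M D finite_subset[OF M] finite_subset[OF D] by simp_all
  define R where "R = (\<lambda>m. \<Sum>d\<in>D. \<beta> d * jac d m)"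
  define c where "c = (\<lambda>m. R m ^ 3)"
  define Q where "Q = (\<Sum>m\<in>M. (c m)\<^sup>2)"
  define D3 where "D3 = D \<times> D \<times> D"
  define e where "e = (\<lambda>(a :: nat, b :: nat, d :: nat). a * b * d)"
  define b where "b = (\<lambda>(a, b, d). \<beta> a * \<beta> b * \<beta> d)"
  define A where "A = (\<lambda>e. \<Sum>m\<in>M. c m * jac e m)"
  define r where "r = (\<lambda>k. real (card {t \<in> D3. e t = k}))"
  have finD3: "finite D3" using finD by (simp add: D3_def)
  have odd: "odd m" if "m \<in> M" for m using that M by auto
  have Dpos: "d > 0" if "d \<in> D" for d using that D by auto
  have cube: "c m = (\<Sum>t\<in>D3. b t * jac (e t) m)" if "m \<in> M" for m
  proof -
    have "c m = (\<Sum>x\<in>D. \<Sum>y\<in>D. \<Sum>z\<in>D. (\<beta> x * jac x m) * ((\<beta> y * jac y m) * (\<beta> z * jac z m)))"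
      unfolding c_def R_def by (rule sum_cube)
    also have "\<dots> = (\<Sum>t\<in>D3. b t * jac (e t) m)"
      using odd[OF that]
      by (simp add: D3_def sum.cartesian_product b_def e_def case_prod_beta jacobi_mult_left mult_ac)
    finally show ?thesis .
  qed
  have range_e: "e ` D3 \<subseteq> {1..U ^ 3}"
  proof -
    have "x * y * z \<in> {1..U ^ 3}" if "x \<in> D" "y \<in> D" "z \<in> D" for x y z
    proof -
      have "x * y * z \<le> U * U * U" using that D by (intro mult_le_mono) auto
      moreover have "x * y * z > 0" using that Dpos by simp
      ultimately show ?thesis by (simp add: power3_eq_cube Suc_le_eq)
    qed
    then show ?thesis by (auto simp: D3_def e_def)
  qed
  have b_le: "\<bar>b t\<bar> \<le> 1" for t
    using \<beta> by (auto simp: b_def abs_mult split: prod.split intro!: mult_le_one)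
  \<comment> \<open>Duality: opening one of the two cubes in \<open>c m * c m\<close> makes
    \<open>Q\<close> a linear form in the sums \<open>A\<close>. The sieve bounds the mean square of
    \<open>A\<close> by \<open>Q\<close> again, so after Cauchy-Schwarz one factor \<open>Q\<close>
    cancels.\<close>
  have "Q = (\<Sum>m\<in>M. c m * (\<Sum>t\<in>D3. b t * jac (e t) m))"
    unfolding Q_def power2_eq_square using cube by (intro sum.cong refl) simp
  also have "\<dots> = (\<Sum>t\<in>D3. \<Sum>m\<in>M. c m * (b t * jac (e t) m))"
    by (simp only: sum_distrib_left) (rule sum.swap)
  also have "\<dots> = (\<Sum>t\<in>D3. b t * A (e t))"
    by (simp add: A_def sum_distrib_left mult_ac)
  also have "\<dots> \<le> (\<Sum>t\<in>D3. \<bar>A (e t)\<bar>)"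
  proof (rule sum_mono)
    fix t
    have "b t * A (e t) \<le> \<bar>b t\<bar> * \<bar>A (e t)\<bar>" unfolding abs_mult[symmetric] by (rule abs_ge_self)
    also have "\<dots> \<le> 1 * \<bar>A (e t)\<bar>" by (intro mult_right_mono b_le) auto
    finally show "b t * A (e t) \<le> \<bar>A (e t)\<bar>" by simp
  qed
  also have "\<dots> = (\<Sum>k\<in>{1..U ^ 3}. \<Sum>t | t \<in> D3 \<and> e t = k. \<bar>A (e t)\<bar>)"
    by (rule sum.group[symmetric]) (use finD3 range_e in auto)
  also have "\<dots> = (\<Sum>k\<in>{1..U ^ 3}. r k * \<bar>A k\<bar>)"
    by (intro sum.cong refl) (simp add: r_def)
  finally have Q_le: "Q \<le> (\<Sum>k\<in>{1..U ^ 3}. r k * \<bar>A k\<bar>)" .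
  have Q0: "0 \<le> Q" unfolding Q_def by (intro sum_nonneg) auto
  define S where "S = (\<Sum>k\<in>{1..U ^ 3}. (r k)\<^sup>2)"
  have S0: "0 \<le> S" unfolding S_def by (intro sum_nonneg) auto
  have "Q\<^sup>2 \<le> (\<Sum>k\<in>{1..U ^ 3}. r k * \<bar>A k\<bar>)\<^sup>2"
    by (intro power_mono Q_le Q0)
  also have "\<dots> \<le> S * (\<Sum>k\<in>{1..U ^ 3}. \<bar>A k\<bar>\<^sup>2)"
    unfolding S_def by (rule Cauchy_Schwarz_ineq_sum)
  also have "\<dots> = S * (\<Sum>k\<in>{1..U ^ 3}. (A k)\<^sup>2)" by simp
  also have "\<dots> \<le> S * ((real (U ^ 3) + real T ^ 3) * Q)"
    unfolding A_def Q_def by (intro mult_left_mono dual_large_sieve M S0)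
  also have "\<dots> \<le> S * ((real U ^ 3 + real U ^ 3) * Q)"
    using TU by (intro mult_left_mono mult_right_mono add_mono power_mono Q0 S0) auto
  finally have "Q * Q \<le> (2 * real U ^ 3 * S) * Q" by (simp add: power2_eq_square mult_ac)
  then have Q_le2: "Q \<le> 2 * real U ^ 3 * S"
    using Q0 S0 by (cases "Q = 0") (auto simp: mult_nonneg_nonneg)
  have r_le: "r k \<le> real (tau k) ^ 2" if "k > 0" for k
  proof -
    have "card {t \<in> D3. e t = k} \<le> card ({a. a dvd k} \<times> {a. a dvd k})"
    proof (rule card_inj_on_le[where f = "\<lambda>(x, y, z). (x, y)"])
      show "inj_on (\<lambda>(x, y, z). (x, y)) {t \<in> D3. e t = k}"
        using that by (auto simp: inj_on_def e_def)
    qed (use that in \<open>auto simp: e_def\<close>)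
    then show ?thesis
      by (simp add: r_def card_cartesian_product tau_def power2_eq_square flip: of_nat_mult)
  qed
  \<comment> \<open>Replacing only one of the two factors \<open>r k\<close> by its divisor bound
    leaves a sum over triples, which submultiplicativity of \<open>tau\<close> separates into a cube
    of second moments.\<close>
  have "S \<le> (\<Sum>k\<in>{1..U ^ 3}. r k * real (tau k) ^ 2)"
    unfolding S_def power2_eq_square[of "r _"]
    by (intro sum_mono mult_left_mono r_le) (auto simp: r_def)
  also have "\<dots> = (\<Sum>k\<in>{1..U ^ 3}. \<Sum>t | t \<in> D3 \<and> e t = k. real (tau (e t)) ^ 2)"
    by (intro sum.cong refl) (simp add: r_def)
  also have "\<dots> = (\<Sum>t\<in>D3. real (tau (e t)) ^ 2)"
    by (rule sum.group) (use finD3 range_e in auto)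
  also have "\<dots> \<le> (\<Sum>(x, y, z)\<in>D3. real (tau x) ^ 2 * (real (tau y) ^ 2 * real (tau z) ^ 2))"
  proof (intro sum_mono, clarify)
    fix x y z assume "(x, y, z) \<in> D3"
    then have pos: "x > 0" "y > 0" "z > 0" using Dpos by (auto simp: D3_def)
    have "tau (x * y * z) \<le> tau (x * y) * tau z" using pos by (intro tau_mult_le) auto
    also have "\<dots> \<le> tau x * tau y * tau z" using pos by (intro mult_right_mono tau_mult_le) auto
    finally have "real (tau (x * y * z)) \<le> real (tau x * tau y * tau z)"
      by (simp only: of_nat_le_iff)
    then have "real (tau (x * y * z)) ^ 2 \<le> real (tau x * tau y * tau z) ^ 2"
      by (rule power_mono) simp
    then show "real (tau (e (x, y, z))) ^ 2 \<le> real (tau x) ^ 2 * (real (tau y) ^ 2 * real (tau z) ^ 2)"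
      by (simp add: e_def power_mult_distrib mult.assoc)
  qed
  also have "\<dots> = (\<Sum>x\<in>D. real (tau x) ^ 2) ^ 3"
    unfolding D3_def sum_cube by (simp add: sum.cartesian_product case_prod_beta)
  also have "\<dots> \<le> (\<Sum>x\<in>{1..U}. real (tau x) ^ 2) ^ 3"
    using D by (intro power_mono sum_mono2 sum_nonneg) auto
  also have "\<dots> \<le> (real U * (1 + ln (real U)) ^ 3) ^ 3"
    using TU by (intro power_mono sum_tau_squared_le sum_nonneg) auto
  finally have S_le: "S \<le> real U ^ 3 * (1 + ln (real U)) ^ 9"
    by (simp add: power_mult_distrib flip: power_mult)
  have cardM: "real (card M) \<le> real T"
  proof -
    have "M \<subseteq> {1..T}" using M by auto
    then show ?thesis using card_mono[of "{1..T}" M] by simp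
  qed
  have "(\<Sum>m\<in>M. \<Sum>d\<in>D. \<alpha> m * \<beta> d * jac d m) = (\<Sum>m\<in>M. \<alpha> m * R m)"
    by (simp add: R_def sum_distrib_left mult.assoc)
  also have "\<dots> ^ 6 \<le> real (card M) ^ 5 * (\<Sum>m\<in>M. (\<alpha> m * R m) ^ 6)"
    by (rule sum_power6_le[OF finM])
  also have "\<dots> \<le> real T ^ 5 * (\<Sum>m\<in>M. (c m)\<^sup>2)"
  proof (intro mult_mono power_mono sum_mono cardM)
    fix m
    have "(\<alpha> m * R m) ^ 6 = \<bar>\<alpha> m\<bar> ^ 6 * R m ^ 6" by (simp add: power_mult_distrib)
    also have "\<dots> \<le> 1 * R m ^ 6"
      using \<alpha>[of m] by (intro mult_right_mono power_le_one) auto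
    finally show "(\<alpha> m * R m) ^ 6 \<le> (c m)\<^sup>2" by (simp add: c_def flip: power_mult)
  qed (auto intro!: sum_nonneg)
  also have "\<dots> \<le> real T ^ 5 * (2 * real U ^ 3 * (real U ^ 3 * (1 + ln (real U)) ^ 9))"
    unfolding Q_def[symmetric]
    by (intro mult_left_mono order_trans[OF Q_le2]) (use S_le in \<open>auto intro!: mult_left_mono\<close>)
  also have "\<dots> = 2 * real T ^ 5 * real U ^ 6 * (1 + ln (real U)) ^ 9"
    by (simp add: mult_ac flip: power_add)
  finally show ?thesis .
qed

text \<open>Sixth root of the preceding bound. Since \<open>T ^ 5 = T ^ 6 * T powr (-1)\<close>, the
  saving is \<open>T powr (-1/6)\<close>; the constant and the logarithmic exponent 9/6 are rounded
  up to 2.\<close>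

lemma jacobi_rectangle_aux:
  fixes \<alpha> \<beta> :: "nat \<Rightarrow> real"
  assumes M: "M \<subseteq> {m \<in> {1..T}. odd m \<and> squarefree m}" and D: "D \<subseteq> {1..U}"
    and TU: "0 < T" "T \<le> U"
    and \<alpha>: "\<And>m. \<bar>\<alpha> m\<bar> \<le> 1" and \<beta>: "\<And>d. \<bar>\<beta> d\<bar> \<le> 1"
  shows "\<bar>\<Sum>m\<in>M. \<Sum>d\<in>D. \<alpha> m * \<beta> d * jac d m\<bar>
    \<le> 2 * real T * real U * (1 + ln (real U)) ^ 2 * real T powr (-1/6)"
proof -
  let ?B = "\<Sum>m\<in>M. \<Sum>d\<in>D. \<alpha> m * \<beta> d * jac d m" and ?L = "1 + ln (real U)"
  let ?K = "2 * real T * real U * ?L ^ 2 * real T powr (-1/6)"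
  have L: "?L \<ge> 1" using ln_nat_nonneg[of U] by simp
  have "(real T powr (-1/6)) ^ 6 = real T powr (-1)"
    using TU by (simp add: powr_power)
  then have "?K ^ 6 = 64 * real T ^ 6 * real U ^ 6 * ?L ^ 12 * real T powr (-1)"
    by (simp add: power_mult_distrib flip: power_mult)
  also have "\<dots> = 64 * real T ^ 5 * real U ^ 6 * ?L ^ 12"
    using TU by (simp add: powr_minus field_simps eval_nat_numeral)
  finally have K6: "?K ^ 6 = 64 * real T ^ 5 * real U ^ 6 * ?L ^ 12" .
  have "\<bar>?B\<bar> ^ 6 = ?B ^ 6" by simp
  also have "\<dots> \<le> 2 * real T ^ 5 * real U ^ 6 * ?L ^ 9"
    by (rule jacobi_rectangle_power6[OF M D TU \<alpha> \<beta>])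
  also have "\<dots> \<le> 64 * real T ^ 5 * real U ^ 6 * ?L ^ 12"
    using L TU by (intro mult_mono power_increasing) (auto simp: Suc_le_eq)
  finally have "\<bar>?B\<bar> ^ 6 \<le> ?K ^ 6" unfolding K6 .
  moreover have "0 \<le> ?K" using L by simp
  ultimately show ?thesis by (rule power_le_imp_le_base[where n = 5, simplified numeral_eq_Suc, simplified])
qed

text \<open>If \<open>U < T\<close>, reciprocity exchanges the two variables. The sign it produces
  is not a product of a function of \<open>d\<close> and one of \<open>m\<close>, so
  \<open>D\<close> is first cut into the classes 1 and 3 modulo 4; this doubles the
  constant.\<close>

lemma jacobi_rectangle:
  fixes \<alpha> \<beta> :: "nat \<Rightarrow> real"
  assumes M: "M \<subseteq> {m \<in> {1..T}. odd m \<and> squarefree m}"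
    and D: "D \<subseteq> {d \<in> {1..U}. odd d \<and> squarefree d}"
    and TU: "0 < T" "0 < U"
    and \<alpha>: "\<And>m. \<bar>\<alpha> m\<bar> \<le> 1" and \<beta>: "\<And>d. \<bar>\<beta> d\<bar> \<le> 1"
  shows "\<bar>\<Sum>m\<in>M. \<Sum>d\<in>D. \<alpha> m * \<beta> d * jac d m\<bar>
    \<le> 4 * real T * real U * (1 + ln (real (max T U))) ^ 2 * real (min T U) powr (-1/6)"
proof (cases "T \<le> U")
  case True
  have "\<bar>\<Sum>m\<in>M. \<Sum>d\<in>D. \<alpha> m * \<beta> d * jac d m\<bar>
      \<le> 2 * real T * real U * (1 + ln (real U)) ^ 2 * real T powr (-1/6)"
    using D True TU by (intro jacobi_rectangle_aux M \<alpha> \<beta>) auto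
  also have "\<dots> \<le> 4 * real T * real U * (1 + ln (real U)) ^ 2 * real T powr (-1/6)"
    by (intro mult_right_mono) auto
  finally show ?thesis using True by (simp add: max_def min_def)
next
  case False
  have finM: "finite M" and finD: "finite D"
    using M D finite_subset[OF M] finite_subset[OF D] by simp_all
  define D1 where "D1 = {d \<in> D. d mod 4 = 1}"
  define D3 where "D3 = {d \<in> D. d mod 4 = 3}"
  \<comment> \<open>For \<open>d\<close> congruent to 3 modulo 4 the reciprocity sign is a function
    of \<open>m\<close> alone and can be moved into the coefficient.\<close>
  define \<gamma> where "\<gamma> = (\<lambda>m. \<alpha> m * real_of_int (recip_sign 3 m))"
  have sub: "D1 \<subseteq> {d \<in> {1..U}. odd d \<and> squarefree d}" "D3 \<subseteq> {d \<in> {1..U}. odd d \<and> squarefree d}"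
    using D by (auto simp: D1_def D3_def)
  have "D = D1 \<union> D3" "D1 \<inter> D3 = {}"
  proof -
    have "d mod 4 = 1 \<or> d mod 4 = 3" if "d \<in> D" for d
    proof -
      have "odd d" using that D by auto
      then show ?thesis by presburger
    qed
    then show "D = D1 \<union> D3" by (auto simp: D1_def D3_def)
  qed (auto simp: D1_def D3_def)
  then have split: "(\<Sum>d\<in>D. f d) = (\<Sum>d\<in>D1. f d) + (\<Sum>d\<in>D3. f d)" for f :: "nat \<Rightarrow> real"
    using finD by (simp add: sum.union_disjoint)
  have "(\<Sum>m\<in>M. \<Sum>d\<in>D. \<alpha> m * \<beta> d * jac d m) = (\<Sum>d\<in>D. \<Sum>m\<in>M. \<alpha> m * \<beta> d * jac d m)"
    by (rule sum.swap)
  also have "\<dots> = (\<Sum>d\<in>D1. \<Sum>m\<in>M. \<alpha> m * \<beta> d * jac d m) + (\<Sum>d\<in>D3. \<Sum>m\<in>M. \<alpha> m * \<beta> d * jac d m)"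
    by (rule split)
  also have "(\<Sum>d\<in>D1. \<Sum>m\<in>M. \<alpha> m * \<beta> d * jac d m) = (\<Sum>d\<in>D1. \<Sum>m\<in>M. \<beta> d * \<alpha> m * jac m d)"
  proof (intro sum.cong refl)
    fix d m assume "d \<in> D1" "m \<in> M"
    then have "odd d" "odd m" using sub M by auto
    then have "jac d m = real_of_int (recip_sign d m) * jac m d"
      using jacobi_reciprocity[of d m] by simp
    then show "\<alpha> m * \<beta> d * jac d m = \<beta> d * \<alpha> m * jac m d"
      using \<open>d \<in> D1\<close> by (simp add: recip_sign_def D1_def)
  qed
  also have "(\<Sum>d\<in>D3. \<Sum>m\<in>M. \<alpha> m * \<beta> d * jac d m) = (\<Sum>d\<in>D3. \<Sum>m\<in>M. \<beta> d * \<gamma> m * jac m d)"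
  proof (intro sum.cong refl)
    fix d m assume "d \<in> D3" "m \<in> M"
    then have "odd d" "odd m" using sub M by auto
    then have "jac d m = real_of_int (recip_sign d m) * jac m d"
      using jacobi_reciprocity[of d m] by simp
    then show "\<alpha> m * \<beta> d * jac d m = \<beta> d * \<gamma> m * jac m d"
      using \<open>d \<in> D3\<close> by (simp add: recip_sign_def D3_def \<gamma>_def)
  qed
  finally have eq: "(\<Sum>m\<in>M. \<Sum>d\<in>D. \<alpha> m * \<beta> d * jac d m) =
      (\<Sum>d\<in>D1. \<Sum>m\<in>M. \<beta> d * \<alpha> m * jac m d) + (\<Sum>d\<in>D3. \<Sum>m\<in>M. \<beta> d * \<gamma> m * jac m d)" .
  have M': "M \<subseteq> {1..T}" using M by auto
  have \<gamma>: "\<bar>\<gamma> m\<bar> \<le> 1" for m using \<alpha>[of m] by (simp add: \<gamma>_def recip_sign_def)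
  have "\<bar>\<Sum>d\<in>D1. \<Sum>m\<in>M. \<beta> d * \<alpha> m * jac m d\<bar>
      \<le> 2 * real U * real T * (1 + ln (real T)) ^ 2 * real U powr (-1/6)"
    using False TU by (intro jacobi_rectangle_aux sub M' \<alpha> \<beta>) auto
  moreover have "\<bar>\<Sum>d\<in>D3. \<Sum>m\<in>M. \<beta> d * \<gamma> m * jac m d\<bar>
      \<le> 2 * real U * real T * (1 + ln (real T)) ^ 2 * real U powr (-1/6)"
    using False TU by (intro jacobi_rectangle_aux sub M' \<gamma> \<beta>) auto
  ultimately have "\<bar>\<Sum>m\<in>M. \<Sum>d\<in>D. \<alpha> m * \<beta> d * jac d m\<bar>
      \<le> 4 * real T * real U * (1 + ln (real T)) ^ 2 * real U powr (-1/6)"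
    unfolding eq by (simp add: mult_ac)
  then show ?thesis using False by (simp add: max_def min_def)
qed

section \<open>From rectangles to the hyperbolic region\<close>

lemma card_nat_interval_le:
  fixes x y :: real
  assumes "x \<le> y"
  shows "real (card {d::nat. x < real d \<and> real d \<le> y}) \<le> y - x + 1"
proof -
  have "int ` {d::nat. x < real d \<and> real d \<le> y} \<subseteq> {\<lfloor>x\<rfloor> + 1..\<lfloor>y\<rfloor>}"
    by (auto simp: floor_less_iff le_floor_iff) linarith+
  then have "card (int ` {d::nat. x < real d \<and> real d \<le> y}) \<le> card {\<lfloor>x\<rfloor> + 1..\<lfloor>y\<rfloor>}"
    by (intro card_mono) auto
  then have "real (card {d::nat. x < real d \<and> real d \<le> y}) \<le> real (card {\<lfloor>x\<rfloor> + 1..\<lfloor>y\<rfloor>})"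
    by (simp add: card_image)
  also have "\<dots> \<le> y - x + 1"
    using assms floor_mono[OF assms] by (simp add: of_nat_nat) linarith
  finally show ?thesis .
qed

text \<open>The condition $md \le Z$ is made independent of $m$ by cutting the range of $m$ into
  intervals of ratio $1 + \delta$; the pairs lost in doing so satisfy $Z/(1+\delta) < md \le Z$.\<close>
lemma jacobi_hyperbola:
  fixes \<alpha> \<beta> :: "nat \<Rightarrow> real" and V Z :: nat
  assumes M: "M \<subseteq> {m \<in> {1..Z}. V < m \<and> odd m \<and> squarefree m}"
    and D: "D \<subseteq> {d \<in> {1..Z}. V < d \<and> odd d \<and> squarefree d}"
    and pos: "0 < V" "0 < Z"
    and \<alpha>: "\<And>m. \<bar>\<alpha> m\<bar> \<le> 1" and \<beta>: "\<And>d. \<bar>\<beta> d\<bar> \<le> 1"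
  shows "\<bar>\<Sum>m\<in>M. \<Sum>d | d \<in> D \<and> m * d \<le> Z. \<alpha> m * \<beta> d * jac d m\<bar>
    \<le> 10 * real Z * (1 + ln (real Z)) ^ 3 * real V powr (-1/12)"
proof -
  have finM: "finite M" and finD: "finite D"
    using M D finite_subset[OF M] finite_subset[OF D] by simp_all
  define L where "L = 1 + ln (real Z)"
  have L1: "L \<ge> 1" using ln_nat_nonneg[of Z] by (simp add: L_def)
  \<comment> \<open>This balances the two errors: about \<open>L / \<delta>\<close> rectangles with
    saving \<open>V powr (-1/6)\<close>, which is the square of \<open>\<delta>\<close>, against
    lost pairs numbering about \<open>\<delta> * Z * L\<close>.\<close>
  define \<delta> where "\<delta> = real V powr (-1/12)"
  have \<delta>: "0 < \<delta>" "\<delta> \<le> 1"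
    using pos powr_mono[of "-1/12" 0 "real V"] by (auto simp: \<delta>_def)
  define T where "T = (\<lambda>k. real V * (1 + \<delta>) ^ k)"
  \<comment> \<open>The index of the interval containing \<open>m\<close>. With \<open>U k\<close>
    taken from the upper end \<open>T k\<close>, every \<open>d \<le> U k\<close> is permitted for
    each \<open>m\<close> in the \<open>k\<close>-th interval.\<close>
  define \<kappa> where "\<kappa> = (\<lambda>m. LEAST k. real m \<le> T k)"
  define K where "K = nat \<lfloor>1 + 2 * ln (real Z) / \<delta>\<rfloor>"
  define U where "U = (\<lambda>k. nat \<lfloor>real Z / T k\<rfloor>)"
  have Tpos: "T k > 0" for k using pos \<delta> by (simp add: T_def)
  have ex: "\<exists>k. real m \<le> T k" for m
  proof -
    obtain k where "real m < (1 + \<delta>) ^ k" using real_arch_pow[of "1 + \<delta>" "real m"] \<delta> by auto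
    also have "\<dots> \<le> T k" using pos \<delta> by (simp add: T_def mult_le_cancel_right1)
    finally show ?thesis by (auto intro: less_imp_le)
  qed
  have \<kappa>_ge: "real m \<le> T (\<kappa> m)" for m
    unfolding \<kappa>_def by (rule LeastI_ex[OF ex])
  have \<kappa>_pos: "\<kappa> m \<ge> 1" if "m \<in> M" for m
    using \<kappa>_ge[of m] that M by (cases "\<kappa> m") (auto simp: T_def)
  have \<kappa>_lt: "T (\<kappa> m) < (1 + \<delta>) * real m" if "m \<in> M" for m
  proof -
    have "\<kappa> m - 1 < \<kappa> m" using \<kappa>_pos[OF that] by simp
    then have "\<not> real m \<le> T (\<kappa> m - 1)" unfolding \<kappa>_def by (rule not_less_Least)
    moreover have "T (\<kappa> m) = (1 + \<delta>) * T (\<kappa> m - 1)"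
      using \<kappa>_pos[OF that] by (cases "\<kappa> m") (auto simp: T_def)
    ultimately show ?thesis using \<delta> by simp
  qed
  have ln\<delta>: "\<delta> / 2 \<le> ln (1 + \<delta>)"
  proof -
    have "exp (\<delta> / 2) \<le> 1 + \<delta> / 2 + (\<delta> / 2)\<^sup>2"
      using \<delta> by (intro exp_bound) auto
    also have "\<dots> \<le> 1 + \<delta>" using \<delta> mult_left_mono[of \<delta> 1 \<delta>] by (simp add: power2_eq_square field_simps)
    finally have "ln (exp (\<delta> / 2)) \<le> ln (1 + \<delta>)" by (intro ln_mono) auto
    then show ?thesis by simp
  qed
  have \<kappa>_le: "\<kappa> m \<le> K" if "m \<in> M" for m
  proof -
    have m: "m \<in> {1..Z}" using that M by auto
    have "T (\<kappa> m) < (1 + \<delta>) * real Z"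
      using \<kappa>_lt[OF that] m \<delta> by (smt (verit) atLeastAtMost_iff mult_left_mono of_nat_mono)
    then have "(1 + \<delta>) ^ \<kappa> m \<le> (1 + \<delta>) * real Z"
      using pos \<delta> by (smt (verit) T_def mult_le_cancel_right1 of_nat_1 of_nat_le_iff One_nat_def Suc_leI zero_le_power)
    then have "ln ((1 + \<delta>) ^ \<kappa> m) \<le> ln ((1 + \<delta>) * real Z)"
      using \<delta> pos by (intro ln_mono) auto
    then have "real (\<kappa> m) * ln (1 + \<delta>) \<le> ln (1 + \<delta>) + ln (real Z)"
      using \<delta> pos by (simp add: ln_realpow ln_mult)
    then have "(real (\<kappa> m) - 1) * ln (1 + \<delta>) \<le> ln (real Z)" by (simp add: algebra_simps)
    moreover have "(real (\<kappa> m) - 1) * (\<delta> / 2) \<le> (real (\<kappa> m) - 1) * ln (1 + \<delta>)"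
      using \<kappa>_pos[OF that] by (intro mult_left_mono ln\<delta>) auto
    ultimately have "(real (\<kappa> m) - 1) * (\<delta> / 2) \<le> ln (real Z)" by linarith
    then have "real (\<kappa> m) \<le> 1 + 2 * ln (real Z) / \<delta>" using \<delta> by (simp add: field_simps)
    then show ?thesis unfolding K_def by (rule le_nat_floor)
  qed
  have K_le: "real K \<le> 2 * L / \<delta>"
  proof -
    have "real K \<le> 1 + 2 * ln (real Z) / \<delta>"
      using \<delta> ln_nat_nonneg[of Z] by (simp add: K_def of_nat_nat add_nonneg_nonneg)
    also have "\<dots> \<le> 2 / \<delta> + 2 * ln (real Z) / \<delta>" using \<delta> by (simp add: field_simps)
    also have "\<dots> = 2 * L / \<delta>" by (simp add: L_def add_divide_distrib distrib_left)
    finally show ?thesis .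
  qed
  define f where "f = (\<lambda>m d. \<alpha> m * \<beta> d * jac d m)"
  let ?lost = "\<lambda>m. {d. d \<in> D \<and> m * d \<le> Z \<and> U (\<kappa> m) < d}" and ?kept = "\<lambda>k. {d. d \<in> D \<and> d \<le> U k}"
  have f_le: "\<bar>f m d\<bar> \<le> 1" if "m \<in> M" for m d
    using \<alpha>[of m] \<beta>[of d] abs_jac_le_1[of m d] that M by (auto simp: f_def abs_mult intro!: mult_le_one)
  have U_iff: "d \<le> U k \<longleftrightarrow> real d * T k \<le> real Z" for d k
    using Tpos[of k] by (simp add: U_def le_nat_iff le_floor_iff pos_le_divide_eq)
  have fits: "m * d \<le> Z" if "m \<in> M" "d \<le> U (\<kappa> m)" for m d
  proof -
    have "real d * real m \<le> real d * T (\<kappa> m)" by (intro mult_left_mono \<kappa>_ge) auto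
    also have "\<dots> \<le> real Z" using that U_iff by blast
    finally show ?thesis by (simp add: mult.commute flip: of_nat_mult)
  qed
  have split: "(\<Sum>d | d \<in> D \<and> m * d \<le> Z. f m d) =
      (\<Sum>d\<in>?kept (\<kappa> m). f m d) + (\<Sum>d\<in>?lost m. f m d)"
    if "m \<in> M" for m
  proof -
    have "{d. d \<in> D \<and> m * d \<le> Z} = ?kept (\<kappa> m) \<union> ?lost m"
      using fits[OF that] by auto
    then show ?thesis using finD by (simp only:) (rule sum.union_disjoint, auto)
  qed
  have main: "\<bar>\<Sum>m | m \<in> M \<and> \<kappa> m = k. \<Sum>d\<in>?kept k. f m d\<bar>
      \<le> 4 * real Z * L ^ 2 * real V powr (-1/6)" for k
  \<comment> \<open>When neither factor of the rectangle is empty, both of its sides exceed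
    \<open>V\<close>, so the minimum in the rectangle bound may be replaced by
    \<open>V\<close>.\<close>
  proof (cases "{m. m \<in> M \<and> \<kappa> m = k} = {} \<or> ?kept k = {}")
    case True
    have "0 \<le> 4 * real Z * L ^ 2 * real V powr (-1/6)" by simp
    then show ?thesis using True by (elim disjE) (simp_all only: sum.empty sum.neutral_const abs_zero)
  next
    case False
    define T' where "T' = nat \<lfloor>T k\<rfloor>"
    have T': "real T' \<le> T k" using Tpos[of k] by (simp add: T'_def of_nat_nat)
    obtain m where m: "m \<in> M" "\<kappa> m = k" using False by blast
    have "m \<le> T'" using \<kappa>_ge[of m] m by (simp add: T'_def le_nat_floor)
    then have T'V: "V < T'" using m M by auto
    obtain d where d: "d \<in> D" "d \<le> U k" using False by blast
    then have UV: "V < U k" using D by auto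
    have "real (U k) * real T' \<le> real (U k) * T k" by (intro mult_left_mono T') auto
    also have "\<dots> \<le> real Z" using U_iff by blast
    finally have TU: "real T' * real (U k) \<le> real Z" by (simp add: mult.commute)
    then have TU': "T' * U k \<le> Z" by (simp flip: of_nat_mult)
    have "T' * 1 \<le> T' * U k" "1 * U k \<le> T' * U k" using T'V UV by (intro mult_le_mono; simp)+
    then have maxZ: "max T' (U k) \<le> Z" using TU' by (metis max.bounded_iff le_trans mult_1 mult_1_right)
    have "\<bar>\<Sum>m | m \<in> M \<and> \<kappa> m = k. \<Sum>d\<in>?kept k. f m d\<bar>
      \<le> 4 * real T' * real (U k) * (1 + ln (real (max T' (U k)))) ^ 2 * real (min T' (U k)) powr (-1/6)"
      unfolding f_def
    proof (rule jacobi_rectangle[OF _ _ _ _ \<alpha> \<beta>])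
      show "{m. m \<in> M \<and> \<kappa> m = k} \<subseteq> {m \<in> {1..T'}. odd m \<and> squarefree m}"
      proof safe
        fix x assume x: "x \<in> M" "k = \<kappa> x"
        then show "x \<in> {1..T'}" "squarefree x" "even x \<Longrightarrow> False"
          using \<kappa>_ge[of x] M by (auto simp: T'_def le_nat_floor)
      qed
      show "?kept k \<subseteq> {d \<in> {1..U k}. odd d \<and> squarefree d}" using D by auto
    qed (use T'V UV in auto)
    also have "\<dots> \<le> 4 * real Z * L ^ 2 * real V powr (-1/6)"
    proof (rule mult_mono[OF mult_mono[OF _ power_mono]])
      show "1 + ln (real (max T' (U k))) \<le> L"
        using maxZ T'V by (auto simp: L_def intro!: ln_mono)
      show "real (min T' (U k)) powr (-1/6) \<le> real V powr (-1/6)"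
        using pos T'V UV by (intro powr_mono2') auto
      show "4 * real T' * real (U k) \<le> 4 * real Z" using TU by simp
    qed (use ln_nat_nonneg[of "max T' (U k)"] in auto)
    finally show ?thesis .
  qed
  \<comment> \<open>The rounding term 1 is charged only for \<open>m * V \<le> Z\<close>, as no
    \<open>d > V\<close> fits otherwise. Its total is then at most \<open>Z / V\<close> instead of
    \<open>Z\<close>.\<close>
  have err: "\<bar>\<Sum>d\<in>?lost m. f m d\<bar>
      \<le> (if m * V \<le> Z then \<delta> * real Z * (1 / real m) + 1 else 0)" if "m \<in> M" for m
  proof (cases "m * V \<le> Z")
    case True
    have mpos: "real m > 0" using that M by auto
    let ?I = "{d::nat. real Z / ((1 + \<delta>) * real m) < real d \<and> real d \<le> real Z / real m}"
    have "\<bar>\<Sum>d\<in>?lost m. f m d\<bar>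
        \<le> (\<Sum>d\<in>?lost m. 1)"
      using f_le[OF that] by (intro order_trans[OF sum_abs] sum_mono)
    also have "\<dots> = real (card (?lost m))" by simp
    also have "\<dots> \<le> real (card ?I)"
    proof (intro of_nat_mono card_mono)
      show "finite ?I"
        by (rule finite_subset[of _ "{..nat \<lfloor>real Z / real m\<rfloor>}"]) (auto simp: le_nat_floor)
      show "?lost m
          \<subseteq> ?I"
      proof safe
        fix d assume d: "d \<in> D" "m * d \<le> Z" "U (\<kappa> m) < d"
        show "real d \<le> real Z / real m"
          using d(2) mpos by (simp add: pos_le_divide_eq mult.commute flip: of_nat_mult)
        have "real Z < real d * T (\<kappa> m)" using d(3) U_iff[of d "\<kappa> m"] by simp
        also have "\<dots> \<le> real d * ((1 + \<delta>) * real m)"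
          using \<kappa>_lt[OF that] by (intro mult_left_mono) auto
        finally show "real Z / ((1 + \<delta>) * real m) < real d"
          using mpos \<delta> by (simp add: pos_divide_less_eq)
      qed
    qed
    also have "\<dots> \<le> real Z / real m - real Z / ((1 + \<delta>) * real m) + 1"
    proof (intro card_nat_interval_le divide_left_mono)
      show "real m \<le> (1 + \<delta>) * real m"
        using mult_right_mono[of 1 "1 + \<delta>" "real m"] \<delta> by simp
    qed (use mpos \<delta> in auto)
    also have "\<dots> \<le> \<delta> * real Z * (1 / real m) + 1"
    proof -
      define a where "a = real Z / real m"
      have "a * ((1 - \<delta>) * (1 + \<delta>)) \<le> a * 1"
        using \<delta> by (intro mult_left_mono) (auto simp: algebra_simps a_def)
      then have "a * (1 - \<delta>) \<le> a / (1 + \<delta>)"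
        using \<delta> by (subst pos_le_divide_eq) (auto simp: mult.assoc)
      then have "a - a / (1 + \<delta>) + 1 \<le> \<delta> * a + 1" by (simp add: algebra_simps)
      moreover have "real Z / ((1 + \<delta>) * real m) = a / (1 + \<delta>)" by (simp add: a_def mult.commute)
      moreover have "\<delta> * real Z * (1 / real m) = \<delta> * a" by (simp add: a_def)
      ultimately show ?thesis unfolding a_def[symmetric] by linarith
    qed
    finally show ?thesis using True by simp
  next
    case False
    have eq: "?lost m = {}"
    proof -
      have "\<not> m * d \<le> Z" if "d \<in> D" for d
      proof -
        have "m * V \<le> m * d" using that D by (intro mult_le_mono) auto
        then show ?thesis using False by linarith
      qed
      then show ?thesis by blast
    qed
    show ?thesis unfolding eq using False by simp
  qed
  have "(\<Sum>m\<in>M. \<Sum>d | d \<in> D \<and> m * d \<le> Z. f m d) =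
      (\<Sum>m\<in>M. \<Sum>d\<in>?kept (\<kappa> m). f m d) +
      (\<Sum>m\<in>M. \<Sum>d\<in>?lost m. f m d)"
    using split by (simp add: sum.distrib)
  also have "(\<Sum>m\<in>M. \<Sum>d\<in>?kept (\<kappa> m). f m d) =
      (\<Sum>k\<in>{1..K}. \<Sum>m | m \<in> M \<and> \<kappa> m = k. \<Sum>d\<in>?kept (\<kappa> m). f m d)"
    by (rule sum.group[symmetric]) (use finM \<kappa>_le \<kappa>_pos in auto)
  also have "\<dots> = (\<Sum>k\<in>{1..K}. \<Sum>m | m \<in> M \<and> \<kappa> m = k. \<Sum>d\<in>?kept k. f m d)"
    by (intro sum.cong refl) auto
  finally have "\<bar>\<Sum>m\<in>M. \<Sum>d | d \<in> D \<and> m * d \<le> Z. f m d\<bar> \<le>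
      \<bar>\<Sum>k\<in>{1..K}. \<Sum>m | m \<in> M \<and> \<kappa> m = k. \<Sum>d\<in>?kept k. f m d\<bar> +
      \<bar>\<Sum>m\<in>M. \<Sum>d\<in>?lost m. f m d\<bar>" by (simp add: abs_triangle_ineq)
  also have "\<bar>\<Sum>k\<in>{1..K}. \<Sum>m | m \<in> M \<and> \<kappa> m = k. \<Sum>d\<in>?kept k. f m d\<bar>
      \<le> (\<Sum>k\<in>{1..K}. 4 * real Z * L ^ 2 * real V powr (-1/6))"
    by (intro order_trans[OF sum_abs] sum_mono main)
  also have "\<dots> = real K * (4 * real Z * L ^ 2 * real V powr (-1/6))" by simp
  also have "\<dots> \<le> 2 * L / \<delta> * (4 * real Z * L ^ 2 * real V powr (-1/6))"
    by (intro mult_right_mono K_le) auto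
  also have "\<dots> = 8 * real Z * L ^ 3 * \<delta>"
  proof -
    have "real V powr (-1/6) = \<delta> * \<delta>" by (simp add: \<delta>_def flip: powr_add)
    then show ?thesis using \<delta> by (simp add: eval_nat_numeral)
  qed
  also have "\<bar>\<Sum>m\<in>M. \<Sum>d\<in>?lost m. f m d\<bar> \<le> real Z * L * \<delta> + real Z * \<delta>"
  proof -
    have "\<bar>\<Sum>m\<in>M. \<Sum>d\<in>?lost m. f m d\<bar>
        \<le> (\<Sum>m\<in>M. if m * V \<le> Z then \<delta> * real Z * (1 / real m) + 1 else 0)"
      by (intro order_trans[OF sum_abs] sum_mono err)
    also have "\<dots> \<le> (\<Sum>m\<in>{1..Z}. if m * V \<le> Z then \<delta> * real Z * (1 / real m) + 1 else 0)"
      using M \<delta> by (intro sum_mono2) auto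
    also have "\<dots> \<le> (\<Sum>m\<in>{1..Z}. \<delta> * real Z * (1 / real m) + (if m * V \<le> Z then 1 else 0))"
      using \<delta> by (intro sum_mono) auto
    also have "\<dots> = \<delta> * real Z * (\<Sum>m\<in>{1..Z}. 1 / real m) + real (card {m \<in> {1..Z}. m * V \<le> Z})"
      by (simp add: sum.distrib sum_distrib_left sum.If_cases Int_def)
    also have "\<dots> \<le> \<delta> * real Z * L + real Z * \<delta>"
    proof (intro add_mono mult_left_mono)
      show "(\<Sum>m\<in>{1..Z}. 1 / real m) \<le> L" unfolding L_def using pos by (intro sum_inverse_le_ln)
      have "card {m \<in> {1..Z}. m * V \<le> Z} \<le> card {1..Z div V}"
        using pos by (intro card_mono) (auto simp: less_eq_div_iff_mult_less_eq)
      then have "real (card {m \<in> {1..Z}. m * V \<le> Z}) \<le> real (Z div V)" by simp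
      also have "\<dots> \<le> real Z / real V" by (rule of_nat_div_le_of_nat)
      also have "\<dots> = real Z * real V powr (-1)" using pos by (simp add: powr_minus field_simps)
      also have "\<dots> \<le> real Z * \<delta>"
        unfolding \<delta>_def using pos by (intro mult_left_mono powr_mono) auto
      finally show "real (card {m \<in> {1..Z}. m * V \<le> Z}) \<le> real Z * \<delta>" .
    qed (use \<delta> in auto)
    finally show ?thesis by (simp add: mult_ac)
  qed
  also have "8 * real Z * L ^ 3 * \<delta> + (real Z * L * \<delta> + real Z * \<delta>) \<le> 10 * real Z * L ^ 3 * \<delta>"
  proof -
    have "L ^ 1 \<le> L ^ 3" using L1 by (intro power_increasing) auto
    moreover have "1 \<le> L ^ 3" using L1 by (rule one_le_power)
    ultimately have "(real Z * \<delta>) * (L + 1) \<le> (real Z * \<delta>) * (2 * L ^ 3)"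
      using \<delta> by (intro mult_left_mono) auto
    then show ?thesis by (simp add: algebra_simps)
  qed
  finally show ?thesis by (simp add: f_def L_def \<delta>_def)
qed

section \<open>Counting pairs subject to mutual residue conditions\<close>

lemma squarefree_mult_iff:
  fixes a b :: nat
  shows "squarefree (a * b) \<longleftrightarrow> squarefree a \<and> squarefree b \<and> coprime a b"
proof safe
  assume sq: "squarefree (a * b)"
  then show "squarefree a" "squarefree b" by (auto dest: squarefree_multD)
  show "coprime a b"
  proof (rule coprimeI)
    fix c assume "c dvd a" "c dvd b"
    then have "c\<^sup>2 dvd a * b" by (simp add: power2_eq_square mult_dvd_mono)
    then show "is_unit c" using sq squarefreeD by blast
  qed
qed (rule squarefree_mult_coprime)

lemma jacobi_mult_coprime: "coprime x y \<Longrightarrow> jacobi b (x * y) = jacobi b x * jacobi b y"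
  by (cases "x = 0 \<or> y = 0") (auto simp: jacobi_mult_right)

lemma jacobi_eq_1:
  assumes "odd m" "\<And>p. prime p \<Longrightarrow> p dvd m \<Longrightarrow> Legendre b (int p) = 1"
  shows "jacobi b m = 1"
  using assms by (induction m rule: odd_prime_induct) (auto simp: jacobi_prime_mult)

text \<open>The sum is the product of \<open>1 + Legendre b p\<close> over the primes of
  \<open>m\<close>; coprimality excludes the value 0, so each factor is 2 or 0. Divided by
  \<open>tau m\<close>, this is the indicator of the residue condition.\<close>

lemma sum_jacobi_divisors:
  assumes "odd m" "squarefree m" "coprime b (int m)"
  shows "(\<Sum>e | e dvd m. jacobi b e) =
    (if \<forall>p. prime p \<and> p dvd m \<longrightarrow> Legendre b (int p) = 1 then int (tau m) else 0)"
proof (cases "\<forall>p. prime p \<and> p dvd m \<longrightarrow> Legendre b (int p) = 1")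
  case True
  have "(\<Sum>e | e dvd m. jacobi b e) = (\<Sum>e | e dvd m. 1)"
  proof (intro sum.cong refl)
    fix e assume e: "e \<in> {e. e dvd m}"
    then have "odd e" using assms(1) by (auto intro: dvd_trans)
    then show "jacobi b e = 1" using True e by (intro jacobi_eq_1) (auto intro: dvd_trans)
  qed
  then show ?thesis unfolding if_P[OF True] by (simp add: tau_def)
next
  case False
  then obtain p where p: "prime p" "p dvd m" "Legendre b (int p) \<noteq> 1" by blast
  have "coprime b (int p)"
    using assms(3) p(2) by (meson coprime_divisors dvd_refl of_nat_dvd_iff)
  then have "Legendre b (int p) \<noteq> 0"
    using p(1) prime_gt_1_nat[OF p(1)] coprime_common_divisor[of b "int p" "int p"]
    by (auto simp: Legendre_def cong_0_iff)
  then have leg: "Legendre b (int p) = -1" using p(3) Legendre_values[of b p] by auto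
  obtain k where k: "m = p * k" using p(2) by blast
  have "k > 0" using k assms(1) by (auto intro: Nat.gr0I)
  have "coprime p k" using assms(2) k squarefree_mult_iff by blast
  then have "(\<Sum>e | e dvd m. jacobi b e) = (\<Sum>e | e dvd p. jacobi b e) * (\<Sum>e | e dvd k. jacobi b e)"
    unfolding k using \<open>k > 0\<close> prime_gt_0_nat[OF p(1)]
    by (intro sum_divisors_coprime jacobi_mult_coprime) auto
  also have "{e. e dvd p} = {1, p}" using p(1) by (auto simp: prime_nat_iff)
  then have "(\<Sum>e | e dvd p. jacobi b e) = 0"
    using prime_gt_1_nat[OF p(1)] leg by (simp add: jacobi_prime[OF p(1)])
  finally show ?thesis unfolding if_not_P[OF False] by simp
qed

text \<open>The condition that \<open>m\<close> and \<open>d\<close> be coprime, which would couple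
  the variables, costs nothing: the symbol vanishes when it fails.\<close>

lemma bilinear_coprime_bound:
  fixes \<alpha> \<beta> :: "nat \<Rightarrow> real" and V Z :: nat
  assumes A: "\<And>m. m \<in> A \<Longrightarrow> V < m \<and> odd m \<and> squarefree m"
    and B: "\<And>d. d \<in> B \<Longrightarrow> V < d \<and> odd d \<and> squarefree d"
    and "0 < V"
    and \<alpha>: "\<And>m. \<bar>\<alpha> m\<bar> \<le> 1" and \<beta>: "\<And>d. \<bar>\<beta> d\<bar> \<le> 1"
  shows "\<bar>\<Sum>(m, d) | m \<in> A \<and> d \<in> B \<and> coprime m d \<and> m * d \<le> Z. \<alpha> m * \<beta> d * jac d m\<bar>
    \<le> 10 * real Z * (1 + ln (real Z)) ^ 3 * real V powr (-1/12)"
proof (cases "Z = 0")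
  case True
  have eq: "{(m, d). m \<in> A \<and> d \<in> B \<and> coprime m d \<and> m * d \<le> Z} = {}"
    using A B True by fastforce
  show ?thesis unfolding eq using True by simp
next
  case False
  define M where "M = A \<inter> {1..Z}"
  define D where "D = B \<inter> {1..Z}"
  have fin: "finite M" "finite D" by (simp_all add: M_def D_def)
  have "(\<Sum>(m, d) | m \<in> A \<and> d \<in> B \<and> coprime m d \<and> m * d \<le> Z. \<alpha> m * \<beta> d * jac d m)
      = (\<Sum>(m, d)\<in>(SIGMA m:M. {d. d \<in> D \<and> m * d \<le> Z}). \<alpha> m * \<beta> d * jac d m)"
  proof (rule sum.mono_neutral_left)
    show "finite (SIGMA m:M. {d. d \<in> D \<and> m * d \<le> Z})" using fin by auto
    show "{(m, d). m \<in> A \<and> d \<in> B \<and> coprime m d \<and> m * d \<le> Z} \<subseteq> (SIGMA m:M. {d. d \<in> D \<and> m * d \<le> Z})"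
    proof
      fix x assume "x \<in> {(m, d). m \<in> A \<and> d \<in> B \<and> coprime m d \<and> m * d \<le> Z}"
      then obtain m d where x: "x = (m, d)" and md: "m \<in> A" "d \<in> B" "m * d \<le> Z" by auto
      then have "m > 0" "d > 0" using A[of m] B[of d] by auto
      then have "m * 1 \<le> m * d" "1 * d \<le> m * d" by (intro mult_le_mono; simp)+
      then have "m \<le> Z" "d \<le> Z" using md(3) by linarith+
      then show "x \<in> (SIGMA m:M. {d. d \<in> D \<and> m * d \<le> Z})" unfolding x
        using md \<open>m > 0\<close> \<open>d > 0\<close> by (auto simp: M_def D_def)
    qed
    show "\<forall>x\<in>(SIGMA m:M. {d. d \<in> D \<and> m * d \<le> Z})
        - {(m, d). m \<in> A \<and> d \<in> B \<and> coprime m d \<and> m * d \<le> Z}.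
        (case x of (m, d) \<Rightarrow> \<alpha> m * \<beta> d * jac d m) = 0"
      using A jacobi_eq_0_iff by (auto simp: M_def D_def coprime_commute)
  qed
  also have "\<dots> = (\<Sum>m\<in>M. \<Sum>d | d \<in> D \<and> m * d \<le> Z. \<alpha> m * \<beta> d * jac d m)"
    using fin by (intro sum.Sigma[symmetric]) auto
  also have "\<bar>\<dots>\<bar> \<le> 10 * real Z * (1 + ln (real Z)) ^ 3 * real V powr (-1/12)"
    using A B False assms(3) by (intro jacobi_hyperbola \<alpha> \<beta>) (auto simp: M_def D_def)
  finally show ?thesis .
qed

text \<open>The summand is multiplicative with value 1 or 1/2 at a prime $p$ according to $\chi(p)$,
  so its mean is of order at most $(\ln Y)^{-1/4}$.\<close>
lemma (in real_character) sum_split_weight_le: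
  assumes "Y \<ge> 2"
  defines "S \<equiv> {n. \<forall>p. prime p \<and> p dvd n \<longrightarrow> \<chi> p = 1}"
  shows "(\<Sum>n | n \<in> {1..Y} \<and> squarefree n. real (card {b. b dvd n \<and> b \<in> S}) / real (tau n))
    \<le> 10 * real Y / ln (real Y) * (sqrt (1 + 2 * ln (real Y)) *
        sqrt (sqrt ((1 + 4 * ln (real Y)) * (3 + ln (real q)))))"
proof -
  define f where "f = (\<lambda>n. if squarefree n then real (card {b. b dvd n \<and> b \<in> S}) / real (tau n) else 0)"
  have S_mult: "a * b \<in> S" if "a \<in> S" "b \<in> S" for a b
    using that by (auto simp: S_def prime_dvd_mult_iff)
  have card_le: "card {b. b dvd n \<and> b \<in> S} \<le> tau n" if "n > 0" for n
    unfolding tau_def using that by (intro card_mono) auto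
  have "(\<Sum>n | n \<in> {1..Y} \<and> squarefree n. real (card {b. b dvd n \<and> b \<in> S}) / real (tau n))
      = (\<Sum>n\<in>{1..Y}. f n)"
    by (simp add: f_def sum.If_cases Int_def)
  also have "\<dots> \<le> 10 * real Y / ln (real Y) * (\<Sum>n\<in>{1..Y}. f n / real n)"
  proof (rule sum_monotone_le[OF _ _ _ _ _ assms(1)])
    show "0 \<le> f m" for m by (simp add: f_def)
    show "f m \<le> 1" for m
    proof (cases "squarefree m")
      case True
      then have "m > 0" by (intro Nat.gr0I notI) simp
      then show ?thesis using card_le[of m] tau_pos[of m] by (simp add: f_def)
    qed (simp add: f_def)
    have "{b. b dvd 1 \<and> b \<in> S} = {1}" by (auto simp: S_def)
    then show "f 1 = 1" by (simp add: f_def tau_def)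
    show "squarefree m" if "f m \<noteq> 0" for m using that by (simp add: f_def split: if_splits)
    show "f (p * k) \<le> f k" if p: "prime p" for p k
    proof (cases "squarefree (p * k)")
      case True
      then have sq: "squarefree k" "coprime p k" by (auto simp: squarefree_mult_iff)
      have k0: "k > 0" using sq(1) by (intro Nat.gr0I notI) simp
      \<comment> \<open>A new prime doubles \<open>tau\<close> and at most doubles the number of
        divisors in \<open>S\<close>, so the ratio cannot grow.\<close>
      have "{b. b dvd p * k \<and> b \<in> S} \<subseteq> {b. b dvd k \<and> b \<in> S} \<union> (\<lambda>b. p * b) ` {b. b dvd k \<and> b \<in> S}"
      proof
        fix b assume b: "b \<in> {b. b dvd p * k \<and> b \<in> S}"
        show "b \<in> {b. b dvd k \<and> b \<in> S} \<union> (\<lambda>b. p * b) ` {b. b dvd k \<and> b \<in> S}"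
        proof (cases "p dvd b")
          case True
          then obtain c where c: "b = p * c" by blast
          have "c dvd k" using b c prime_gt_0_nat[OF p] by auto
          moreover have "c \<in> S" using b c by (auto simp: S_def)
          ultimately show ?thesis using c by blast
        next
          case False
          then have "coprime b p" using p prime_imp_coprime[of p b] by (simp add: coprime_commute)
          then show ?thesis using b by (auto simp: coprime_dvd_mult_right_iff)
        qed
      qed
      then have "card {b. b dvd p * k \<and> b \<in> S} \<le>
          card ({b. b dvd k \<and> b \<in> S} \<union> (\<lambda>b. p * b) ` {b. b dvd k \<and> b \<in> S})"
        using k0 by (intro card_mono) auto
      also have "\<dots> \<le> card {b. b dvd k \<and> b \<in> S} + card ((\<lambda>b. p * b) ` {b. b dvd k \<and> b \<in> S})"
        by (rule card_Un_le)
      also have "\<dots> \<le> 2 * card {b. b dvd k \<and> b \<in> S}"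
        using k0 card_image_le[of "{b. b dvd k \<and> b \<in> S}" "\<lambda>b. p * b"] by simp
      finally have c: "card {b. b dvd p * k \<and> b \<in> S} \<le> 2 * card {b. b dvd k \<and> b \<in> S}" .
      have "{e. e dvd p} = {1, p}" using p by (auto simp: prime_nat_iff)
      then have "tau p = 2" using prime_gt_1_nat[OF p] by (simp add: tau_def)
      then have t: "tau (p * k) = 2 * tau k"
        using tau_coprime[OF sq(2)] k0 prime_gt_0_nat[OF p] by simp
      have "real (card {b. b dvd p * k \<and> b \<in> S}) / real (tau (p * k))
          \<le> real (2 * card {b. b dvd k \<and> b \<in> S}) / real (2 * tau k)"
        unfolding t using c by (intro divide_right_mono) (simp_all only: of_nat_le_iff of_nat_0_le_iff)
      then show ?thesis using True sq by (simp add: f_def)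
    qed (simp add: f_def)
  qed
  also have "\<dots> \<le> 10 * real Y / ln (real Y) * (sqrt (1 + 2 * ln (real Y)) *
        sqrt (sqrt ((1 + 4 * ln (real Y)) * (3 + ln (real q)))))"
  proof (rule mult_left_mono)
    \<comment> \<open>On squarefree numbers the weight is the convolution of \<open>1 / tau\<close>
      restricted to \<open>S\<close> with \<open>1 / tau\<close>. The two logarithmic sums are of
      orders \<open>(ln Y) powr (1/4)\<close> and \<open>(ln Y) powr (1/2)\<close>; division by
      \<open>ln Y\<close> leaves the exponent -1/4.\<close>
    let ?F = "\<lambda>b k. (if b \<in> S then 1 / (real (tau b) * real b) else 0) * (1 / (real (tau k) * real k))"
    have "(\<Sum>n\<in>{1..Y}. f n / real n) \<le> (\<Sum>n\<in>{1..Y}. \<Sum>b | b dvd n. ?F b (n div b))"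
    proof (rule sum_mono)
      fix n assume n: "n \<in> {1..Y}"
      show "f n / real n \<le> (\<Sum>b | b dvd n. ?F b (n div b))"
      proof (cases "squarefree n")
        case True
        have "f n / real n = (\<Sum>b | b dvd n. if b \<in> S then 1 / (real (tau n) * real n) else 0)"
          using True n by (simp add: f_def sum.If_cases Int_def mult.commute)
        also have "\<dots> = (\<Sum>b | b dvd n. ?F b (n div b))"
        proof (intro sum.cong refl)
          fix b assume "b \<in> {b. b dvd n}"
          then obtain k where k: "n = b * k" by auto
          have "b > 0" "k > 0" using k n by (auto intro: Nat.gr0I)
          moreover have "coprime b k" using True k squarefree_mult_iff by blast
          ultimately have "tau n = tau b * tau k" unfolding k by (intro tau_coprime)
          then show "(if b \<in> S then 1 / (real (tau n) * real n) else 0) = ?F b (n div b)"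
            using k \<open>b > 0\<close> by (simp add: mult_ac)
        qed
        finally show ?thesis by simp
      next
        case False
        then show ?thesis by (auto simp: f_def intro!: sum_nonneg)
      qed
    qed
    also have "\<dots> = (\<Sum>k\<in>{1..Y}. \<Sum>b\<in>{1..Y div k}. ?F b k)" by (rule sum_divisors_swap)
    also have "\<dots> \<le> (\<Sum>k\<in>{1..Y}. \<Sum>b\<in>{1..Y}. ?F b k)"
      by (intro sum_mono sum_mono2) (auto intro: order_trans[OF _ div_le_dividend])
    also have "\<dots> = (\<Sum>b\<in>{1..Y}. if b \<in> S then 1 / (real (tau b) * real b) else 0)
        * (\<Sum>k\<in>{1..Y}. 1 / (real (tau k) * real k))"
      unfolding sum_product by (rule sum.swap)
    also have "(\<Sum>b\<in>{1..Y}. if b \<in> S then 1 / (real (tau b) * real b) else 0)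
        = (\<Sum>b\<in>{1..Y} \<inter> S. 1 / (real (tau b) * real b))"
      by (simp add: sum.If_cases)
    also have "(\<Sum>b\<in>{1..Y} \<inter> S. 1 / (real (tau b) * real b)) * (\<Sum>k\<in>{1..Y}. 1 / (real (tau k) * real k))
        \<le> sqrt (sqrt ((1 + 4 * ln (real Y)) * (3 + ln (real q)))) * sqrt (1 + 2 * ln (real Y))"
    proof (rule mult_mono[OF real_le_rsqrt real_le_rsqrt])
      have "(\<Sum>b\<in>{1..Y} \<inter> S. 1 / (real (tau b) * real b))\<^sup>2 \<le> (\<Sum>k\<in>{1..Y\<^sup>2} \<inter> S. 1 / real k)"
        by (rule sum_inverse_tau_le[OF S_mult])
      also have "{1..Y\<^sup>2} \<inter> S = {m. m \<in> {1..Y\<^sup>2} \<and> (\<forall>p. prime p \<and> p dvd m \<longrightarrow> \<chi> p = 1)}"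
        by (auto simp: S_def)
      also have "(\<Sum>k\<in>\<dots>. 1 / real k) \<le> sqrt ((1 + 2 * ln (real (Y\<^sup>2))) * (3 + ln (real q)))"
        by (intro real_le_rsqrt sum_split_inverse_le)
      also have "2 * ln (real (Y\<^sup>2)) = 4 * ln (real Y)"
        using assms(1) by (simp add: ln_realpow)
      finally show "(\<Sum>b\<in>{1..Y} \<inter> S. 1 / (real (tau b) * real b))\<^sup>2
          \<le> sqrt ((1 + 4 * ln (real Y)) * (3 + ln (real q)))" .
      have "(\<Sum>k\<in>{1..Y}. 1 / (real (tau k) * real k))\<^sup>2 \<le> (\<Sum>k\<in>{1..Y\<^sup>2}. 1 / real k)"
        using sum_inverse_tau_le[of UNIV Y] by simp
      also have "\<dots> \<le> 1 + ln (real (Y\<^sup>2))" using assms(1) by (intro sum_inverse_le_ln) auto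
      also have "ln (real (Y\<^sup>2)) = 2 * ln (real Y)"
        using assms(1) by (simp add: ln_realpow)
      finally show "(\<Sum>k\<in>{1..Y}. 1 / (real (tau k) * real k))\<^sup>2 \<le> 1 + 2 * ln (real Y)" .
    qed (auto intro!: sum_nonneg mult_nonneg_nonneg add_nonneg_nonneg simp: ln_nat_nonneg)
    finally show "(\<Sum>n\<in>{1..Y}. f n / real n) \<le> sqrt (1 + 2 * ln (real Y)) *
        sqrt (sqrt ((1 + 4 * ln (real Y)) * (3 + ln (real q))))" by (simp add: mult.commute)
  qed (use assms(1) in auto)
  finally show ?thesis .
qed

section \<open>Admissible pairs with one small coordinate\<close>

text \<open>Since \<open>d\<close> is at most half the square root of \<open>N\<close>, the quotient
  \<open>N / d\<close> is at least twice that root, and rounding down leaves at least the root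
  itself. Replacing \<open>ln (N div d)\<close> by \<open>ln N\<close> therefore costs only a factor
  2; the 4 in the hypothesis pays for the rounding.\<close>

lemma div_large:
  fixes N W d :: nat
  assumes "4 * W\<^sup>2 \<le> N" "1 \<le> d" "d \<le> W"
  shows "2 \<le> N div d" "ln (real N) / 2 \<le> ln (real (N div d))" "real (N div d) \<le> real N / real d"
    "N div d \<le> N"
proof -
  define s where "s = sqrt (real N)"
  have W: "1 \<le> real W" "real d \<le> real W" "0 < real d" using assms by auto
  have "real (4 * W\<^sup>2) \<le> real N" using assms(1) by (simp only: of_nat_le_iff)
  then have "(2 * real W)\<^sup>2 \<le> real N" by (simp add: power_mult_distrib)
  then have s: "2 * real W \<le> s" unfolding s_def by (rule real_le_rsqrt)
  have ss: "real N = s * s" by (simp add: s_def)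
  have "real d * (2 * s) \<le> s * s" using mult_right_mono[of "2 * real d" s s] s W by (simp add: mult_ac)
  then have "2 * s \<le> real N / real d" using W ss by (simp add: field_simps)
  also have "\<dots> < real (N div d) + 1"
  proof -
    have "N < (N div d + 1) * d" using dividend_less_div_times[of d N] assms(2) by simp
    then have "real N < real ((N div d + 1) * d)" by (simp only: of_nat_less_iff)
    then show ?thesis using W by (simp add: pos_divide_less_eq algebra_simps)
  qed
  finally have ge: "s \<le> real (N div d)" using s W by linarith
  then show "2 \<le> N div d" using s W by linarith
  have "ln s \<le> ln (real (N div d))" using ge s W by (intro ln_mono) auto
  moreover have "ln (real N) = ln s + ln s" unfolding ss using s W by (simp add: ln_mult)
  ultimately show "ln (real N) / 2 \<le> ln (real (N div d))" by simp
  show "real (N div d) \<le> real N / real d" by (rule of_nat_div_le_of_nat)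
qed (rule div_le_dividend)

lemma (in real_character) card_split_div_le:
  fixes N W d :: nat
  assumes N: "4 * W\<^sup>2 \<le> N" "1 \<le> d" "d \<le> W" and q: "q \<le> 8 * W"
  shows "real (card {m \<in> {1..N div d}. squarefree m \<and> (\<forall>p. prime p \<and> p dvd m \<longrightarrow> \<chi> p = 1)})
    \<le> 20 * real N / ln (real N) * sqrt ((1 + 2 * ln (real N)) * (3 + ln (8 * real W))) * (1 / real d)"
proof -
  note Y = div_large[OF N]
  let ?Y = "N div d"
  have N2: "2 \<le> N" using Y(1,4) by linarith
  then have lnN: "ln (real N) > 0" by simp
  have lnYN: "ln (real ?Y) \<le> ln (real N)"
    using Y(1,4) by (intro ln_mono) auto
  have lnq: "ln (real q) \<le> ln (8 * real W)"
    using q modulus_pos by (intro ln_mono) auto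
  have "real (card {m \<in> {1..?Y}. squarefree m \<and> (\<forall>p. prime p \<and> p dvd m \<longrightarrow> \<chi> p = 1)})
      \<le> 10 * real ?Y / ln (real ?Y) * sqrt ((1 + 2 * ln (real ?Y)) * (3 + ln (real q)))"
    by (rule card_split_le[OF Y(1)])
  also have "\<dots> \<le> (10 * (real N / real d) / (ln (real N) / 2))
      * sqrt ((1 + 2 * ln (real N)) * (3 + ln (8 * real W)))"
    using Y lnN lnYN lnq modulus_pos ln_nat_nonneg[of ?Y]
    by (intro mult_mono frac_le real_sqrt_le_mono) (auto intro!: add_nonneg_nonneg simp: Suc_le_eq)
  finally show ?thesis by (simp add: mult_ac)
qed

text \<open>The integers composed of primes that split in the field generated by the square root of
  2, that is, primes congruent to 1 or 7 modulo 8. Members are odd, because the symbol at 2 is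
  0.\<close>

definition split_set :: "nat set" where
  "split_set = {n. \<forall>p. prime p \<and> p dvd n \<longrightarrow> Legendre 2 (int p) = 1}"

text \<open>The pairs with $a = \eta d$ and $n = 2^k d m$ satisfying the solubility conditions at the odd
  primes dividing $n$.\<close>
definition admissible :: "int \<Rightarrow> int \<Rightarrow> nat \<Rightarrow> (nat \<times> nat) set" where
  "admissible \<eta> \<epsilon> N = {(d, m). odd d \<and> odd m \<and> squarefree (d * m) \<and> d * m \<le> N \<and> \<eta> * int d \<noteq> 1 \<and>
     (\<forall>p. prime p \<and> p dvd m \<longrightarrow> Legendre (\<eta> * int d) (int p) = 1) \<and>
     d \<in> split_set \<and> (\<forall>p. prime p \<and> p dvd d \<longrightarrow> Legendre (\<epsilon> * int m) (int p) = 1)}"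

lemma admissible_subset: "admissible \<eta> \<epsilon> N \<subseteq> {1..N} \<times> {1..N}"
proof
  fix x assume "x \<in> admissible \<eta> \<epsilon> N"
  then obtain d m where x: "x = (d, m)" "(d, m) \<in> admissible \<eta> \<epsilon> N" by (cases x) auto
  then have dm: "odd d" "odd m" "d * m \<le> N" by (auto simp: admissible_def)
  then have "d > 0" "m > 0" by (auto intro!: Nat.gr0I)
  then have "d * 1 \<le> d * m" "1 * m \<le> d * m" by (intro mult_le_mono; simp)+
  then have "d \<le> N" "m \<le> N" using dm(3) by linarith+
  then show "x \<in> {1..N} \<times> {1..N}" using \<open>d > 0\<close> \<open>m > 0\<close> by (simp add: x)
qed

lemma finite_admissible: "finite (admissible \<eta> \<epsilon> N)"
  by (rule finite_subset[OF admissible_subset]) simp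

lemma real_character_two: "real_character 8 (\<lambda>x. if even x then 0 else jacobi 2 x)"
proof -
  have "real_character (8 * 1) (\<lambda>x. if even x then 0 else jacobi (2 * int 1) x)"
    by (rule real_character_jacobi_upper) auto
  then show ?thesis by (simp only: of_nat_1 mult_1_right)
qed

lemma split_set_character:
  "odd d \<Longrightarrow> d \<in> split_set \<Longrightarrow> prime p \<and> p dvd d \<Longrightarrow> (if even p then 0 else jacobi 2 p) = 1"
  using dvd_trans[of 2 p d] by (auto simp: split_set_def jacobi_prime)

lemma card_fibres:
  fixes S :: "(nat \<times> nat) set"
  assumes "finite S" "\<And>x y. (x, y) \<in> S \<Longrightarrow> 1 \<le> x"
  shows "card {(x, y) \<in> S. x \<le> W} = (\<Sum>x\<in>{1..W}. card {y. (x, y) \<in> S})"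
proof -
  have fin: "finite {y. (x, y) \<in> S}" for x
    by (rule finite_subset[of _ "snd ` S"]) (use assms(1) in force)+
  have "{(x, y) \<in> S. x \<le> W} = (SIGMA x:{1..W}. {y. (x, y) \<in> S})" using assms(2) by force
  then show ?thesis using fin by (simp only:) (rule card_SigmaI, auto)
qed

text \<open>The bound of \<open>card_split_div_le\<close> summed over \<open>d \<le> W\<close>,
  whose harmonic sum is the last factor. Its order is
  \<open>N * (ln W) powr (3/2) / sqrt (ln N)\<close>, negligible against \<open>N\<close> when
  \<open>W\<close> is a power of \<open>ln N\<close>.\<close>

definition small_bound :: "nat \<Rightarrow> nat \<Rightarrow> real" where
  "small_bound N W = 20 * real N / ln (real N) * sqrt ((1 + 2 * ln (real N)) * (3 + ln (8 * real W)))
     * (1 + ln (real W))"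

text \<open>For a fixed small \<open>x\<close>, the other coordinate is squarefree and composed of
  primes at which one character equals 1. A character is demanded only for \<open>x\<close> that
  occur in \<open>S\<close>, because membership supplies what makes it nontrivial.\<close>

lemma card_pairs_split_le:
  fixes S :: "(nat \<times> nat) set"
  assumes N: "4 * W\<^sup>2 \<le> N" "1 \<le> W" and fin: "finite S"
    and S: "\<And>x y. (x, y) \<in> S \<Longrightarrow> 1 \<le> x \<and> 1 \<le> y \<and> x * y \<le> N \<and> squarefree y"
    and char: "\<And>x. 1 \<le> x \<Longrightarrow> x \<le> W \<Longrightarrow> x \<in> fst ` S \<Longrightarrow> \<exists>q \<chi>. real_character q \<chi> \<and> q \<le> 8 * W \<and>
      (\<forall>y p. (x, y) \<in> S \<and> prime p \<and> p dvd y \<longrightarrow> \<chi> p = 1)"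
  shows "real (card {(x, y) \<in> S. x \<le> W}) \<le> small_bound N W"
proof -
  let ?C = "20 * real N / ln (real N) * sqrt ((1 + 2 * ln (real N)) * (3 + ln (8 * real W)))"
  have C: "0 \<le> ?C"
    using N(2) ln_nat_nonneg[of N]
    by (intro mult_nonneg_nonneg divide_nonneg_nonneg) (auto intro!: add_nonneg_nonneg)
  have "real (card {(x, y) \<in> S. x \<le> W}) = (\<Sum>x\<in>{1..W}. real (card {y. (x, y) \<in> S}))"
    using card_fibres[OF fin, of W] S by simp
  also have "\<dots> \<le> (\<Sum>x\<in>{1..W}. ?C * (1 / real x))"
  proof (rule sum_mono)
    fix x assume x: "x \<in> {1..W}"
    show "real (card {y. (x, y) \<in> S}) \<le> ?C * (1 / real x)"
    proof (cases "x \<in> fst ` S")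
      case True
      then obtain q \<chi> where *: "real_character q \<chi>" "q \<le> 8 * W"
        "\<And>y p. (x, y) \<in> S \<Longrightarrow> prime p \<and> p dvd y \<Longrightarrow> \<chi> p = 1"
        using char[of x] x by auto
      interpret real_character q \<chi> by (rule *(1))
      have "{y. (x, y) \<in> S} \<subseteq> {y \<in> {1..N div x}. squarefree y \<and> (\<forall>p. prime p \<and> p dvd y \<longrightarrow> \<chi> p = 1)}"
        using S[of x] *(3) x by (auto simp: less_eq_div_iff_mult_less_eq mult.commute)
      then have "card {y. (x, y) \<in> S}
          \<le> card {y \<in> {1..N div x}. squarefree y \<and> (\<forall>p. prime p \<and> p dvd y \<longrightarrow> \<chi> p = 1)}"
        by (intro card_mono) auto
      also have "real \<dots> \<le> ?C * (1 / real x)"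
        using x *(2) by (intro card_split_div_le N) auto
      finally show ?thesis by simp
    next
      case False
      then have eq: "{y. (x, y) \<in> S} = {}" by force
      show ?thesis unfolding eq using mult_nonneg_nonneg[OF C, of "1 / real x"] by simp
    qed
  qed
  also have "\<dots> = ?C * (\<Sum>x\<in>{1..W}. 1 / real x)" by (rule sum_distrib_left[symmetric])
  also have "\<dots> \<le> small_bound N W"
    unfolding small_bound_def using N(2) by (intro mult_left_mono C sum_inverse_le_ln) auto
  finally show ?thesis .
qed

text \<open>For fixed small \<open>d\<close> the symbol with upper entry \<open>\<eta> * d\<close>
  is a character of modulus \<open>8 * d\<close>. The case \<open>\<eta> * d = 1\<close>, in which
  it would be trivial, is the class \<open>a = 1\<close> that admissible pairs exclude.\<close>

lemma card_admissible_small_left: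
  assumes "4 * W\<^sup>2 \<le> N" "1 \<le> W" "\<eta> \<in> {1, -1, 2, -2}"
  shows "real (card {(d, m) \<in> admissible \<eta> \<epsilon> N. d \<le> W}) \<le> small_bound N W"
proof (rule card_pairs_split_le[OF assms(1,2) finite_admissible])
  fix d m assume "(d, m) \<in> admissible \<eta> \<epsilon> N"
  then show "1 \<le> d \<and> 1 \<le> m \<and> d * m \<le> N \<and> squarefree m"
    using admissible_subset[of \<eta> \<epsilon> N] by (auto simp: admissible_def squarefree_mult_iff)
next
  fix d assume d: "d \<le> W" "d \<in> fst ` admissible \<eta> \<epsilon> N"
  then have *: "squarefree d" "odd d" "\<eta> * int d \<noteq> 1"
    by (auto simp: admissible_def squarefree_mult_iff)
  have "(if even p then 0 else jacobi (\<eta> * int d) p) = 1"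
    if "(d, m) \<in> admissible \<eta> \<epsilon> N \<and> prime p \<and> p dvd m" for m p
    using that dvd_trans[of 2 p m] by (auto simp: admissible_def jacobi_prime)
  then show "\<exists>q \<chi>. real_character q \<chi> \<and> q \<le> 8 * W \<and>
      (\<forall>m p. (d, m) \<in> admissible \<eta> \<epsilon> N \<and> prime p \<and> p dvd m \<longrightarrow> \<chi> p = 1)"
    using real_character_jacobi_upper[OF *(1,2) assms(3) *(3)] d(1)
    by (intro exI conjI) (assumption, simp, blast)
qed

text \<open>For small \<open>m\<close> the saving comes from the residue condition on 2 modulo the
  primes of \<open>d\<close>, with one character of modulus 8 for all \<open>m\<close>. The symbol
  of \<open>\<epsilon> * m\<close> could not serve, being trivial for
  \<open>\<epsilon> * m = 1\<close>.\<close>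

lemma card_admissible_small_right:
  assumes "4 * W\<^sup>2 \<le> N" "1 \<le> W"
  shows "real (card {(d, m) \<in> admissible \<eta> \<epsilon> N. m \<le> W}) \<le> small_bound N W"
proof -
  let ?S = "prod.swap ` admissible \<eta> \<epsilon> N"
  have "prod.swap ` {(d, m) \<in> admissible \<eta> \<epsilon> N. m \<le> W} = {(m, d) \<in> ?S. m \<le> W}" by force
  then have "card {(d, m) \<in> admissible \<eta> \<epsilon> N. m \<le> W} = card {(m, d) \<in> ?S. m \<le> W}"
    using card_image[of prod.swap "{(d, m) \<in> admissible \<eta> \<epsilon> N. m \<le> W}"] by simp
  moreover have "real (card {(m, d) \<in> ?S. m \<le> W}) \<le> small_bound N W"
  proof (rule card_pairs_split_le[OF assms])
    fix m d assume "(m, d) \<in> ?S"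
    then have "(d, m) \<in> admissible \<eta> \<epsilon> N" by auto
    then show "1 \<le> m \<and> 1 \<le> d \<and> m * d \<le> N \<and> squarefree d"
      using admissible_subset[of \<eta> \<epsilon> N] by (auto simp: admissible_def squarefree_mult_iff mult.commute)
  next
    fix m
    have "(if even p then 0 else jacobi 2 p) = 1" if "(m, d) \<in> ?S \<and> prime p \<and> p dvd d" for d p
      using that by (intro split_set_character[of d]) (auto simp: admissible_def)
    then show "\<exists>q \<chi>. real_character q \<chi> \<and> q \<le> 8 * W \<and> (\<forall>d p. (m, d) \<in> ?S \<and> prime p \<and> p dvd d \<longrightarrow> \<chi> p = 1)"
      using real_character_two assms(2) by (intro exI conjI) (assumption, simp, blast)
  qed (simp add: finite_admissible)
  ultimately show ?thesis by simp
qed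

text \<open>Writing the residue conditions modulo $m$ and $d$ as averages of Jacobi symbols over divisors
  $m_1$ of $m = m_0 m_1$ and $d_1$ of $d = d_0 d_1$ produces a sum over quadruples. Only the pairs
  $(m_1, d_0)$ and $(m_0, d_1)$ interact through a single symbol: between $m_1$ and $d_1$ both symbols
  occur, and they cancel by reciprocity.\<close>
definition quads :: "nat set \<Rightarrow> nat set \<Rightarrow> nat \<Rightarrow> nat \<Rightarrow> (nat \<times> nat \<times> nat \<times> nat) set" where
  "quads S S' W N = {(m0, m1, d0, d1). squarefree (m0 * m1 * (d0 * d1)) \<and> odd (m0 * m1 * (d0 * d1)) \<and>
     m0 * m1 * (d0 * d1) \<le> N \<and> W < m0 * m1 \<and> W < d0 * d1 \<and>
     m0 \<in> S \<and> m1 \<in> S \<and> d0 \<in> S' \<and> d1 \<in> S'}"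

definition quad_term :: "int \<Rightarrow> int \<Rightarrow> nat \<times> nat \<times> nat \<times> nat \<Rightarrow> real" where
  "quad_term \<eta> \<epsilon> = (\<lambda>(m0, m1, d0, d1).
     real_of_int (jacobi (\<eta> * int (d0 * d1)) m1) * real_of_int (jacobi (\<epsilon> * int (m0 * m1)) d1)
     / (real (tau (m0 * m1)) * real (tau (d0 * d1))))"

lemma quads_subset: "quads S S' W N \<subseteq> {1..N} \<times> {1..N} \<times> {1..N} \<times> {1..N}"
proof
  fix x assume "x \<in> quads S S' W N"
  then obtain a b c d where x: "x = (a, b, c, d)" "(a, b, c, d) \<in> quads S S' W N"
    by (cases x) auto
  then have *: "a * b * (c * d) \<le> N" "a > 0" "b > 0" "c > 0" "d > 0"
    by (auto simp: quads_def intro!: Nat.gr0I)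
  have "x \<le> N" if "x dvd a * b * (c * d)" for x
    using dvd_imp_le[OF that] * by auto
  from this[of a] this[of b] this[of c] this[of d]
  show "x \<in> {1..N} \<times> {1..N} \<times> {1..N} \<times> {1..N}"
    using * by (auto simp: x)
qed

lemma finite_quads: "finite (quads S S' W N)"
  using quads_subset by (rule finite_subset) auto

text \<open>Both mutual residue conditions become averages \<open>I\<close> of symbols over
  divisors, while the condition on 2 stays as membership in \<open>split_set\<close>, inherited by
  \<open>d0\<close> and \<open>d1\<close>. Enlarging the range to \<open>P\<close> is harmless, as
  products of these averages are nonnegative there.\<close>

lemma card_admissible_large_le:
  assumes \<eta>: "\<eta> \<in> {1, -1, 2, -2}" and \<epsilon>: "\<epsilon> \<in> {1, -1}"
  shows "real (card {(d, m) \<in> admissible \<eta> \<epsilon> N. W < d \<and> W < m})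
    \<le> (\<Sum>t\<in>quads UNIV split_set W N. quad_term \<eta> \<epsilon> t)"
proof -
  define P where "P = {(d, m). odd d \<and> odd m \<and> squarefree (d * m) \<and> d * m \<le> N \<and> W < d \<and> W < m \<and> d \<in> split_set}"
  define I where "I = (\<lambda>b m. (\<Sum>e | e dvd m. real_of_int (jacobi b e)) / real (tau m))"
  have I: "I b m = (if \<forall>p. prime p \<and> p dvd m \<longrightarrow> Legendre b (int p) = 1 then 1 else 0)"
    if "odd m" "squarefree m" "coprime b (int m)" for b m
  proof -
    have "m > 0" using that(1) by (auto intro: Nat.gr0I)
    have "(\<Sum>e | e dvd m. real_of_int (jacobi b e)) = real_of_int (\<Sum>e | e dvd m. jacobi b e)" by simp
    then show ?thesis
      unfolding I_def sum_jacobi_divisors[OF that] using tau_pos[OF \<open>m > 0\<close>] by simp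
  qed
  have cop: "coprime (\<eta> * int d) (int m)" "coprime (\<epsilon> * int m) (int d)" if "(d, m) \<in> P" for d m
  proof -
    have *: "coprime d m" "odd m" using that by (auto simp: P_def squarefree_mult_iff)
    then have "coprime 2 (int m)" by simp
    then have "coprime \<eta> (int m)" using \<eta> by auto
    then show "coprime (\<eta> * int d) (int m)" using * by simp
    show "coprime (\<epsilon> * int m) (int d)" using * \<epsilon> by (auto simp: coprime_commute)
  qed
  have P_I: "I (\<eta> * int d) m * I (\<epsilon> * int m) d \<ge> 0" if "(d, m) \<in> P" for d m
    using that cop[OF that] by (auto simp: I P_def squarefree_mult_iff)
  have finP: "finite P"
  proof (rule finite_subset)
    show "P \<subseteq> {..N} \<times> {..N}"
    proof
      fix x assume "x \<in> P"
      then obtain d m where x: "x = (d, m)" "(d, m) \<in> P" by (cases x) auto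
      then have "d * m \<le> N" "d > 0" "m > 0" by (auto simp: P_def intro!: Nat.gr0I)
      moreover from this have "d * 1 \<le> d * m" "1 * m \<le> d * m" by (intro mult_le_mono; simp)+
      ultimately have "d \<le> N" "m \<le> N" by linarith+
      then show "x \<in> {..N} \<times> {..N}" by (simp add: x)
    qed
  qed simp
  have "real (card {(d, m) \<in> admissible \<eta> \<epsilon> N. W < d \<and> W < m}) =
      (\<Sum>(d, m) \<in> {(d, m) \<in> admissible \<eta> \<epsilon> N. W < d \<and> W < m}. 1)" by simp
  also have "\<dots> = (\<Sum>(d, m) \<in> {(d, m) \<in> admissible \<eta> \<epsilon> N. W < d \<and> W < m}. I (\<eta> * int d) m * I (\<epsilon> * int m) d)"
  proof (intro sum.cong refl)
    fix x assume x: "x \<in> {(d, m) \<in> admissible \<eta> \<epsilon> N. W < d \<and> W < m}"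
    then obtain d m where dm: "x = (d, m)" "(d, m) \<in> P"
      by (auto simp: admissible_def P_def)
    show "(case x of (d, m) \<Rightarrow> 1) = (case x of (d, m) \<Rightarrow> I (\<eta> * int d) m * I (\<epsilon> * int m) d)"
      using x dm cop[OF dm(2)] by (auto simp: I admissible_def squarefree_mult_iff)
  qed
  also have "\<dots> \<le> (\<Sum>(d, m)\<in>P. I (\<eta> * int d) m * I (\<epsilon> * int m) d)"
    using finP P_I by (intro sum_mono2) (auto simp: admissible_def P_def)
  also have "\<dots> = (\<Sum>(d, m)\<in>P. \<Sum>(m1, d1)\<in>{e. e dvd m} \<times> {e. e dvd d}.
      real_of_int (jacobi (\<eta> * int d) m1) * real_of_int (jacobi (\<epsilon> * int m) d1) / (real (tau m) * real (tau d)))"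
    by (simp add: I_def sum_product sum.cartesian_product sum_divide_distrib case_prod_beta)
  also have "\<dots> = (\<Sum>((d, m), (m1, d1))\<in>(SIGMA x:P. {e. e dvd snd x} \<times> {e. e dvd fst x}).
      real_of_int (jacobi (\<eta> * int d) m1) * real_of_int (jacobi (\<epsilon> * int m) d1) / (real (tau m) * real (tau d)))"
  proof -
    have "finite ({e. e dvd snd x} \<times> {e. e dvd fst x})" if "x \<in> P" for x
      using that by (auto simp: P_def intro!: Nat.gr0I finite_divisors)
    then show ?thesis using finP by (subst sum.Sigma[symmetric]) (auto simp: case_prod_beta)
  qed
  also have "\<dots> = (\<Sum>t\<in>quads UNIV split_set W N. quad_term \<eta> \<epsilon> t)"
  proof -
    define j :: "(nat \<times> nat) \<times> nat \<times> nat \<Rightarrow> nat \<times> nat \<times> nat \<times> nat"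
      where "j = (\<lambda>((d, m), (m1, d1)). (m div m1, m1, d div d1, d1))"
    define i :: "nat \<times> nat \<times> nat \<times> nat \<Rightarrow> (nat \<times> nat) \<times> nat \<times> nat"
      where "i = (\<lambda>(m0, m1, d0, d1). ((d0 * d1, m0 * m1), (m1, d1)))"
    show ?thesis
    proof (rule sum.reindex_bij_witness[where j = j and i = i])
      fix a assume a: "a \<in> (SIGMA x:P. {e. e dvd snd x} \<times> {e. e dvd fst x})"
      obtain d m m1 d1 where a': "a = ((d, m), (m1, d1))" by (metis surj_pair)
      obtain m0 d0 where e: "m = m0 * m1" "d = d0 * d1"
        using a a' by (auto simp: dvd_def mult.commute)
      have P: "(d0 * d1, m0 * m1) \<in> P" using a a' e by auto
      have "m1 > 0" "d1 > 0" using P by (auto simp: P_def intro!: Nat.gr0I)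
      then have j: "j a = (m0, m1, d0, d1)"
        by (simp add: a' e j_def)
      show "i (j a) = a" unfolding j by (simp add: a' e i_def)
      show "j a \<in> quads UNIV split_set W N"
        unfolding j using P by (auto simp: P_def quads_def split_set_def mult.commute)
      show "quad_term \<eta> \<epsilon> (j a) =
          (\<lambda>((d, m), (m1, d1)). real_of_int (jacobi (\<eta> * int d) m1) *
            real_of_int (jacobi (\<epsilon> * int m) d1) / (real (tau m) * real (tau d))) a"
        unfolding j by (simp add: a' e quad_term_def)
    next
      fix t assume t: "t \<in> quads UNIV split_set W N"
      obtain m0 m1 d0 d1 where t': "t = (m0, m1, d0, d1)" by (cases t) auto
      have pos: "m1 > 0" "d1 > 0" using t t' by (auto simp: quads_def intro!: Nat.gr0I)
      show "j (i t) = t" using pos by (simp add: t' i_def j_def)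
      show "i t \<in> (SIGMA x:P. {e. e dvd snd x} \<times> {e. e dvd fst x})"
        using t by (auto simp: t' i_def P_def quads_def split_set_def prime_dvd_mult_iff mult.commute)
    qed
  qed
  finally show ?thesis .
qed

lemma quads_bilinear:
  assumes "0 < V" "0 < N"
  shows "\<bar>\<Sum>t | t \<in> quads S S' W N \<and> (case t of (m0, m1, d0, d1) \<Rightarrow> V < m1 \<and> V < d0 \<and> E m0 d1).
      quad_term \<eta> \<epsilon> t\<bar> \<le> 10 * real N * (1 + ln (real N)) ^ 5 * real V powr (-1/12)"
proof -
  define T where "T = {t. t \<in> quads S S' W N \<and> (case t of (m0, m1, d0, d1) \<Rightarrow> V < m1 \<and> V < d0 \<and> E m0 d1)}"
  define h where "h = (\<lambda>(m0 :: nat, m1 :: nat, d0 :: nat, d1 :: nat). (m0, d1))"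
  let ?L = "1 + ln (real N)" and ?v = "real V powr (-1/12)"
  have L: "?L \<ge> 1" using ln_nat_nonneg[of N] by simp
  have finT: "finite T" unfolding T_def using finite_quads by (rule finite_subset[rotated]) auto
  have inner: "\<bar>\<Sum>t | t \<in> T \<and> h t = (a, b). quad_term \<eta> \<epsilon> t\<bar>
      \<le> 10 * real N * ?L ^ 3 * ?v * (1 / real a * (1 / real b))"
    if ab: "a \<in> {1..N}" "b \<in> {1..N}" for a b
  proof (cases "{t. t \<in> T \<and> h t = (a, b)} = {}")
    case True
    have "0 \<le> 10 * real N * ?L ^ 3 * ?v * (1 / real a * (1 / real b))" using L by simp
    then show ?thesis unfolding True by simp
  next
    case False
    then have *: "odd a" "odd b" "squarefree a" "squarefree b" "coprime a b" "a \<in> S" "b \<in> S'" "E a b"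
      by (auto simp: T_def h_def quads_def squarefree_mult_iff coprime_mult_left_iff
          coprime_mult_right_iff coprime_commute)
    define Z where "Z = N div (a * b)"
    define A where "A = {m. V < m \<and> odd m \<and> squarefree m \<and> coprime m (a * b) \<and> W < a * m \<and> m \<in> S}"
    define B where "B = {d. V < d \<and> odd d \<and> squarefree d \<and> coprime d (a * b) \<and> W < d * b \<and> d \<in> S'}"
    define \<alpha> where "\<alpha> = (\<lambda>m. if odd m then real_of_int (jacobi \<eta> m) * jac b m * jac m b / real (tau m) else 0)"
    define \<beta> where "\<beta> = (\<lambda>d. 1 / real (tau d))"
    define \<kappa> where "\<kappa> = real_of_int (jacobi \<epsilon> b) * jac a b / (real (tau a) * real (tau b))"
    have jac1: "\<bar>real_of_int (jacobi x m)\<bar> \<le> 1" if "odd m" for x m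
      using jacobi_values[OF that, of x] by auto
    have div1: "\<bar>x / real n\<bar> \<le> 1" if "\<bar>x\<bar> \<le> 1" for x :: real and n :: nat
      using that by (cases "n = 0") (auto simp: divide_le_eq)
    have \<alpha>: "\<bar>\<alpha> m\<bar> \<le> 1" for m
    proof (cases "odd m")
      case True
      have "\<bar>real_of_int (jacobi \<eta> m) * jac b m * jac m b\<bar> \<le> 1"
        unfolding abs_mult using True *(2) by (intro mult_le_one jac1) auto
      then show ?thesis using True div1 by (simp add: \<alpha>_def)
    qed (simp add: \<alpha>_def)
    have \<beta>: "\<bar>\<beta> d\<bar> \<le> 1" for d using div1[of 1] by (simp add: \<beta>_def)
    have \<kappa>: "\<bar>\<kappa>\<bar> \<le> 1"
    proof -
      have "\<bar>real_of_int (jacobi \<epsilon> b) * jac a b\<bar> \<le> 1"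
        unfolding abs_mult using *(2) by (intro mult_le_one jac1) auto
      then show ?thesis using div1[of _ "tau a * tau b"] by (simp add: \<kappa>_def)
    qed
    have Z_iff: "x \<le> Z \<longleftrightarrow> x * (a * b) \<le> N" for x
      using ab by (simp add: Z_def less_eq_div_iff_mult_less_eq)
    have "(\<Sum>t | t \<in> T \<and> h t = (a, b). quad_term \<eta> \<epsilon> t) =
        (\<Sum>(m, d) | m \<in> A \<and> d \<in> B \<and> coprime m d \<and> m * d \<le> Z. \<kappa> * (\<alpha> m * \<beta> d * jac d m))"
    proof (rule sum.reindex_bij_witness[where i = "\<lambda>(m, d). (a, m, d, b)" and j = "\<lambda>(x, m, d, y). (m, d)"])
      fix t assume t: "t \<in> {t. t \<in> T \<and> h t = (a, b)}"
      then obtain m d where t': "t = (a, m, d, b)" by (auto simp: h_def split: prod.splits)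
      have q: "(a, m, d, b) \<in> quads S S' W N" "V < m" "V < d" using t t' by (auto simp: T_def)
      then have c: "coprime a m" "coprime d b" "odd m" "odd d" "coprime m d"
        by (auto simp: quads_def squarefree_mult_iff coprime_mult_left_iff coprime_mult_right_iff)
      have pos: "m > 0" "d > 0" "a > 0" "b > 0" using q(2,3) ab by auto
      show "(case case t of (x, m, d, y) \<Rightarrow> (m, d) of (m, d) \<Rightarrow> (a, m, d, b)) = t" by (simp add: t')
      show "(case t of (x, m, d, y) \<Rightarrow> (m, d)) \<in> {(m, d). m \<in> A \<and> d \<in> B \<and> coprime m d \<and> m * d \<le> Z}"
        using q by (auto simp: t' quads_def A_def B_def squarefree_mult_iff coprime_mult_left_iff
            coprime_mult_right_iff coprime_commute Z_iff mult_ac)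
      show "(case case t of (x, m, d, y) \<Rightarrow> (m, d) of (m, d) \<Rightarrow> \<kappa> * (\<alpha> m * \<beta> d * jac d m)) = quad_term \<eta> \<epsilon> t"
      proof -
        have "tau (a * m) = tau a * tau m" "tau (d * b) = tau d * tau b"
          by (intro tau_coprime c pos)+
        then have "quad_term \<eta> \<epsilon> t =
            real_of_int (jacobi (\<eta> * int (d * b)) m) * real_of_int (jacobi (\<epsilon> * int (a * m)) b)
            / (real (tau a * tau m) * real (tau d * tau b))"
          by (simp only: t' quad_term_def case_prod_conv)
        then show ?thesis
          using c(3) *(2) by (simp add: t' \<kappa>_def \<alpha>_def \<beta>_def jacobi_mult_left mult_ac)
      qed
    next
      fix x assume x: "x \<in> {(m, d). m \<in> A \<and> d \<in> B \<and> coprime m d \<and> m * d \<le> Z}"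
      then obtain m d where x': "x = (m, d)" by (cases x) auto
      show "(case case x of (m, d) \<Rightarrow> (a, m, d, b) of (x, m, d, y) \<Rightarrow> (m, d)) = x" by (simp add: x')
      show "(case x of (m, d) \<Rightarrow> (a, m, d, b)) \<in> {t. t \<in> T \<and> h t = (a, b)}"
        using x * by (auto simp: x' T_def h_def quads_def A_def B_def squarefree_mult_iff coprime_mult_left_iff
            coprime_mult_right_iff coprime_commute Z_iff mult_ac)
    qed
    also have "\<dots> = \<kappa> * (\<Sum>(m, d) | m \<in> A \<and> d \<in> B \<and> coprime m d \<and> m * d \<le> Z. \<alpha> m * \<beta> d * jac d m)"
      by (simp add: sum_distrib_left case_prod_beta)
    finally have eq: "(\<Sum>t | t \<in> T \<and> h t = (a, b). quad_term \<eta> \<epsilon> t) =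
        \<kappa> * (\<Sum>(m, d) | m \<in> A \<and> d \<in> B \<and> coprime m d \<and> m * d \<le> Z. \<alpha> m * \<beta> d * jac d m)" .
    have "\<bar>\<Sum>t | t \<in> T \<and> h t = (a, b). quad_term \<eta> \<epsilon> t\<bar> \<le> 1 * \<bar>\<Sum>(m, d) | m \<in> A \<and> d \<in> B \<and> coprime m d \<and> m * d \<le> Z. \<alpha> m * \<beta> d * jac d m\<bar>"
      unfolding eq abs_mult by (intro mult_right_mono \<kappa>) auto
    also have "\<dots> \<le> 10 * real Z * (1 + ln (real Z)) ^ 3 * ?v"
      unfolding mult_1 by (rule bilinear_coprime_bound[OF _ _ assms(1) \<alpha> \<beta>]) (auto simp: A_def B_def)
    also have "\<dots> \<le> 10 * (real N / real (a * b)) * ?L ^ 3 * ?v"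
    proof (rule mult_right_mono[OF mult_mono[OF mult_left_mono power_mono]])
      show "real Z \<le> real N / real (a * b)" unfolding Z_def by (rule of_nat_div_le_of_nat)
      show "1 + ln (real Z) \<le> ?L"
        using assms(2) by (cases "Z = 0") (auto simp: Z_def intro!: ln_mono ln_nat_nonneg)
    qed (use ln_nat_nonneg[of Z] in auto)
    finally show ?thesis by (simp add: mult_ac)
  qed
  have "(\<Sum>t\<in>T. quad_term \<eta> \<epsilon> t) = (\<Sum>x\<in>{1..N} \<times> {1..N}. \<Sum>t | t \<in> T \<and> h t = x. quad_term \<eta> \<epsilon> t)"
  proof (rule sum.group[symmetric])
    show "h ` T \<subseteq> {1..N} \<times> {1..N}"
      using quads_subset[of S S' W N] by (auto simp: T_def h_def)
  qed (use finT in auto)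
  also have "\<bar>\<dots>\<bar> \<le> (\<Sum>x\<in>{1..N} \<times> {1..N}. \<bar>\<Sum>t | t \<in> T \<and> h t = x. quad_term \<eta> \<epsilon> t\<bar>)"
    by (rule sum_abs)
  also have "\<dots> \<le> (\<Sum>(a, b)\<in>{1..N} \<times> {1..N}. 10 * real N * ?L ^ 3 * ?v * (1 / real a * (1 / real b)))"
    using inner by (intro sum_mono) auto
  also have "\<dots> = 10 * real N * ?L ^ 3 * ?v * (\<Sum>a\<in>{1..N}. 1 / real a)\<^sup>2"
    unfolding power2_eq_square[of "sum _ _"] sum_product sum.cartesian_product
    by (simp add: sum_distrib_left case_prod_beta)
  also have "\<dots> \<le> 10 * real N * ?L ^ 3 * ?v * ?L\<^sup>2"
    using L assms by (intro mult_left_mono power_mono sum_inverse_le_ln sum_nonneg) auto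
  also have "\<dots> = 10 * real N * ?L ^ 5 * ?v"
    by (simp add: eval_nat_numeral mult_ac)
  finally show ?thesis by (simp add: T_def)
qed

text \<open>Of order \<open>L powr (3/4)\<close>: the logarithmic factor in
  \<open>sum_split_weight_le\<close> for modulus 8, with 6 as an upper bound for
  \<open>3 + ln 8\<close>.\<close>

definition weight_factor :: "real \<Rightarrow> real" where
  "weight_factor L = sqrt (1 + 2 * L) * sqrt (sqrt ((1 + 4 * L) * 6))"

text \<open>For fixed small \<open>m1\<close> and \<open>d1\<close> the pairs
  \<open>(m0, d0)\<close> are grouped by their product \<open>n\<close>. Since \<open>m0\<close> and
  \<open>d0\<close> are coprime, the weight becomes \<open>1 / tau n\<close> for each divisor
  \<open>d0\<close> of \<open>n\<close> in \<open>split_set\<close>, which is the weighted mean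
  already estimated. The product \<open>m1 * d1\<close> is at most \<open>V^2\<close>, hence the
  fourth power of \<open>V\<close> in the hypothesis.\<close>

lemma quads_trivial:
  assumes "4 * (V\<^sup>2)\<^sup>2 \<le> N" "1 \<le> V"
  shows "(\<Sum>(m0, m1, d0, d1) | (m0, m1, d0, d1) \<in> quads S split_set W N \<and> m1 \<le> V \<and> d1 \<le> V.
      1 / (real (tau m0) * real (tau d0)))
    \<le> 20 * real N / ln (real N) * weight_factor (ln (real N)) * (1 + ln (real V))\<^sup>2"
proof -
  interpret real_character 8 "\<lambda>x. if even x then 0 else jacobi 2 x" by (rule real_character_two)
  define R where "R = {n. \<forall>p. prime p \<and> p dvd n \<longrightarrow> (if even p then 0 else jacobi 2 p) = 1}"
  define T where "T = {(m0, m1, d0, d1). (m0, m1, d0, d1) \<in> quads S split_set W N \<and> m1 \<le> V \<and> d1 \<le> V}"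
  define h where "h = (\<lambda>(m0 :: nat, m1 :: nat, d0 :: nat, d1 :: nat). (m1, d1))"
  define f where "f = (\<lambda>(m0, m1 :: nat, d0, d1 :: nat). 1 / (real (tau m0) * real (tau d0)))"
  let ?C = "20 * real N / ln (real N) * weight_factor (ln (real N))"
  have finT: "finite T" unfolding T_def using finite_quads by (rule finite_subset[rotated]) auto
  have inner: "(\<Sum>t | t \<in> T \<and> h t = (u, v). f t) \<le> ?C * (1 / real u * (1 / real v))"
    if uv: "u \<in> {1..V}" "v \<in> {1..V}" for u v
  proof -
    define Y where "Y = N div (u * v)"
    have "u * v \<le> V * V" "1 * 1 \<le> u * v" using uv by (intro mult_le_mono; simp)+
    then have "4 * (V\<^sup>2)\<^sup>2 \<le> N" "1 \<le> u * v" "u * v \<le> V\<^sup>2" using assms by (auto simp: power2_eq_square)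
    note Y = div_large[OF this, folded Y_def]
    have lnN: "ln (real N) > 0" using Y(1,4) by simp
    have lnYN: "ln (real Y) \<le> ln (real N)" using Y(1,4) by (intro ln_mono) auto
    have lnY: "ln (real Y) \<ge> 0" by (rule ln_nat_nonneg)
    have "ln (real 8) = 3 * ln 2" using ln_realpow[of 2 3] by simp
    then have ln8: "3 + ln (real 8) \<le> 6" using ln_le_minus_one[of "2 :: real"] by simp
    have "(\<Sum>t | t \<in> T \<and> h t = (u, v). f t)
        \<le> (\<Sum>(n, b)\<in>(SIGMA n:{n. n \<in> {1..Y} \<and> squarefree n}. {b. b dvd n \<and> b \<in> R}). 1 / real (tau n))"
    proof (rule sum_le_included[where i = "\<lambda>(n, b). (n div b, u, b, v)"])
      show "\<forall>t\<in>{t. t \<in> T \<and> h t = (u, v)}.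
          \<exists>y\<in>(SIGMA n:{n. n \<in> {1..Y} \<and> squarefree n}. {b. b dvd n \<and> b \<in> R}).
            (case y of (n, b) \<Rightarrow> (n div b, u, b, v)) = t \<and> f t \<le> (case y of (n, b) \<Rightarrow> 1 / real (tau n))"
      proof
        fix t assume t: "t \<in> {t. t \<in> T \<and> h t = (u, v)}"
        then obtain a b where t': "t = (a, u, b, v)" by (auto simp: h_def split: prod.splits)
        have q: "(a, u, b, v) \<in> quads S split_set W N" using t t' by (auto simp: T_def)
        then have c: "coprime a b" "squarefree (a * b)" "odd b" "b \<in> split_set"
          by (auto simp: quads_def squarefree_mult_iff coprime_mult_left_iff coprime_mult_right_iff)
        have pos: "a > 0" "b > 0" using q by (auto simp: quads_def intro!: Nat.gr0I)
        have "a * b \<le> Y"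
          using q uv by (simp add: Y_def less_eq_div_iff_mult_less_eq quads_def mult_ac)
        moreover have "b \<in> R" using split_set_character[OF c(3,4)] by (auto simp: R_def)
        ultimately show "\<exists>y\<in>(SIGMA n:{n. n \<in> {1..Y} \<and> squarefree n}. {b. b dvd n \<and> b \<in> R}).
            (case y of (n, b) \<Rightarrow> (n div b, u, b, v)) = t \<and> f t \<le> (case y of (n, b) \<Rightarrow> 1 / real (tau n))"
          using c pos by (intro bexI[of _ "(a * b, b)"]) (auto simp: t' f_def tau_coprime Suc_le_eq)
      qed
    qed (use finT in \<open>auto intro!: finite_divisors\<close>)
    also have "\<dots> = (\<Sum>n | n \<in> {1..Y} \<and> squarefree n. \<Sum>b | b dvd n \<and> b \<in> R. 1 / real (tau n))"
      by (rule sum.Sigma[symmetric]) auto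
    also have "\<dots> = (\<Sum>n | n \<in> {1..Y} \<and> squarefree n. real (card {b. b dvd n \<and> b \<in> R}) / real (tau n))"
      by simp
    also have "\<dots> \<le> 10 * real Y / ln (real Y) * (sqrt (1 + 2 * ln (real Y)) *
        sqrt (sqrt ((1 + 4 * ln (real Y)) * (3 + ln (real 8)))))"
      unfolding R_def by (rule sum_split_weight_le[OF Y(1)])
    also have "\<dots> \<le> (10 * (real N / real (u * v)) / (ln (real N) / 2)) * weight_factor (ln (real N))"
      unfolding weight_factor_def using Y lnN lnYN lnY ln8
      by (intro mult_mono frac_le real_sqrt_le_mono) (auto intro!: mult_nonneg_nonneg add_nonneg_nonneg)
    finally show ?thesis by (simp add: mult_ac)
  qed
  have "(\<Sum>t\<in>T. f t) = (\<Sum>x\<in>{1..V} \<times> {1..V}. \<Sum>t | t \<in> T \<and> h t = x. f t)"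
  proof (rule sum.group[symmetric])
    show "h ` T \<subseteq> {1..V} \<times> {1..V}"
      using quads_subset[of S split_set W N] by (auto simp: T_def h_def)
  qed (use finT in auto)
  also have "\<dots> \<le> (\<Sum>(a, b)\<in>{1..V} \<times> {1..V}. ?C * (1 / real a * (1 / real b)))"
    using inner by (intro sum_mono) auto
  also have "\<dots> = ?C * (\<Sum>a\<in>{1..V}. 1 / real a)\<^sup>2"
    unfolding power2_eq_square[of "sum _ _"] sum_product sum.cartesian_product
    by (simp add: sum_distrib_left case_prod_beta)
  also have "\<dots> \<le> ?C * (1 + ln (real V))\<^sup>2"
    using assms ln_nat_nonneg[of N]
    by (intro mult_left_mono power_mono sum_inverse_le_ln sum_nonneg)
       (auto simp: weight_factor_def intro!: mult_nonneg_nonneg divide_nonneg_nonneg)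
  finally show ?thesis by (simp add: T_def f_def)
qed

text \<open>If neither interacting pair consists of two large numbers, then $m_0 m_1 > V^2$ and
  $d_0 d_1 > V^2$ leave only the cases $m_1, d_1 \le V$ and $m_0, d_0 \le V$.\<close>
lemma sum_quad_term_le:
  assumes "4 * (V\<^sup>2)\<^sup>2 \<le> N" "1 \<le> V"
  shows "(\<Sum>t\<in>quads UNIV split_set (V\<^sup>2) N. quad_term \<eta> \<epsilon> t)
    \<le> 20 * real N * (1 + ln (real N)) ^ 5 * real V powr (-1/12)
      + 40 * real N / ln (real N) * weight_factor (ln (real N)) * (1 + ln (real V))\<^sup>2"
proof -
  define Q where "Q = quads UNIV split_set (V\<^sup>2) N"
  define Q1 where "Q1 = {t. t \<in> Q \<and> (case t of (m0, m1, d0, d1) \<Rightarrow> V < m1 \<and> V < d0 \<and> True)}"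
  define Q2 where "Q2 = {t. t \<in> Q \<and> (case t of (m0, m1, d0, d1) \<Rightarrow> V < m0 \<and> V < d1 \<and> \<not> (V < m1 \<and> V < d0))}"
  define Q3 where "Q3 = {(m0, m1, d0, d1). (m0, m1, d0, d1) \<in> Q \<and> m1 \<le> V \<and> d1 \<le> V}"
  define Q4 where "Q4 = {(m0, m1, d0, d1). (m0, m1, d0, d1) \<in> Q \<and> m0 \<le> V \<and> d0 \<le> V}"
  let ?B = "10 * real N * (1 + ln (real N)) ^ 5 * real V powr (-1/12)"
  let ?C = "20 * real N / ln (real N) * weight_factor (ln (real N)) * (1 + ln (real V))\<^sup>2"
  let ?g = "quad_term \<eta> \<epsilon>"
  have pos: "0 < V" "0 < N" using assms by (auto intro: Nat.gr0I)
  have finQ: "finite Q" unfolding Q_def by (rule finite_quads)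
  have "\<bar>\<Sum>t\<in>Q1. ?g t\<bar> \<le> ?B"
    unfolding Q1_def Q_def by (rule quads_bilinear[OF pos])
  then have 1: "(\<Sum>t\<in>Q1. ?g t) \<le> ?B" by linarith
  have 2: "(\<Sum>t\<in>Q2. ?g t) \<le> ?B"
  proof -
    \<comment> \<open>The roles of the two coordinates are exchanged, together with
      \<open>\<eta>\<close> and \<open>\<epsilon>\<close>. The negated condition, which keeps this
      range disjoint from \<open>Q1\<close>, then involves only the variables that are frozen in the
      bilinear bound.\<close>
    let ?s = "\<lambda>(m0, m1, d0, d1). (d0, d1, m0, m1)"
    have "(\<Sum>t\<in>Q2. ?g t) = (\<Sum>t | t \<in> quads split_set UNIV (V\<^sup>2) N \<and>
        (case t of (m0, m1, d0, d1) \<Rightarrow> V < m1 \<and> V < d0 \<and> \<not> (V < d1 \<and> V < m0)). quad_term \<epsilon> \<eta> t)"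
      by (rule sum.reindex_bij_witness[where i = ?s and j = ?s])
         (auto simp: Q2_def Q_def quads_def quad_term_def mult_ac)
    also have "\<bar>\<dots>\<bar> \<le> ?B" by (rule quads_bilinear[OF pos])
    finally show ?thesis by linarith
  qed
  \<comment> \<open>All symbols are bounded by 1, and the factors \<open>tau\<close> of one index,
    the one whose variables will be small, are discarded.\<close>
  have g_le: "?g (a, b, c, d) \<le> 1 / (real (tau a) * real (tau c))"
    "?g (a, b, c, d) \<le> 1 / (real (tau b) * real (tau d))" if t: "(a, b, c, d) \<in> Q" for a b c d
  proof -
    have cop: "coprime a b" "coprime c d" "odd b" "odd d"
      using t by (auto simp: Q_def quads_def squarefree_mult_iff)
    have p: "a > 0" "b > 0" "c > 0" "d > 0" using t by (auto simp: Q_def quads_def intro!: Nat.gr0I)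
    have tp: "real (tau x) \<ge> 1" if "x > 0" for x using tau_pos[OF that] by simp
    have "?g (a, b, c, d) \<le> \<bar>?g (a, b, c, d)\<bar>" by (rule abs_ge_self)
    also have "\<dots> = \<bar>real_of_int (jacobi (\<eta> * int (c * d)) b)\<bar> * \<bar>real_of_int (jacobi (\<epsilon> * int (a * b)) d)\<bar>
        / ((real (tau a) * real (tau b)) * (real (tau c) * real (tau d)))"
      by (simp add: quad_term_def tau_coprime cop p abs_mult)
    also have "\<dots> \<le> 1 / ((real (tau a) * real (tau b)) * (real (tau c) * real (tau d)))"
      using jacobi_values[OF cop(3), of "\<eta> * int (c * d)"] jacobi_values[OF cop(4), of "\<epsilon> * int (a * b)"]
      by (intro divide_right_mono) auto
    finally have le: "?g (a, b, c, d) \<le> 1 / ((real (tau a) * real (tau c)) * (real (tau b) * real (tau d)))"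
      by (simp add: mult_ac)
    have "1 \<le> real (tau x) * real (tau y)" if "x > 0" "y > 0" for x y
      using mult_mono[OF tp[OF that(1)] tp[OF that(2)]] by simp
    then have ge: "1 \<le> real (tau a) * real (tau c)" "1 \<le> real (tau b) * real (tau d)" using p by auto
    have "1 / ((real (tau a) * real (tau c)) * (real (tau b) * real (tau d))) \<le> 1 / (real (tau a) * real (tau c))"
      "1 / ((real (tau a) * real (tau c)) * (real (tau b) * real (tau d))) \<le> 1 / (real (tau b) * real (tau d))"
      using ge by (auto intro!: divide_left_mono simp: mult_le_cancel_left1 mult_le_cancel_right1)
    then show "?g (a, b, c, d) \<le> 1 / (real (tau a) * real (tau c))"
      "?g (a, b, c, d) \<le> 1 / (real (tau b) * real (tau d))" using le by linarith+
  qed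
  define f where "f = (\<lambda>(a, b :: nat, c, d :: nat). 1 / (real (tau a) * real (tau c)))"
  define f' where "f' = (\<lambda>(a :: nat, b, c :: nat, d). 1 / (real (tau b) * real (tau d)))"
  have 3: "(\<Sum>t\<in>Q3. f t) \<le> ?C"
    using quads_trivial[OF assms, of UNIV "V\<^sup>2"] by (simp add: Q3_def Q_def f_def)
  have 4: "(\<Sum>t\<in>Q4. f' t) \<le> ?C"
  proof -
    \<comment> \<open>After symbols have been replaced by absolute values, the conditions on
      quadruples are symmetric under exchanging the indices 0 and 1.\<close>
    let ?s = "\<lambda>(m0, m1, d0, d1). (m1, m0, d1, d0)"
    have "(\<Sum>t\<in>Q4. f' t) = (\<Sum>t\<in>Q3. f t)"
      by (rule sum.reindex_bij_witness[where i = ?s and j = ?s])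
         (auto simp: Q3_def Q4_def Q_def quads_def f_def f'_def mult_ac)
    then show ?thesis using 3 by simp
  qed
  have rest: "Q - Q1 - Q2 \<subseteq> Q3 \<union> Q4"
  proof
    fix t assume t: "t \<in> Q - Q1 - Q2"
    obtain a b c d where t': "t = (a, b, c, d)" by (cases t) auto
    have q: "V\<^sup>2 < a * b" "V\<^sup>2 < c * d" "(a, b, c, d) \<in> Q"
      using t by (auto simp: t' Q_def quads_def)
    have *: "b \<le> V \<or> c \<le> V" "a \<le> V \<or> d \<le> V" using t by (auto simp: t' Q1_def Q2_def)
    have "\<not> (a \<le> V \<and> b \<le> V)" "\<not> (c \<le> V \<and> d \<le> V)"
      using q(1,2) mult_le_mono[of a V b V] mult_le_mono[of c V d V] by (auto simp: power2_eq_square)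
    then have "b \<le> V \<and> d \<le> V \<or> a \<le> V \<and> c \<le> V" using * by blast
    then show "t \<in> Q3 \<union> Q4" using q(3) by (auto simp: t' Q3_def Q4_def)
  qed
  have f0: "f t \<ge> 0" "f' t \<ge> 0" for t by (auto simp: f_def f'_def split: prod.split)
  have fin: "finite Q3" "finite Q4"
    using finQ by (auto simp: Q3_def Q4_def elim!: rev_finite_subset)
  have "(\<Sum>t\<in>Q - Q1 - Q2. ?g t) \<le> (\<Sum>t\<in>Q - Q1 - Q2. (if t \<in> Q3 then f t else 0) + (if t \<in> Q4 then f' t else 0))"
  proof (rule sum_mono)
    fix t assume t: "t \<in> Q - Q1 - Q2"
    obtain a b c d where t': "t = (a, b, c, d)" by (cases t) auto
    have "?g t \<le> f t" "?g t \<le> f' t" using g_le[of a b c d] t by (auto simp: t' f_def f'_def)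
    then show "?g t \<le> (if t \<in> Q3 then f t else 0) + (if t \<in> Q4 then f' t else 0)"
      using rest t f0[of t] by auto
  qed
  also have "\<dots> \<le> (\<Sum>t\<in>Q. (if t \<in> Q3 then f t else 0) + (if t \<in> Q4 then f' t else 0))"
    using finQ f0 by (intro sum_mono2) (auto intro!: add_nonneg_nonneg)
  also have "\<dots> = (\<Sum>t\<in>Q3. f t) + (\<Sum>t\<in>Q4. f' t)"
  proof -
    have "Q \<inter> {t. t \<in> Q3} = Q3" "Q \<inter> {t. t \<in> Q4} = Q4" by (auto simp: Q3_def Q4_def)
    then show ?thesis using finQ by (simp add: sum.distrib sum.If_cases)
  qed
  finally have 5: "(\<Sum>t\<in>Q - Q1 - Q2. ?g t) \<le> ?C + ?C" using 3 4 by linarith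
  have "Q1 \<subseteq> Q" "Q2 \<subseteq> Q - Q1" by (auto simp: Q1_def Q2_def)
  then have "(\<Sum>t\<in>Q. ?g t) = (\<Sum>t\<in>Q - Q1 - Q2. ?g t) + (\<Sum>t\<in>Q2. ?g t) + (\<Sum>t\<in>Q1. ?g t)"
    using sum.subset_diff[of Q1 Q ?g] sum.subset_diff[of Q2 "Q - Q1" ?g] finQ by simp
  also have "\<dots> \<le> (?C + ?C) + ?B + ?B" using 1 2 5 by (intro add_mono)
  finally show ?thesis by (simp add: Q_def algebra_simps)
qed

lemma card_admissible_le:
  assumes N: "4 * (V\<^sup>2)\<^sup>2 \<le> N" "1 \<le> V" and \<eta>: "\<eta> \<in> {1, -1, 2, -2}" and \<epsilon>: "\<epsilon> \<in> {1, -1}"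
  shows "real (card (admissible \<eta> \<epsilon> N)) \<le> 2 * small_bound N (V\<^sup>2)
    + (20 * real N * (1 + ln (real N)) ^ 5 * real V powr (-1/12)
      + 40 * real N / ln (real N) * weight_factor (ln (real N)) * (1 + ln (real V))\<^sup>2)"
proof -
  let ?A = "{(d, m) \<in> admissible \<eta> \<epsilon> N. d \<le> V\<^sup>2}" and ?B = "{(d, m) \<in> admissible \<eta> \<epsilon> N. m \<le> V\<^sup>2}"
  let ?C = "{(d, m) \<in> admissible \<eta> \<epsilon> N. V\<^sup>2 < d \<and> V\<^sup>2 < m}"
  have V: "1 \<le> V\<^sup>2" using N(2) by simp
  have "admissible \<eta> \<epsilon> N = ?A \<union> (?B \<union> ?C)" by auto
  then have "card (admissible \<eta> \<epsilon> N) \<le> card ?A + card (?B \<union> ?C)"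
    using card_Un_le[of ?A "?B \<union> ?C"] by simp
  also have "\<dots> \<le> card ?A + (card ?B + card ?C)"
    by (intro add_left_mono card_Un_le)
  finally have "real (card (admissible \<eta> \<epsilon> N)) \<le> real (card ?A) + real (card ?B) + real (card ?C)"
    by simp
  moreover note card_admissible_small_left[OF N(1) V \<eta>, of \<epsilon>]
  moreover note card_admissible_small_right[OF N(1) V, of \<eta> \<epsilon>]
  moreover note card_admissible_large_le[OF \<eta> \<epsilon>, of N "V\<^sup>2"]
  moreover note sum_quad_term_le[OF N, of \<eta> \<epsilon>]
  ultimately show ?thesis by linarith
qed

text \<open>The exponent 72 makes $V^{-1/12} = (1 + \ln N)^{-6}$ beat the factor $(1 + \ln N)^5$ lost in the
  bilinear range.\<close>
lemma admissible_density_0: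
  assumes \<eta>: "\<eta> \<in> {1, -1, 2, -2}" and \<epsilon>: "\<epsilon> \<in> {1, -1}"
  shows "(\<lambda>N. real (card (admissible \<eta> \<epsilon> N)) / real N) \<longlonglongrightarrow> 0"
proof -
  define v where "v = (\<lambda>L::real. (1 + L) ^ 72)"
  \<comment> \<open>The bound of \<open>card_admissible_le\<close> divided by \<open>N\<close>, as a
    function of \<open>L = ln N\<close>. As \<open>V\<close> is \<open>v L\<close> rounded up, it
    lies between \<open>v L\<close> and \<open>2 * v L\<close>, and the condition
    \<open>4 * V ^ 4 \<le> N\<close> follows from \<open>64 * v L ^ 4 \<le> N\<close>. The three
    terms decay like \<open>L powr (-1/2)\<close>, \<open>1 / L\<close> and
    \<open>L powr (-1/4)\<close> up to powers of \<open>ln L\<close>.\<close>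
  define G where "G = (\<lambda>L. 40 / L * sqrt ((1 + 2 * L) * (3 + ln (8 * (2 * v L)\<^sup>2))) * (1 + ln ((2 * v L)\<^sup>2))
    + 20 * (1 / (1 + L)) + 40 / L * weight_factor L * (1 + ln (2 * v L))\<^sup>2)"
  have "(G \<longlongrightarrow> 0) at_top"
    unfolding G_def v_def weight_factor_def by real_asymp
  moreover have "filterlim (\<lambda>N. ln (real N)) at_top sequentially" by real_asymp
  ultimately have lim: "(\<lambda>N. G (ln (real N))) \<longlonglongrightarrow> 0"
    by (rule filterlim_compose)
  have "\<forall>\<^sub>F N::nat in sequentially. 64 * ((1 + ln (real N)) ^ 72) ^ 4 \<le> real N"
    by real_asymp
  then have "\<forall>\<^sub>F N in sequentially. real (card (admissible \<eta> \<epsilon> N)) / real N \<le> G (ln (real N))"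
    using eventually_ge_at_top[of 3]
  proof eventually_elim
    case (elim N)
    define L where "L = ln (real N)"
    define V where "V = nat \<lceil>v L\<rceil>"
    have L: "L > 0" using elim(2) by (simp add: L_def)
    have v1: "v L \<ge> 1" using L by (simp add: v_def)
    have V_ge: "v L \<le> real V" unfolding V_def by (rule real_nat_ceiling_ge)
    have V_le: "real V \<le> 2 * v L"
    proof -
      have "real V = real_of_int \<lceil>v L\<rceil>" using v1 by (simp add: V_def)
      then show ?thesis using v1 ceiling_correct[of "v L"] by linarith
    qed
    have V1: "1 \<le> V" using V_ge v1 by linarith
    have "real (4 * (V\<^sup>2)\<^sup>2) = 4 * real V ^ 4" by (simp flip: power_mult)
    also have "\<dots> \<le> 4 * (2 * v L) ^ 4" using power_mono[OF V_le, of 4] by simp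
    also have "\<dots> = 64 * v L ^ 4" by (simp add: power_mult_distrib)
    also have "\<dots> \<le> real N" using elim(1) by (simp add: v_def L_def)
    finally have NV: "4 * (V\<^sup>2)\<^sup>2 \<le> N" by (simp only: of_nat_le_iff)
    have lnV: "ln (real V) \<le> ln (2 * v L)" "0 \<le> ln (real V)" using V_le V1 by (auto intro!: ln_mono)
    have V2: "real (V\<^sup>2) \<le> (2 * v L)\<^sup>2"
      by (simp only: of_nat_power) (rule power_mono[OF V_le], simp)
    have lnV2: "ln (real (V\<^sup>2)) \<le> ln ((2 * v L)\<^sup>2)" "0 \<le> ln (real (V\<^sup>2))"
      "ln (8 * real (V\<^sup>2)) \<le> ln (8 * (2 * v L)\<^sup>2)" "0 \<le> ln (8 * real (V\<^sup>2))"
    proof -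
      have x: "1 \<le> real (V\<^sup>2)" using V1 by simp
      then show "ln (real (V\<^sup>2)) \<le> ln ((2 * v L)\<^sup>2)" using V2 by (intro ln_mono) linarith+
      show "ln (8 * real (V\<^sup>2)) \<le> ln (8 * (2 * v L)\<^sup>2)" using V2 x by (intro ln_mono) linarith+
      show "0 \<le> ln (real (V\<^sup>2))" "0 \<le> ln (8 * real (V\<^sup>2))"
        using x by (intro ln_ge_zero; linarith)+
    qed
    have small: "small_bound N (V\<^sup>2) \<le> real N * (20 / L * sqrt ((1 + 2 * L) * (3 + ln (8 * (2 * v L)\<^sup>2)))
        * (1 + ln ((2 * v L)\<^sup>2)))"
    proof -
      have "small_bound N (V\<^sup>2) = real N * (20 / L * sqrt ((1 + 2 * L) * (3 + ln (8 * real (V\<^sup>2)))) * (1 + ln (real (V\<^sup>2))))"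
        by (simp add: small_bound_def L_def mult_ac)
      also have "\<dots> \<le> real N * (20 / L * sqrt ((1 + 2 * L) * (3 + ln (8 * (2 * v L)\<^sup>2))) * (1 + ln ((2 * v L)\<^sup>2)))"
        using lnV2 L by (intro mult_left_mono mult_mono real_sqrt_le_mono add_left_mono mult_nonneg_nonneg) auto
      finally show ?thesis .
    qed
    have "real V powr (-1/12) \<le> v L powr (-1/12)"
      using V_ge v1 by (intro powr_mono2') auto
    also have "v L powr (-1/12) = 1 / (1 + L) ^ 6"
    proof -
      have "v L = (1 + L) powr 72" unfolding v_def using L by (intro powr_numeral[symmetric]) simp
      then have "v L powr (-1/12) = (1 + L) powr (72 * (-1/12))" by (simp only: powr_powr)
      also have "\<dots> = (1 + L) powr (- 6)" by simp
      also have "\<dots> = 1 / (1 + L) powr 6" by (rule powr_minus_divide)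
      also have "(1 + L) powr 6 = (1 + L) ^ 6" using L by (intro powr_numeral) simp
      finally show ?thesis .
    qed
    finally have "real V powr (-1/12) \<le> 1 / (1 + L) ^ 6" .
    then have bil: "20 * real N * (1 + L) ^ 5 * real V powr (-1/12) \<le> real N * (20 * (1 / (1 + L)))"
    proof -
      have "20 * real N * (1 + L) ^ 5 * real V powr (-1/12) \<le> 20 * real N * (1 + L) ^ 5 * (1 / (1 + L) ^ 6)"
        using L \<open>real V powr (-1/12) \<le> 1 / (1 + L) ^ 6\<close> by (intro mult_left_mono) auto
      also have "(1 + L) ^ 6 = (1 + L) ^ 5 * (1 + L)" by (simp add: eval_nat_numeral)
      also have "20 * real N * (1 + L) ^ 5 * (1 / ((1 + L) ^ 5 * (1 + L))) = real N * (20 * (1 / (1 + L)))"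
        using L by simp
      finally show ?thesis .
    qed
    have triv: "40 * real N / L * weight_factor L * (1 + ln (real V))\<^sup>2
        \<le> real N * (40 / L * weight_factor L * (1 + ln (2 * v L))\<^sup>2)"
    proof -
      have "40 * real N / L * weight_factor L * (1 + ln (real V))\<^sup>2 = real N * (40 / L * weight_factor L * (1 + ln (real V))\<^sup>2)"
        by (simp add: mult_ac)
      also have "\<dots> \<le> real N * (40 / L * weight_factor L * (1 + ln (2 * v L))\<^sup>2)"
        using lnV L by (intro mult_left_mono power_mono) (auto simp: weight_factor_def)
      finally show ?thesis .
    qed
    have "real (card (admissible \<eta> \<epsilon> N)) \<le> 2 * small_bound N (V\<^sup>2)
      + (20 * real N * (1 + L) ^ 5 * real V powr (-1/12)
      + 40 * real N / L * weight_factor L * (1 + ln (real V))\<^sup>2)"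
      unfolding L_def by (rule card_admissible_le[OF NV V1 \<eta> \<epsilon>])
    also have "\<dots> \<le> 2 * (real N * (20 / L * sqrt ((1 + 2 * L) * (3 + ln (8 * (2 * v L)\<^sup>2)))
        * (1 + ln ((2 * v L)\<^sup>2)))) + (real N * (20 * (1 / (1 + L)))
        + real N * (40 / L * weight_factor L * (1 + ln (2 * v L))\<^sup>2))"
      using small bil triv by linarith
    also have "\<dots> = G L * real N" by (simp add: G_def algebra_simps)
    finally show ?case using elim(2) by (simp add: pos_divide_le_eq L_def)
  qed
  then show ?thesis
    by (intro tendsto_sandwich[OF _ _ tendsto_const lim]) auto
qed

section \<open>Local solubility\<close>

lemma padic_seq_mod:
  assumes "padic_seq p X" "k \<le> K"
  shows "X K mod int p ^ k = X k mod int p ^ k"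
  using assms(2)
proof (induction K rule: dec_induct)
  case (step K)
  have "X (Suc K) mod int p ^ k = X (Suc K) mod int p ^ K mod int p ^ k"
    using step by (simp add: mod_mod_cancel le_imp_power_dvd)
  also have "\<dots> = X K mod int p ^ k"
    using assms(1) step by (simp add: padic_seq_def mod_mod_cancel le_imp_power_dvd)
  finally show ?case using step by simp
qed simp

lemma extract_common_power:
  fixes x y q :: int
  assumes "\<not> (q ^ k dvd x \<and> q ^ k dvd y)"
  obtains t x' y' where "t < k" "x = q ^ t * x'" "y = q ^ t * y'" "\<not> (q dvd x' \<and> q dvd y')"
  using assms
proof (induction k arbitrary: x y thesis)
  case (Suc k)
  show ?case
  proof (cases "q dvd x \<and> q dvd y")
    case False
    then show ?thesis using Suc.prems(1)[of 0 x y] by simp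
  next
    case True
    then obtain x1 y1 where xy: "x = q * x1" "y = q * y1" by blast
    have "\<not> (q ^ k dvd x1 \<and> q ^ k dvd y1)" using Suc.prems(2) xy by (auto simp: mult_dvd_mono)
    then obtain t x' y' where "t < k" "x1 = q ^ t * x'" "y1 = q ^ t * y'" "\<not> (q dvd x' \<and> q dvd y')"
      using Suc.IH by blast
    then show ?thesis using Suc.prems(1)[of "Suc t" x' y'] xy by (simp add: mult.assoc)
  qed
qed simp

lemma qform_scale: "qform a B c (w * x) (w * y) = w ^ 4 * qform a B c x y"
  by (simp add: qform_def algebra_simps eval_nat_numeral)

text \<open>A common factor \<open>p ^ t\<close> of the coordinates comes out of the quartic as
  \<open>p ^ (4 * t)\<close> and forces \<open>p ^ (2 * t)\<close> to divide the third coordinate.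
  Because the point is nonzero modulo \<open>p ^ k\<close>, one has \<open>t < k\<close>, so reading
  the sequences at level \<open>4 * k + N\<close> leaves precision \<open>N\<close> after
  cancellation.\<close>

lemma soluble_Qp_primitive:
  assumes p: "prime p" and sol: "soluble_Qp p a B c"
  obtains x y z :: int where "\<not> (int p dvd x \<and> int p dvd y)" "int p ^ N dvd z\<^sup>2 - qform a B c x y"
proof -
  let ?q = "int p"
  obtain X Y Z k where X: "padic_seq p X" and Y: "padic_seq p Y" and Z: "padic_seq p Z"
    and k: "X k mod ?q ^ k \<noteq> 0 \<or> Y k mod ?q ^ k \<noteq> 0"
    and eq: "\<And>k. (Z k)\<^sup>2 mod ?q ^ k = qform a B c (X k) (Y k) mod ?q ^ k"
    using sol unfolding soluble_Qp_def by blast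
  define K where "K = 4 * k + N"
  have "\<not> (?q ^ k dvd X K \<and> ?q ^ k dvd Y K)"
    using k padic_seq_mod[OF X, of k K] padic_seq_mod[OF Y, of k K] by (auto simp: K_def dvd_eq_mod_eq_0)
  then obtain t x y where t: "t < k" and xy: "X K = ?q ^ t * x" "Y K = ?q ^ t * y"
    "\<not> (?q dvd x \<and> ?q dvd y)"
    by (rule extract_common_power)
  have hom: "qform a B c (X K) (Y K) = ?q ^ (4 * t) * qform a B c x y"
    unfolding xy qform_scale by (simp add: mult.commute flip: power_mult)
  have dvd: "?q ^ K dvd (Z K)\<^sup>2 - ?q ^ (4 * t) * qform a B c x y"
    using eq[of K] unfolding hom by (simp add: mod_eq_dvd_iff)
  have "?q ^ (4 * t) dvd ?q ^ K" using t by (intro le_imp_power_dvd) (simp add: K_def)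
  then have "?q ^ (4 * t) dvd (Z K)\<^sup>2 - ?q ^ (4 * t) * qform a B c x y"
    using dvd by (rule dvd_trans)
  then have "?q ^ (4 * t) dvd (Z K)\<^sup>2" by (simp add: dvd_diff_right_iff dvd_diff_left_iff)
  then have "(?q ^ (2 * t))\<^sup>2 dvd (Z K)\<^sup>2" by (simp flip: power_mult)
  then have "?q ^ (2 * t) dvd Z K" by (simp add: pow_divides_pow_iff)
  then obtain z where z: "Z K = ?q ^ (2 * t) * z" by blast
  have "(Z K)\<^sup>2 - ?q ^ (4 * t) * qform a B c x y = ?q ^ (4 * t) * (z\<^sup>2 - qform a B c x y)"
    by (simp add: z power_mult_distrib algebra_simps flip: power_mult)
  moreover have "?q ^ (4 * t) * ?q ^ N dvd ?q ^ K"
    unfolding power_add[symmetric] using t by (intro le_imp_power_dvd) (simp add: K_def)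
  ultimately have "?q ^ (4 * t) * ?q ^ N dvd ?q ^ (4 * t) * (z\<^sup>2 - qform a B c x y)"
    using dvd dvd_trans by metis
  then have "?q ^ N dvd z\<^sup>2 - qform a B c x y" using prime_gt_0_nat[OF p] by simp
  then show ?thesis using that xy(3) by blast
qed

lemma Legendre_eq_0_iff: "Legendre a (int p) = 0 \<longleftrightarrow> int p dvd a"
  by (simp add: Legendre_def cong_0_iff)

lemma Legendre_square:
  assumes "prime p" "2 < p" "\<not> int p dvd w"
  shows "Legendre (w\<^sup>2) (int p) = 1"
  using Legendre_mult[OF assms(1,2), of w w] Legendre_values[of w p] assms(3) Legendre_eq_0_iff[of w p]
  by (auto simp: power2_eq_square)

lemma Legendre_eq_1I:
  assumes p: "prime p" "2 < p" and "[z\<^sup>2 = a * w\<^sup>2] (mod int p)" "\<not> int p dvd a" "\<not> int p dvd w"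
  shows "Legendre a (int p) = 1"
proof -
  have P: "prime (int p)" using p by simp
  have "\<not> int p dvd z"
  proof
    assume "int p dvd z"
    then have "int p dvd a * w\<^sup>2"
      using assms(3) cong_dvd_iff[of "z\<^sup>2" "a * w\<^sup>2" "int p"] by (simp add: power2_eq_square)
    then show False using assms(4,5) P by (simp add: prime_dvd_mult_iff prime_dvd_power_iff)
  qed
  then have "1 = Legendre (z\<^sup>2) (int p)" using Legendre_square[OF p] by simp
  also have "\<dots> = Legendre (a * w\<^sup>2) (int p)" by (rule Legendre_cong[OF assms(3)])
  also have "\<dots> = Legendre a (int p)" using Legendre_square[OF p assms(5)] by (simp add: Legendre_mult p)
  finally show ?thesis by simp
qed

text \<open>Here \<open>p\<close> divides the middle coefficient and \<open>p^2\<close> divides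
  \<open>c\<close>. If \<open>p\<close> does not divide \<open>x\<close>, reduction modulo
  \<open>p\<close> gives that \<open>a * x ^ 4\<close> is a square. If \<open>p\<close> divides
  \<open>x\<close>, then \<open>p^2\<close> cancels throughout and \<open>c / p^2\<close> is a
  square modulo \<open>p\<close>; its product with \<open>a\<close> is the square of
  \<open>n'\<close>, so \<open>a\<close> is one too. The second case consumes three powers of
  \<open>p\<close>.\<close>

lemma soluble_Qp_not_dvd:
  fixes a c s n' :: int
  assumes p: "prime p" "odd p" and a: "\<not> int p dvd a" and n': "\<not> int p dvd n'"
    and ac: "a * c = (int p * n')\<^sup>2" and sol: "soluble_Qp p a (6 * s * (int p * n')) c"
  shows "Legendre a (int p) = 1"
proof -
  let ?q = "int p"
  have p2: "2 < p" using p odd_prime_gt_2 by blast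
  have P: "prime ?q" using p by simp
  have q0: "?q \<noteq> 0" using P by auto
  have "coprime (?q\<^sup>2) a" using P a by (simp add: prime_imp_coprime)
  moreover have "?q\<^sup>2 dvd a * c" unfolding ac by (simp add: power_mult_distrib)
  ultimately have "?q\<^sup>2 dvd c" by (simp add: coprime_dvd_mult_right_iff)
  then obtain c' where c: "c = ?q\<^sup>2 * c'" by blast
  then have ac': "a * c' = n'\<^sup>2" using ac q0 by (simp add: power_mult_distrib)
  have c': "\<not> ?q dvd c'"
  proof
    assume "?q dvd c'"
    then have "?q dvd n'\<^sup>2" unfolding ac'[symmetric] by simp
    then show False using n' P by (simp add: prime_dvd_power_iff)
  qed
  obtain x y z where xy: "\<not> (?q dvd x \<and> ?q dvd y)"
    and dvd: "?q ^ 3 dvd z\<^sup>2 - qform a (6 * s * (?q * n')) c x y"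
    by (rule soluble_Qp_primitive[OF p(1) sol])
  show ?thesis
  proof (cases "?q dvd x")
    case False
    have "?q dvd ?q ^ 3" by simp
    then have "?q dvd z\<^sup>2 - qform a (6 * s * (?q * n')) c x y" using dvd by (rule dvd_trans)
    moreover have "z\<^sup>2 - a * (x\<^sup>2)\<^sup>2 = (z\<^sup>2 - qform a (6 * s * (?q * n')) c x y) +
        ?q * (6 * s * n' * x\<^sup>2 * y\<^sup>2 + ?q * c' * y ^ 4)"
      by (simp add: qform_def c algebra_simps power2_eq_square eval_nat_numeral)
    ultimately have "?q dvd z\<^sup>2 - a * (x\<^sup>2)\<^sup>2" by (metis dvd_add dvd_triv_left)
    then have "[z\<^sup>2 = a * (x\<^sup>2)\<^sup>2] (mod ?q)" by (simp add: cong_iff_dvd_diff)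
    then show ?thesis
      by (rule Legendre_eq_1I[OF p(1) p2 _ a]) (use False P in \<open>simp add: prime_dvd_power_iff\<close>)
  next
    case True
    then obtain x1 where x: "x = ?q * x1" by blast
    have y: "\<not> ?q dvd y" using xy True by blast
    let ?r = "?q * (?q * a * x1 ^ 4 + 6 * s * n' * x1\<^sup>2 * y\<^sup>2)"
    have q: "qform a (6 * s * (?q * n')) c x y = ?q\<^sup>2 * (?r + c' * (y\<^sup>2)\<^sup>2)"
      by (simp add: qform_def c x algebra_simps eval_nat_numeral)
    have "?q\<^sup>2 dvd ?q ^ 3" by (simp add: le_imp_power_dvd)
    then have "?q\<^sup>2 dvd z\<^sup>2 - ?q\<^sup>2 * (?r + c' * (y\<^sup>2)\<^sup>2)" using dvd unfolding q by (rule dvd_trans)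
    then have "?q\<^sup>2 dvd z\<^sup>2" by (simp add: dvd_diff_left_iff)
    then have "?q dvd z" by (simp add: pow_divides_pow_iff)
    then obtain z1 where z: "z = ?q * z1" by blast
    have "z\<^sup>2 - ?q\<^sup>2 * (?r + c' * (y\<^sup>2)\<^sup>2) = ?q\<^sup>2 * (z1\<^sup>2 - (?r + c' * (y\<^sup>2)\<^sup>2))"
      by (simp add: z power_mult_distrib algebra_simps)
    then have "?q\<^sup>2 * ?q dvd ?q\<^sup>2 * (z1\<^sup>2 - (?r + c' * (y\<^sup>2)\<^sup>2))"
      using dvd unfolding q by (simp add: eval_nat_numeral mult.assoc)
    then have "?q dvd z1\<^sup>2 - (?r + c' * (y\<^sup>2)\<^sup>2)" using q0 by simp
    moreover have "z1\<^sup>2 - c' * (y\<^sup>2)\<^sup>2 = (z1\<^sup>2 - (?r + c' * (y\<^sup>2)\<^sup>2)) + ?r" by simp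
    ultimately have "?q dvd z1\<^sup>2 - c' * (y\<^sup>2)\<^sup>2" by (metis dvd_add dvd_triv_left)
    then have "[z1\<^sup>2 = c' * (y\<^sup>2)\<^sup>2] (mod ?q)" by (simp add: cong_iff_dvd_diff)
    then have "Legendre c' ?q = 1"
      by (rule Legendre_eq_1I[OF p(1) p2 _ c']) (use y P in \<open>simp add: prime_dvd_power_iff\<close>)
    moreover have "Legendre a ?q * Legendre c' ?q = Legendre (n'\<^sup>2) ?q"
      unfolding ac'[symmetric] by (rule Legendre_mult[OF p(1) p2, symmetric])
    ultimately show ?thesis using Legendre_square[OF p(1) p2 n'] by simp
  qed
qed

text \<open>After division by $p$ the form must vanish modulo $p$. Completing the square shows that its
  roots in $x^2/y^2$ are $-s n' (1 \mp s\sqrt{2})^2/a'$, whence both conditions.\<close>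
lemma soluble_Qp_dvd:
  fixes a' c s n' :: int
  assumes p: "prime p" "odd p" and a': "\<not> int p dvd a'" and n': "\<not> int p dvd n'" and s: "s\<^sup>2 = 1"
    and ac: "int p * a' * c = (int p * n')\<^sup>2" and sol: "soluble_Qp p (int p * a') (6 * s * (int p * n')) c"
  shows "Legendre 2 (int p) = 1" "Legendre (- s * (a' * n')) (int p) = 1"
proof -
  let ?q = "int p"
  have p2: "2 < p" using p odd_prime_gt_2 by blast
  have P: "prime ?q" using p by simp
  have q0: "?q \<noteq> 0" using P by auto
  have "a' * c = ?q * n'\<^sup>2" using ac q0 by (simp add: power_mult_distrib power2_eq_square)
  then have "?q dvd a' * c" by simp
  then have "?q dvd c" using a' P by (simp add: prime_dvd_mult_iff)
  then obtain c' where c: "c = ?q * c'" by blast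
  then have ac': "a' * c' = n'\<^sup>2" using \<open>a' * c = ?q * n'\<^sup>2\<close> q0 by simp
  obtain x y z where xy: "\<not> (?q dvd x \<and> ?q dvd y)"
    and dvd: "?q ^ 2 dvd z\<^sup>2 - qform (?q * a') (6 * s * (?q * n')) c x y"
    by (rule soluble_Qp_primitive[OF p(1) sol])
  define G where "G = a' * x ^ 4 + 6 * s * n' * x\<^sup>2 * y\<^sup>2 + c' * y ^ 4"
  have q: "qform (?q * a') (6 * s * (?q * n')) c x y = ?q * G"
    by (simp add: qform_def c G_def algebra_simps)
  have "?q dvd ?q\<^sup>2" by simp
  then have "?q dvd z\<^sup>2 - ?q * G" using dvd unfolding q by (rule dvd_trans)
  then have "?q dvd z\<^sup>2" by (simp add: dvd_diff_left_iff)
  then have "?q dvd z" using P by (simp add: prime_dvd_power_iff)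
  then have "?q\<^sup>2 dvd z\<^sup>2" by (simp add: pow_divides_pow_iff)
  then have "?q\<^sup>2 dvd ?q * G" using dvd unfolding q by (simp add: dvd_diff_right_iff)
  then have G: "?q dvd G" using q0 by (simp add: power2_eq_square)
  \<comment> \<open>Completing the square: \<open>a' * G\<close> equals the square of
    \<open>A\<close> minus twice the square of \<open>u\<close>, because
    \<open>9 * s^2 - 8 = 1\<close>. The coefficient 6 enters exactly here.\<close>
  define A where "A = a' * x\<^sup>2 + 3 * s * n' * y\<^sup>2"
  define u where "u = 2 * n' * y\<^sup>2"
  have "A\<^sup>2 - 2 * u\<^sup>2 = a'\<^sup>2 * x ^ 4 + 6 * s * a' * n' * x\<^sup>2 * y\<^sup>2 + (9 * s\<^sup>2 - 8) * n'\<^sup>2 * y ^ 4"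
    by (simp add: A_def u_def algebra_simps eval_nat_numeral)
  also have "\<dots> = a' * G"
    unfolding s G_def ac'[symmetric] by (simp add: algebra_simps eval_nat_numeral)
  finally have Au: "?q dvd A\<^sup>2 - 2 * u\<^sup>2" using G by simp
  have y: "\<not> ?q dvd y"
  proof
    assume y: "?q dvd y"
    then have "?q dvd a' * x ^ 4 + y * (6 * s * n' * x\<^sup>2 * y + c' * y ^ 3)"
      using G by (simp add: G_def algebra_simps eval_nat_numeral)
    then have "?q dvd a' * x ^ 4" using y by (simp add: dvd_add_left_iff)
    then have "?q dvd x" using a' P by (simp add: prime_dvd_mult_iff prime_dvd_power_iff)
    then show False using xy y by blast
  qed
  have two: "\<not> ?q dvd 2" using p2 by (auto dest: zdvd_imp_le)
  have u: "\<not> ?q dvd u" using two n' y P by (simp add: u_def prime_dvd_mult_iff prime_dvd_power_iff)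
  show leg2: "Legendre 2 ?q = 1"
    using Au by (intro Legendre_eq_1I[OF p(1) p2 _ two u]) (simp add: cong_iff_dvd_diff)
  then have "QuadRes ?q 2" by (auto simp: Legendre_def split: if_splits)
  then obtain r where "[r\<^sup>2 = 2] (mod ?q)" by (auto simp: QuadRes_def)
  then have r: "?q dvd r\<^sup>2 - 2" by (simp add: cong_iff_dvd_diff)
  have "(A - r * u) * (A + r * u) = (A\<^sup>2 - 2 * u\<^sup>2) - u\<^sup>2 * (r\<^sup>2 - 2)"
    by (simp add: algebra_simps power2_eq_square)
  then have "?q dvd (A - r * u) * (A + r * u)" using Au r by simp
  then have "?q dvd A - r * u \<or> ?q dvd A - (- r) * u" using P by (simp add: prime_dvd_mult_iff)
  then obtain t where t: "?q dvd A - t * u" "?q dvd t\<^sup>2 - 2" using r by (metis power2_minus)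
  \<comment> \<open>The product of \<open>1 - s * t\<close> and \<open>1 + s * t\<close> is
    congruent to \<open>1 - 2 = -1\<close>, so both are units.\<close>
  have w: "\<not> ?q dvd 1 - s * t"
  proof
    assume "?q dvd 1 - s * t"
    then have "?q dvd (1 - s * t) * (1 + s * t) + (t\<^sup>2 - 2)" using t(2) by (intro dvd_add) auto
    also have "(1 - s * t) * (1 + s * t) + (t\<^sup>2 - 2) = (1 - s\<^sup>2) * t\<^sup>2 - 1"
      by (simp add: algebra_simps power2_eq_square)
    also have "\<dots> = -1" unfolding s by simp
    finally show False using P by simp
  qed
  \<comment> \<open>From \<open>A\<close> congruent to \<open>t * u\<close> one gets
    \<open>a' * x^2\<close> congruent to \<open>- s * n' * y^2 * (3 - 2 * s * t)\<close>, and
    \<open>3 - 2 * s * t\<close> is congruent to the square of \<open>1 - s * t\<close>, since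
    \<open>t^2\<close> is congruent to 2. Multiplying by \<open>a'\<close> exhibits
    \<open>- s * a' * n'\<close> as a quotient of squares.\<close>
  have "(a' * x)\<^sup>2 - (- s * (a' * n')) * (y * (1 - s * t))\<^sup>2 =
      a' * (A - t * u) + a' * n' * y\<^sup>2 * s * (s\<^sup>2 * (t\<^sup>2 - 2) + 2 * (s\<^sup>2 - 1)) - a' * n' * y\<^sup>2 * 2 * t * (s\<^sup>2 - 1)"
    by (simp add: A_def u_def algebra_simps power2_eq_square)
  also have "\<dots> = a' * (A - t * u) + a' * n' * y\<^sup>2 * s * (t\<^sup>2 - 2)" unfolding s by simp
  finally have "?q dvd (a' * x)\<^sup>2 - (- s * (a' * n')) * (y * (1 - s * t))\<^sup>2" using t by simp
  moreover have "\<not> ?q dvd s"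
  proof
    assume "?q dvd s"
    then have "?q dvd s\<^sup>2" by (simp add: power2_eq_square)
    then show False using P s by simp
  qed
  ultimately show "Legendre (- s * (a' * n')) ?q = 1"
    using a' n' y w P
    by (intro Legendre_eq_1I[OF p(1) p2, of "a' * x" _ "y * (1 - s * t)"])
       (auto simp: cong_iff_dvd_diff prime_dvd_mult_iff)
qed

text \<open>Scaling by a common denominator \<open>D\<close>, which multiplies the third coordinate
  by \<open>D^2\<close>, gives an integral point; it is a real point and, read as constant
  sequences, a point over every p-adic field.\<close>

lemma soluble_imp_locally_soluble:
  assumes "soluble a B c"
  shows "locally_soluble a B c"
proof -
  obtain x y z :: rat where xy: "(x, y) \<noteq> (0, 0)" and eq: "z\<^sup>2 = qform (of_int a) (of_int B) (of_int c) x y"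
    using assms by (auto simp: soluble_def)
  obtain x1 x2 where x: "x = of_int x1 / of_int x2" "x2 \<noteq> 0"
    by (cases x) (auto simp: Fract_of_int_quotient)
  obtain y1 y2 where y: "y = of_int y1 / of_int y2" "y2 \<noteq> 0"
    by (cases y) (auto simp: Fract_of_int_quotient)
  obtain z1 z2 where z: "z = of_int z1 / of_int z2" "z2 \<noteq> 0"
    by (cases z) (auto simp: Fract_of_int_quotient)
  define D where "D = x2 * y2 * z2"
  define X where "X = x1 * y2 * z2"
  define Y where "Y = y1 * x2 * z2"
  define Z where "Z = z1 * x2 * y2 * D"
  have D: "D \<noteq> 0" using x y z by (simp add: D_def)
  have XYZ: "of_int X = x * of_int D" "of_int Y = y * of_int D" "of_int Z = z * of_int D ^ 2"
    using x y z by (simp_all add: X_def Y_def Z_def D_def power2_eq_square)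
  have "(of_int (Z\<^sup>2) :: rat) = of_int (qform a B c X Y)"
  proof -
    have "(of_int (Z\<^sup>2) :: rat) = z\<^sup>2 * of_int D ^ 4"
      by (simp add: XYZ power_mult_distrib flip: power_mult)
    also have "\<dots> = of_int (qform a B c X Y)"
      unfolding eq by (simp add: qform_def XYZ algebra_simps power_mult_distrib flip: power_add)
    finally show ?thesis .
  qed
  then have int: "Z\<^sup>2 = qform a B c X Y" by (simp only: of_int_eq_iff)
  have XY: "X \<noteq> 0 \<or> Y \<noteq> 0"
  proof -
    have "(of_int X :: rat) \<noteq> 0 \<or> (of_int Y :: rat) \<noteq> 0" using xy D by (auto simp: XYZ)
    then show ?thesis by simp
  qed
  have "soluble_R a B c"
    unfolding soluble_R_def
  proof (intro exI conjI)
    show "(real_of_int X, real_of_int Y) \<noteq> (0, 0)" using XY by auto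
    have "(real_of_int Z)\<^sup>2 = real_of_int (qform a B c X Y)" by (simp flip: int)
    then show "(real_of_int Z)\<^sup>2 = qform (real_of_int a) (real_of_int B) (real_of_int c) (real_of_int X) (real_of_int Y)"
      by (simp add: qform_def)
  qed
  moreover have "soluble_Qp p a B c" if p: "prime p" for p
    unfolding soluble_Qp_def
  proof (intro exI conjI)
    show "padic_seq p (\<lambda>_. X)" "padic_seq p (\<lambda>_. Y)" "padic_seq p (\<lambda>_. Z)" by (auto simp: padic_seq_def)
    \<comment> \<open>A nonzero integer has absolute value below \<open>p\<close> raised to that
      absolute value, so this explicit level already detects that it is nonzero.\<close>
    have nz: "W mod int p ^ nat \<bar>W\<bar> \<noteq> 0" if "W \<noteq> 0" for W
    proof
      assume "W mod int p ^ nat \<bar>W\<bar> = 0"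
      then have "int p ^ nat \<bar>W\<bar> dvd W" by (simp add: dvd_eq_mod_eq_0)
      then have "int p ^ nat \<bar>W\<bar> dvd \<bar>W\<bar>" by simp
      then have "int (p ^ nat \<bar>W\<bar>) \<le> int (nat \<bar>W\<bar>)" using that by (simp add: zdvd_imp_le)
      moreover have "nat \<bar>W\<bar> < p ^ nat \<bar>W\<bar>"
        using prime_ge_2_nat[OF p] by (intro power_gt_expt) auto
      ultimately show False by linarith
    qed
    show "X mod int p ^ (if X \<noteq> 0 then nat \<bar>X\<bar> else nat \<bar>Y\<bar>) \<noteq> 0 \<or> Y mod int p ^ (if X \<noteq> 0 then nat \<bar>X\<bar> else nat \<bar>Y\<bar>) \<noteq> 0"
      using nz XY by auto
    show "\<forall>k. Z\<^sup>2 mod int p ^ k = qform a B c X Y mod int p ^ k" by (simp add: int)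
  qed
  ultimately show ?thesis by (simp add: locally_soluble_def)
qed

section \<open>Comparison of the two averages\<close>

text \<open>The multiplicity condition makes \<open>a\<close> squarefree up to sign; its primes
  divide \<open>n^2\<close>, hence \<open>n\<close>, and a squarefree number is the product of its
  primes.\<close>

lemma FF_first_coord:
  assumes "(a, c) \<in> FF B (int n ^ 2)" "n > 0"
  shows "a \<noteq> 0" "squarefree (nat \<bar>a\<bar>)" "nat \<bar>a\<bar> dvd n"
proof -
  have ac: "a * c = int n ^ 2" and mult: "\<And>p. prime p \<Longrightarrow> multiplicity (int p) a \<le> 1"
    using assms(1) by (auto simp: FF_def)
  show a: "a \<noteq> 0" using ac assms(2) by auto
  let ?A = "nat \<bar>a\<bar>"
  have "\<not> p\<^sup>2 dvd ?A" if p: "prime p" for p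
  proof
    assume "p\<^sup>2 dvd ?A"
    then have "int p ^ 2 dvd a" by (simp add: nat_abs_dvd_iff flip: of_nat_power)
    then have "2 \<le> multiplicity (int p) a"
      using a p prime_gt_1_nat[OF p] by (intro multiplicity_geI) auto
    then show False using mult[OF p] by simp
  qed
  then show sq: "squarefree ?A"
    using a by (subst squarefree_factorial_semiring) auto
  have "\<Prod>(prime_factors ?A) dvd n"
  proof (rule prod_primes_dvd)
    fix p assume "p \<in> prime_factors ?A"
    then have p: "prime p" "p dvd ?A" by auto
    then have "int p dvd a" by (simp add: of_nat_dvd_iff flip: nat_abs_dvd_iff)
    then have "int p dvd int n ^ 2" unfolding ac[symmetric] by simp
    then have "p dvd n ^ 2" by (simp flip: of_nat_power)
    then show "p dvd n" using p(1) by (simp add: prime_dvd_power_nat)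
  qed auto
  then show "?A dvd n" using squarefree_eq_prod_primes[OF sq] by simp
qed

lemma finite_FF:
  assumes "n > 0"
  shows "finite (FF B (int n ^ 2))" "inj_on fst (FF B (int n ^ 2))"
proof -
  show inj: "inj_on fst (FF B (int n ^ 2))"
  proof (rule inj_onI)
    fix x y assume xy: "x \<in> FF B (int n ^ 2)" "y \<in> FF B (int n ^ 2)" "fst x = fst y"
    obtain a c c' where *: "x = (a, c)" "y = (a, c')" using xy(3) by (metis prod.collapse)
    then have "a * c = a * c'" "a \<noteq> 0"
      using xy FF_first_coord(1)[OF _ assms] by (auto simp: FF_def)
    then show "x = y" using * by simp
  qed
  have "fst ` FF B (int n ^ 2) \<subseteq> {- int n..int n}"
  proof
    fix a assume "a \<in> fst ` FF B (int n ^ 2)"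
    then obtain c where "(a, c) \<in> FF B (int n ^ 2)" by auto
    then have "nat \<bar>a\<bar> \<le> n" using FF_first_coord(3)[OF _ assms] assms dvd_imp_le by blast
    then show "a \<in> {- int n..int n}" by auto
  qed
  then show "finite (FF B (int n ^ 2))"
    using inj finite_imageD finite_subset finite_atLeastAtMost_int by blast
qed

text \<open>The triples \<open>(\<eta>, \<epsilon>, k)\<close>: \<open>\<eta>\<close> is the sign of
  \<open>a\<close> times its power of 2, \<open>\<epsilon>\<close> is \<open>- s * sgn a\<close>,
  and \<open>k\<close> is the exponent of 2 in \<open>n\<close>. The last is recorded so that
  \<open>n\<close> can be recovered from \<open>d\<close> and \<open>m\<close>.\<close>

definition parameters :: "(int \<times> int \<times> nat) set" where
  "parameters = {1, -1, 2, -2} \<times> {1, -1} \<times> {0, 1}"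

text \<open>Besides the trivial class $a = 1$, a locally soluble form for $n$ comes from an admissible
  pair: $a = \eta d$ and $n = 2^k d m$ with $d$, $m$ odd.\<close>
lemma locally_soluble_imp_admissible:
  assumes n: "n > 0" "squarefree n" and s: "s \<in> {1, -1}"
    and ac: "(a, c) \<in> FF_ls (6 * s * int n) (int n ^ 2)" "a \<noteq> 1" and "n \<le> N"
  shows "\<exists>\<eta> \<epsilon> k d m. (\<eta>, \<epsilon>, k) \<in> parameters \<and> (d, m) \<in> admissible \<eta> \<epsilon> N \<and>
    n = 2 ^ k * d * m \<and> a = \<eta> * int d"
proof -
  have FF: "(a, c) \<in> FF (6 * s * int n) (int n ^ 2)" and ls: "locally_soluble a (6 * s * int n) c"
    using ac(1) by (auto simp: FF_ls_def)
  have acn: "a * c = int n ^ 2" using FF by (auto simp: FF_def)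
  define A where "A = nat \<bar>a\<bar>"
  have a0: "a \<noteq> 0" and sqA: "squarefree A" and dvd: "A dvd n"
    using FF_first_coord[OF FF n(1)] by (auto simp: A_def)
  obtain M where M: "n = A * M" using dvd by blast
  have sqM: "squarefree M" and cop: "coprime A M" using n(2) M squarefree_mult_iff by auto
  have odd_part: "\<exists>j d. x = 2 ^ j * d \<and> odd d \<and> j \<le> (1::nat)" if sq: "squarefree x" for x :: nat
  proof (cases "even x")
    case True
    then obtain y where y: "x = 2 * y" by blast
    have "odd y" using sq y squarefree_mult_iff[of 2 y] by simp
    then show ?thesis using y by (intro exI[of _ 1] exI[of _ y]) auto
  next
    case False
    then show ?thesis by (intro exI[of _ 0] exI[of _ x]) auto
  qed
  obtain j d where d: "A = 2 ^ j * d" "odd d" "j \<le> 1" using odd_part[OF sqA] by blast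
  obtain i m where m: "M = 2 ^ i * m" "odd m" "i \<le> 1" using odd_part[OF sqM] by blast
  define \<eta> where "\<eta> = sgn a * 2 ^ j"
  define \<epsilon> where "\<epsilon> = - s * sgn a"
  have aA: "a = sgn a * int A" using a0 by (simp add: A_def sgn_mult_abs)
  have a: "a = \<eta> * int d" using aA d(1) by (simp add: \<eta>_def)
  have sg: "sgn a = 1 \<or> sgn a = -1" using a0 by (auto simp: sgn_if)
  have ndm: "n = 2 ^ (i + j) * d * m" using M d m by (simp add: power_add mult_ac)
  have ij: "i + j \<le> 1"
  proof (rule ccontr)
    assume "\<not> i + j \<le> 1"
    then have "i = 1" "j = 1" using d m by auto
    then show False using cop d(1) m(1) by simp
  qed
  have sqdm: "squarefree (d * m)"
    using n(2) ndm squarefree_mono[of "d * m" n] by (simp add: mult.assoc)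
  have qp: "soluble_Qp p a (6 * s * int n) c" if "prime p" for p
    using ls that by (auto simp: locally_soluble_def)
  have npn: "\<not> int p dvd int n'" if "prime p" "n = p * n'" for p n'
  proof
    assume "int p dvd int n'"
    then have "p dvd n'" by simp
    then have "p\<^sup>2 dvd n" using that(2) by (simp add: power2_eq_square mult_dvd_mono)
    then show False using n(2) that(1) squarefreeD[of n p] not_prime_unit by blast
  qed
  have leg_m: "Legendre a (int p) = 1" if p: "prime p" "p dvd m" for p
  proof -
    have "odd p" using p m(2) by (auto intro: dvd_trans)
    have "p dvd M" using p m(1) by simp
    then have "\<not> p dvd A" using cop p(1) coprime_common_divisor not_prime_unit by blast
    then have pa: "\<not> int p dvd a" by (simp add: A_def nat_abs_dvd_iff dvd_nat_abs_iff)
    obtain k where "M = p * k" using \<open>p dvd M\<close> by blast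
    then have n': "n = p * (A * k)" using M by (simp add: mult_ac)
    show ?thesis
      using soluble_Qp_not_dvd[OF p(1) \<open>odd p\<close> pa npn[OF p(1) n'], of c s] acn qp[OF p(1)] n' by simp
  qed
  have leg_d: "Legendre 2 (int p) = 1 \<and> Legendre (\<epsilon> * int m) (int p) = 1" if p: "prime p" "p dvd d" for p
  proof -
    have odd_p: "odd p" using p d(2) by (auto intro: dvd_trans)
    then have p2: "2 < p" using p(1) odd_prime_gt_2 by blast
    obtain A' where A': "A = p * A'" using p d(1) by (auto simp: dvd_def mult_ac)
    have n': "n = p * (A' * M)" using M A' by (simp add: mult.assoc)
    have pA': "\<not> int p dvd int (A' * M)" by (rule npn[OF p(1) n'])
    then have pA: "\<not> int p dvd int A'" "\<not> int p dvd int M" by auto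
    have aA': "a = int p * (sgn a * int A')" using arg_cong[OF A', of int] aA by (simp add: mult.left_commute)
    have nd: "\<not> int p dvd sgn a * int A'" using pA(1) sg by auto
    have s2: "s\<^sup>2 = 1" using s by auto
    have "int p * (sgn a * int A') * c = (int p * int (A' * M))\<^sup>2"
      using acn n' aA' by simp
    moreover have "soluble_Qp p (int p * (sgn a * int A')) (6 * s * (int p * int (A' * M))) c"
      using qp[OF p(1)] aA' n' by simp
    ultimately have l: "Legendre 2 (int p) = 1" "Legendre (- s * (sgn a * int A' * int (A' * M))) (int p) = 1"
      using soluble_Qp_dvd[OF p(1) odd_p nd pA' s2, of c] by auto
    \<comment> \<open>The local condition at \<open>p\<close> concerns the cofactors of
      \<open>p\<close> in \<open>a\<close> and \<open>n\<close>. Up to the square of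
      \<open>A'\<close> their product is \<open>\<epsilon> * m\<close> times a power of 2, and 2 is
      already known to be a residue.\<close>
    have "- s * (sgn a * int A' * int (A' * M)) = \<epsilon> * int m * (2 ^ i * (int A')\<^sup>2)"
      by (simp add: \<epsilon>_def m(1) power2_eq_square mult_ac)
    then have "Legendre (\<epsilon> * int m) (int p) * (Legendre (2 ^ i) (int p) * Legendre ((int A')\<^sup>2) (int p)) = 1"
      using l(2) by (simp only: Legendre_mult[OF p(1) p2])
    moreover have "Legendre ((int A')\<^sup>2) (int p) = 1" by (rule Legendre_square[OF p(1) p2 pA(1)])
    moreover have "Legendre (2 ^ i) (int p) = 1"
    proof -
      have "i = 0 \<or> i = 1" using m(3) by auto
      then show ?thesis
        using l(1) jacobi_one_left[OF odd_p] jacobi_prime[OF p(1), of 1] by auto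
    qed
    ultimately show ?thesis using l(1) by simp
  qed
  have "(d, m) \<in> admissible \<eta> \<epsilon> N"
  proof -
    have "d * m \<le> 2 ^ (i + j) * (d * m)" by simp
    also have "\<dots> = n" using ndm by (simp add: mult.assoc)
    also have "\<dots> \<le> N" by (rule assms(6))
    finally have "d * m \<le> N" .
    then show ?thesis
      unfolding admissible_def split_set_def mem_Collect_eq case_prod_conv
      using d(2) m(2) sqdm ac(2) leg_m leg_d unfolding a by blast
  qed
  moreover have "(\<eta>, \<epsilon>, i + j) \<in> parameters"
  proof -
    have j: "j = 0 \<or> j = 1" using d(3) by auto
    have 1: "\<sigma> * 2 ^ j \<in> {1, -1, 2, -2}" if "\<sigma> = 1 \<or> \<sigma> = -1" for \<sigma> :: int
      using that j by (elim disjE) simp_all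
    have 2: "- s * \<sigma> \<in> {1, -1}" if "\<sigma> = 1 \<or> \<sigma> = -1" for \<sigma> :: int
      using that s by (elim disjE) auto
    have 3: "i + j \<in> {0, 1}" using ij by auto
    show ?thesis
      unfolding parameters_def \<eta>_def \<epsilon>_def by (intro SigmaI 1[OF sg] 2[OF sg] 3)
  qed
  ultimately show ?thesis using ndm a
    by (intro exI[of _ \<eta>] exI[of _ \<epsilon>] exI[of _ "i + j"] exI[of _ d] exI[of _ m] conjI)
qed

text \<open>An upper bound for the number of locally soluble forms with \<open>a\<close> different
  from 1 over all squarefree \<open>n \<le> N\<close>.\<close>

definition excess :: "nat \<Rightarrow> real" where
  "excess N = (\<Sum>(\<eta>, \<epsilon>, k)\<in>parameters. real (card (admissible \<eta> \<epsilon> N)))"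

lemma finite_parameters: "finite parameters"
  by (simp add: parameters_def)

lemma excess_density_0: "(\<lambda>N. excess N / real N) \<longlonglongrightarrow> 0"
proof -
  have "(\<lambda>N. \<Sum>x\<in>parameters. real (card (admissible (fst x) (fst (snd x)) N)) / real N) \<longlonglongrightarrow> (\<Sum>x\<in>parameters. 0)"
    by (intro tendsto_sum admissible_density_0) (auto simp: parameters_def)
  then show ?thesis by (simp add: excess_def sum_divide_distrib case_prod_beta)
qed

lemma sum_card_FF_ls_le:
  assumes s: "s \<in> {1, -1}"
  shows "(\<Sum>n | n \<in> {1..N} \<and> squarefree n. real (card (FF_ls (6 * s * int n) (int n ^ 2))))
    \<le> real (card {n \<in> {1..N}. squarefree n}) + excess N"
proof -
  define S where "S = {n \<in> {1..N}. squarefree n}"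
  define F where "F = (\<lambda>n. fst ` FF_ls (6 * s * int n) (int n ^ 2))"
  have finS: "finite S" by (simp add: S_def)
  have finF: "finite (F n)" and cardF: "card (FF_ls (6 * s * int n) (int n ^ 2)) = card (F n)" if "n \<in> S" for n
  proof -
    have sub: "FF_ls (6 * s * int n) (int n ^ 2) \<subseteq> FF (6 * s * int n) (int n ^ 2)" by (auto simp: FF_ls_def)
    have "n > 0" using that by (simp add: S_def)
    then show "finite (F n)" "card (FF_ls (6 * s * int n) (int n ^ 2)) = card (F n)"
      using finite_FF[of n "6 * s * int n"] sub unfolding F_def
      by (auto intro: finite_subset card_image[symmetric] inj_on_subset)
  qed
  define T where "T = (SIGMA x:parameters. admissible (fst x) (fst (snd x)) N)"
  \<comment> \<open>Recovers \<open>(n, a)\<close> from the parameters and the admissible pair, so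
    the forms with \<open>a\<close> different from 1 lie in the image of a set of known size;
    injectivity plays no part in an upper bound.\<close>
  define g where "g = (\<lambda>((\<eta> :: int, \<epsilon> :: int, k :: nat), (d :: nat, m :: nat)). (2 ^ k * d * m, \<eta> * int d))"
  have finT: "finite T" unfolding T_def by (intro finite_SigmaI finite_parameters finite_admissible)
  have "card (F n) \<le> 1 + card (F n - {1})" if "n \<in> S" for n
    using card_Diff_singleton_if[of "F n" 1] by (auto split: if_splits)
  then have "(\<Sum>n\<in>S. card (FF_ls (6 * s * int n) (int n ^ 2))) \<le> (\<Sum>n\<in>S. 1 + card (F n - {1}))"
    using cardF by (intro sum_mono) auto
  also have "\<dots> = card S + card (SIGMA n:S. F n - {1})"
    using finS finF by (simp only: sum.distrib) (subst card_SigmaI, auto)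
  also have "card (SIGMA n:S. F n - {1}) \<le> card (g ` T)"
  proof (rule card_mono)
    show "(SIGMA n:S. F n - {1}) \<subseteq> g ` T"
    proof
      fix x assume x: "x \<in> (SIGMA n:S. F n - {1})"
      obtain n a where x': "x = (n, a)" by (cases x)
      have n: "n > 0" "squarefree n" "n \<le> N" using x x' by (auto simp: S_def)
      obtain c where "(a, c) \<in> FF_ls (6 * s * int n) (int n ^ 2)" "a \<noteq> 1"
        using x x' by (auto simp: F_def)
      from locally_soluble_imp_admissible[OF n(1,2) s this n(3)]
      obtain \<eta> \<epsilon> k d m where *: "(\<eta>, \<epsilon>, k) \<in> parameters" "(d, m) \<in> admissible \<eta> \<epsilon> N"
        "n = 2 ^ k * d * m" "a = \<eta> * int d" by blast
      then have "((\<eta>, \<epsilon>, k), (d, m)) \<in> T" by (simp add: T_def)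
      moreover have "g ((\<eta>, \<epsilon>, k), (d, m)) = x" using * x' by (simp add: g_def)
      ultimately show "x \<in> g ` T" by (metis imageI)
    qed
  qed (use finT in simp)
  also have "card (g ` T) \<le> card T" by (rule card_image_le[OF finT])
  also have "card T = (\<Sum>x\<in>parameters. card (admissible (fst x) (fst (snd x)) N))"
    unfolding T_def by (rule card_SigmaI) (auto simp: finite_parameters finite_admissible)
  finally have "(\<Sum>n\<in>S. card (FF_ls (6 * s * int n) (int n ^ 2)))
      \<le> card S + (\<Sum>x\<in>parameters. card (admissible (fst x) (fst (snd x)) N))" by simp
  then have "real (\<Sum>n\<in>S. card (FF_ls (6 * s * int n) (int n ^ 2)))
      \<le> real (card S + (\<Sum>x\<in>parameters. card (admissible (fst x) (fst (snd x)) N)))"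
    by (simp only: of_nat_le_iff)
  then show ?thesis by (simp add: S_def excess_def case_prod_beta)
qed

lemma card_FF_sol:
  assumes "n > 0"
  shows "1 \<le> card (FF_sol B (int n ^ 2))" "card (FF_sol B (int n ^ 2)) \<le> card (FF_ls B (int n ^ 2))"
proof -
  have fin: "finite (FF_ls B (int n ^ 2))"
    by (rule finite_subset[OF _ finite_FF(1)[OF assms]]) (auto simp: FF_ls_def)
  have sub: "FF_sol B (int n ^ 2) \<subseteq> FF_ls B (int n ^ 2)"
    using soluble_imp_locally_soluble by (auto simp: FF_sol_def FF_ls_def)
  then show "card (FF_sol B (int n ^ 2)) \<le> card (FF_ls B (int n ^ 2))"
    by (intro card_mono fin)
  have "soluble 1 B (int n ^ 2)"
    unfolding soluble_def by (intro exI[of _ 1] exI[of _ 0] conjI) (auto simp: qform_def)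
  then have "(1, int n ^ 2) \<in> FF_sol B (int n ^ 2)"
    by (auto simp: FF_sol_def FF_def)
  then have "FF_sol B (int n ^ 2) \<noteq> {}" by blast
  then show "1 \<le> card (FF_sol B (int n ^ 2))"
    using finite_subset[OF sub fin] by (simp add: Suc_le_eq card_gt_0_iff)
qed

text \<open>A union bound over all \<open>k \<ge> 2\<close> whose square divides \<open>n\<close>;
  the sum of \<open>1 / k^2\<close> telescopes to at most \<open>3/4\<close>. Any positive density
  serves to make an error of size \<open>o(N)\<close> negligible.\<close>

lemma card_squarefree_ge: "real (card {n \<in> {1..N}. squarefree n}) \<ge> real N / 4"
proof -
  have tel: "(\<Sum>k\<in>{2..K}. 1 / real k ^ 2) \<le> 3/4 - 1 / real K" if "K \<ge> 2" for K
    using that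
  proof (induction K rule: dec_induct)
    case (step K)
    have "1 / (real K + 1) ^ 2 \<le> 1 / (real K * (real K + 1))"
      using step by (intro divide_left_mono) (auto simp: power2_eq_square)
    also have "\<dots> = 1 / real K - 1 / (real K + 1)" using step by (simp add: field_simps)
    finally show ?case using step by (simp add: add.commute)
  qed simp
  have tel': "(\<Sum>k\<in>{2..K}. 1 / real k ^ 2) \<le> 3/4" for K
  proof (cases "K \<ge> 2")
    case True
    have "0 \<le> 1 / real K" by simp
    then show ?thesis using tel[OF True] by linarith
  qed auto
  define Q where "Q = (\<lambda>k. {n \<in> {1..N}. k\<^sup>2 dvd n})"
  have cardQ: "real (card (Q k)) \<le> real N * (1 / real k ^ 2)" if "k \<in> {2..N}" for k
  proof -
    have "Q k \<subseteq> (\<lambda>i. k\<^sup>2 * i) ` {1..N div k\<^sup>2}"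
    proof
      fix n assume n: "n \<in> Q k"
      then obtain i where i: "n = k\<^sup>2 * i" by (auto simp: Q_def)
      then show "n \<in> (\<lambda>i. k\<^sup>2 * i) ` {1..N div k\<^sup>2}"
        using n that by (intro image_eqI[of _ _ i])
          (auto simp: Q_def less_eq_div_iff_mult_less_eq mult.commute Suc_le_eq intro!: Nat.gr0I)
    qed
    then have "card (Q k) \<le> card ((\<lambda>i. k\<^sup>2 * i) ` {1..N div k\<^sup>2})" by (intro card_mono) auto
    also have "\<dots> \<le> N div k\<^sup>2" using card_image_le[of "{1..N div k\<^sup>2}" "\<lambda>i. k\<^sup>2 * i"] by simp
    finally have "real (card (Q k)) \<le> real (N div k\<^sup>2)" by simp
    also have "\<dots> \<le> real N / real (k\<^sup>2)" by (rule of_nat_div_le_of_nat)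
    finally show ?thesis by simp
  qed
  have "{1..N} \<subseteq> {n \<in> {1..N}. squarefree n} \<union> (\<Union>k\<in>{2..N}. Q k)"
  proof
    fix n assume n: "n \<in> {1..N}"
    show "n \<in> {n \<in> {1..N}. squarefree n} \<union> (\<Union>k\<in>{2..N}. Q k)"
    proof (cases "squarefree n")
      case False
      then obtain k where k: "k\<^sup>2 dvd n" "\<not> k dvd 1" by (rule not_squarefreeE)
      have "k\<^sup>2 \<le> n" using k(1) n by (intro dvd_imp_le) auto
      moreover have "k \<le> k\<^sup>2" by (simp add: power2_eq_square)
      moreover have "k \<noteq> 0" using k(1) n by (intro notI) auto
      ultimately have "k \<in> {2..N}" using k(2) n by (cases "k = 1") auto
      then show ?thesis using k(1) n by (auto simp: Q_def)
    qed (use n in auto)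
  qed
  then have "card {1..N} \<le> card ({n \<in> {1..N}. squarefree n} \<union> (\<Union>k\<in>{2..N}. Q k))"
    by (intro card_mono) (auto simp: Q_def)
  also have "\<dots> \<le> card {n \<in> {1..N}. squarefree n} + card (\<Union>k\<in>{2..N}. Q k)" by (rule card_Un_le)
  also have "card (\<Union>k\<in>{2..N}. Q k) \<le> (\<Sum>k\<in>{2..N}. card (Q k))" by (rule card_UN_le) simp
  finally have "real N \<le> real (card {n \<in> {1..N}. squarefree n}) + (\<Sum>k\<in>{2..N}. real (card (Q k)))"
    by (simp flip: of_nat_sum of_nat_add)
  also have "(\<Sum>k\<in>{2..N}. real (card (Q k))) \<le> (\<Sum>k\<in>{2..N}. real N * (1 / real k ^ 2))"
    by (rule sum_mono[OF cardQ])
  also have "\<dots> = real N * (\<Sum>k\<in>{2..N}. 1 / real k ^ 2)" by (simp add: sum_distrib_left)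
  also have "\<dots> \<le> real N * (3/4)" by (intro mult_left_mono tel') auto
  finally show ?thesis by simp
qed

text \<open>The solvable form \<open>a = 1\<close> puts the numerator above the number of squarefree
  \<open>n\<close>, while the denominator exceeds that number by at most \<open>excess N\<close>.
  Hence the ratio differs from 1 by at most \<open>excess N / (N / 4)\<close>.\<close>

lemma ratio_tendsto_1:
  assumes s: "s \<in> {1, -1}"
  shows "((\<lambda>X::real. (\<Sum>n\<in>{n::nat. 0 < n \<and> real n < X \<and> squarefree n}.
              real (card (FF_sol (6 * s * int n) (int n ^ 2))))
          / (\<Sum>n\<in>{n::nat. 0 < n \<and> real n < X \<and> squarefree n}.
              real (card (FF_ls (6 * s * int n) (int n ^ 2))))) \<longlongrightarrow> 1) at_top"
proof -
  define S where "S = (\<lambda>N::nat. {n. n \<in> {1..N} \<and> squarefree n})"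
  define sol where "sol = (\<lambda>N. \<Sum>n\<in>S N. real (card (FF_sol (6 * s * int n) (int n ^ 2))))"
  define ls where "ls = (\<lambda>N. \<Sum>n\<in>S N. real (card (FF_ls (6 * s * int n) (int n ^ 2))))"
  have "(\<lambda>N. sol N / ls N) \<longlonglongrightarrow> 1"
  proof (rule LIM_zero_cancel, rule tendsto_norm_zero_cancel, rule tendsto_sandwich[OF _ _ tendsto_const])
    have "(\<lambda>N. 4 * (excess N / real N)) \<longlonglongrightarrow> 4 * 0"
      by (intro tendsto_mult tendsto_const excess_density_0)
    then show "(\<lambda>N. 4 * (excess N / real N)) \<longlonglongrightarrow> 0" by simp
    show "\<forall>\<^sub>F N in sequentially. 0 \<le> norm (sol N / ls N - 1)" by simp
    show "\<forall>\<^sub>F N in sequentially. norm (sol N / ls N - 1) \<le> 4 * (excess N / real N)"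
      using eventually_gt_at_top[of 0]
    proof eventually_elim
      case (elim N)
      have "real (card (S N)) = (\<Sum>n\<in>S N. 1)" by simp
      also have "\<dots> \<le> sol N"
        unfolding sol_def
      proof (rule sum_mono)
        fix n assume "n \<in> S N"
        then show "1 \<le> real (card (FF_sol (6 * s * int n) (int n ^ 2)))"
          using card_FF_sol(1)[of n "6 * s * int n"] by (simp add: S_def)
      qed
      finally have 1: "real (card (S N)) \<le> sol N" .
      have 2: "sol N \<le> ls N"
        unfolding sol_def ls_def by (intro sum_mono) (auto simp: S_def intro!: card_FF_sol(2))
      have 3: "ls N \<le> real (card (S N)) + excess N"
        using sum_card_FF_ls_le[OF s, of N] by (simp add: ls_def S_def)
      have 4: "real N / 4 \<le> real (card (S N))"
        using card_squarefree_ge[of N] by (simp add: S_def)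
      have pos: "ls N > 0" using 1 2 4 elim by simp
      have "norm (sol N / ls N - 1) = (ls N - sol N) / ls N"
        using 2 pos by (simp add: field_simps abs_if)
      also have "\<dots> \<le> excess N / (real N / 4)"
        using 1 2 3 4 elim by (intro frac_le) auto
      finally show ?case by (simp add: mult.commute)
    qed
  qed
  \<comment> \<open>The inequality \<open>n < X\<close> is strict, so the largest integer in range
    is the ceiling of \<open>X\<close> minus 1, also when \<open>X\<close> is an integer.\<close>
  moreover have "filterlim (\<lambda>X::real. nat (\<lceil>X\<rceil> - 1)) sequentially at_top"
    unfolding filterlim_at_top
  proof
    fix Z :: nat
    show "\<forall>\<^sub>F X::real in at_top. Z \<le> nat (\<lceil>X\<rceil> - 1)"
      using eventually_gt_at_top[of "real Z"]
    proof eventually_elim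
      case (elim X)
      then have "int Z < \<lceil>X\<rceil>" by (simp add: less_ceiling_iff)
      then show ?case by (simp add: le_nat_iff)
    qed
  qed
  ultimately have "((\<lambda>X::real. sol (nat (\<lceil>X\<rceil> - 1)) / ls (nat (\<lceil>X\<rceil> - 1))) \<longlongrightarrow> 1) at_top"
    by (rule filterlim_compose)
  moreover have "{n::nat. 0 < n \<and> real n < X \<and> squarefree n} = S (nat (\<lceil>X\<rceil> - 1))" for X :: real
  proof -
    have "real n < X \<longleftrightarrow> n \<le> nat (\<lceil>X\<rceil> - 1)" if "n > 0" for n
    proof -
      have "real n < X \<longleftrightarrow> int n < \<lceil>X\<rceil>" by (simp add: less_ceiling_iff)
      also have "\<dots> \<longleftrightarrow> n \<le> nat (\<lceil>X\<rceil> - 1)" using that by linarith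
      finally show ?thesis .
    qed
    then show ?thesis by (auto simp: S_def Suc_le_eq)
  qed
  ultimately show ?thesis by (simp add: sol_def ls_def)
qed

theorem theorem4p3:
  shows "((\<lambda>X::real. (\<Sum>n\<in>{n::nat. 0 < n \<and> real n < X \<and> squarefree n}.
              real (card (FF_sol (6 * int n) (int n ^ 2))))
          / (\<Sum>n\<in>{n::nat. 0 < n \<and> real n < X \<and> squarefree n}.
              real (card (FF_ls (6 * int n) (int n ^ 2))))) \<longlongrightarrow> 1) at_top
    \<and> ((\<lambda>X::real. (\<Sum>n\<in>{n::nat. 0 < n \<and> real n < X \<and> squarefree n}.
              real (card (FF_sol (- 6 * int n) (int n ^ 2))))
          / (\<Sum>n\<in>{n::nat. 0 < n \<and> real n < X \<and> squarefree n}.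
              real (card (FF_ls (- 6 * int n) (int n ^ 2))))) \<longlongrightarrow> 1) at_top"
  using ratio_tendsto_1[of 1] ratio_tendsto_1[of "-1"] by simp

end
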